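(* Let $w>0$ be real, let $\alpha,\beta>0$, and let $n\ge1$ be an integer with $\frac1{n+1}\le\alpha\beta\le\frac1n$. Let $\gamma=S^{-1}g$ be the canonical dual window of the Gabor frame generated by the Cauchy kernel $g(t)=\frac{1}{t-iw}$. (i) If $n$ is even, put $\lambda=\frac1{2\alpha}-\frac n2\beta$. Then $$\gamma(t)=\frac{\alpha}{\pi}\sin\left(\frac{\pi}{\alpha}(t+iw)\right)\Biggl(e^{2\pi (n-2)\beta w}\,\frac{e^{4\pi\beta w}-1}{e^{4\pi\beta wn}-1}\,e^{-\pi\beta (n-2)(w+it)}\,\frac{e^{2\pi\beta n(w+it)}-1}{e^{2\pi\beta(w+it)}-1}\,e^{(\pi it-\pi w)\beta}\,\frac{\sin(\pi(\beta-2\lambda)(t+iw))}{\pi(t+iw)}$$ $$\qquad+\,e^{2\pi n\beta w}\,\frac{e^{4\pi\beta w}-1}{e^{4\pi\beta w(n+1)}-1}\,e^{-\pi\beta n(w+it)}\,\frac{e^{2\pi\beta(n+1)(w+it)}-1}{e^{2\pi\beta(w+it)}-1}\,\frac{\sin(2\pi\lambda(t+iw))}{\pi(t+iw)}\Biggr).$$ (ii) If $n$ is odd, put $\delta=\frac{n+1}2\beta-\frac1{2\alpha}$. Then $$\gamma(t)=\frac{\alpha}{\pi}\sin\left(\frac{\pi}{\alpha}(t+iw)\right)\Biggl(e^{2\pi(n-1)\beta w}\,\frac{e^{4\pi\beta w}-1}{e^{4\pi\beta w(n+1)}-1}\,e^{-\pi\beta(n+1)(w+it)}\,\frac{e^{2\pi\beta(n+1)(w+it)}-1}{e^{2\pi\beta(w+it)}-1}\,e^{(\pi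 it-\pi w)\beta}\,\frac{\sin(\pi(\beta-2\delta)(t+iw))}{\pi(t+iw)}$$ $$\qquad+\,e^{2\pi(n-1)\beta w}\,\frac{e^{4\pi\beta w}-1}{e^{4\pi\beta wn}-1}\,e^{-\pi\beta(n-1)(w+it)}\,\frac{e^{2\pi\beta n(w+it)}-1}{e^{2\pi\beta(w+it)}-1}\,\frac{\sin(2\pi\delta(t+iw))}{\pi(t+iw)}\Biggr).$$
   Context: For $m,k\in\mathbb{Z}$ put $g_{m,k}(t)=\dfrac{e^{2\pi i\beta k t}}{t-\alpha m-iw}$, $t\in\mathbb{R}$. The system $\{g_{m,k}\}_{m,k\in\mathbb{Z}}$ is known to be a frame in $L^2(\mathbb{R})$ for all $\alpha\beta\le1$. With $\langle f,g\rangle=\int_{\mathbb{R}}f\overline g$, its frame operator is $$Sf=\sum_{m,k\in\mathbb{Z}}\langle f,g_{m,k}\rangle g_{m,k},\qquad f\in L^2(\mathbb{R}),$$ which is bounded and invertible on $L^2(\mathbb{R})$; the canonical dual window is $\gamma=S^{-1}g$.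
   Formalization: Two misprints are corrected: in (i) the factor e^{(πit−πw)β} becomes e^{−(πit−πw)β}; in (ii) the leading factor e^{2π(n−1)βw} of the first summand becomes e^{2π(n+1)βw}. As printed, (i) for n and (ii) for n−1 contradict each other at αβ=1/n, n even. *)

theory Defs
  imports "HOL-Analysis.Analysis"
begin

text \<open>
  Elements of \<open>L\<^sup>2(\<real>)\<close> are represented by square-integrable Borel functions; equality in
  \<open>L\<^sup>2(\<real>)\<close> is equality almost everywhere.
\<close>

definition L2 :: "(real \<Rightarrow> complex) set" where
  "L2 = {f. f \<in> borel_measurable lborel \<and> integrable lborel (\<lambda>t. (cmod (f t))\<^sup>2)}"

definition L2_inner :: "(real \<Rightarrow> complex) \<Rightarrow> (real \<Rightarrow> complex) \<Rightarrow> complex" where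
  "L2_inner f g = (LINT t|lborel. f t * cnj (g t))"

definition L2_norm :: "(real \<Rightarrow> complex) \<Rightarrow> real" where
  "L2_norm f = sqrt (LINT t|lborel. (cmod (f t))\<^sup>2)"

text \<open>
  \<open>frame_operator_maps G f h\<close> says \<open>S f = h\<close> for the frame operator
  \<open>S f = (\<Sum>j. \<langle>f, G j\<rangle> G j)\<close> of the family \<open>G\<close>. The series converges unconditionally in the
  norm of \<open>L\<^sup>2(\<real>)\<close>, i.e. along the net of all finite sets of indices. It is a relation
  because \<open>S f\<close> is determined only up to equality almost everywhere.
\<close>

definition frame_operator_maps ::
    "('i \<Rightarrow> real \<Rightarrow> complex) \<Rightarrow> (real \<Rightarrow> complex) \<Rightarrow> (real \<Rightarrow> complex) \<Rightarrow> bool" where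
  "frame_operator_maps G f h \<longleftrightarrow> f \<in> L2 \<and> h \<in> L2 \<and>
     ((\<lambda>J. L2_norm (\<lambda>t. (\<Sum>j\<in>J. L2_inner f (G j) * G j t) - h t)) \<longlongrightarrow> 0)
       (finite_subsets_at_top UNIV)"

definition gabor_system ::
    "real \<Rightarrow> real \<Rightarrow> (real \<Rightarrow> complex) \<Rightarrow> int \<times> int \<Rightarrow> real \<Rightarrow> complex" where
  "gabor_system \<alpha> \<beta> g = (\<lambda>(m, k) t.
     exp (2 * of_real pi * \<i> * of_real \<beta> * of_int k * of_real t) * g (t - \<alpha> * of_int m))"

text \<open>\<open>\<gamma> = S\<^sup>-\<^sup>1 g\<close>, stated as \<open>S \<gamma> = g\<close>.\<close>

definition canonical_dual_window ::
    "real \<Rightarrow> real \<Rightarrow> (real \<Rightarrow> complex) \<Rightarrow> (real \<Rightarrow> complex) \<Rightarrow> bool" where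
  "canonical_dual_window \<alpha> \<beta> g \<gamma> \<longleftrightarrow> frame_operator_maps (gabor_system \<alpha> \<beta> g) \<gamma> g"

definition cauchy_kernel :: "real \<Rightarrow> real \<Rightarrow> complex" where
  "cauchy_kernel w t = 1 / (of_real t - \<i> * of_real w)"

end

(* The Fourier transform of the Cauchy kernel is a one-sided exponential, so on the frequency side
   the Gabor system consists of modulated one-sided exponentials started at the points beta*k.

   Uniqueness: if f is orthogonal to the system, then
   K(xi) = int f(t) exp(-2 pi i xi (t + iw)) / (t + iw) dt vanishes at the points beta*k, and the
   nonzero Fourier coefficients of K on [beta*k, beta*(k+1)], extended by 0 to length 1/alpha,
   vanish by partial fractions. Hence K = 0 and f = 0.

   Existence: for an interval [a, b] of frequencies put z = t + iw, zeta = t - iw,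
   L = 2 pi / alpha and phi(t) = (1 - exp(i L z)) (exp(i a z) - exp(i b z)) / z. If no point
   2 pi beta k or 2 pi beta k - L lies inside (a, b), only finitely many k contribute to S phi, and
   summing over m by a Fourier series gives
   S phi = 2 pi L W (exp(i zeta a) - exp(i zeta b)) / (zeta (1 - exp(-i zeta L))),
   where W is the sum of exp(-4 pi beta w k) over the contributing k. Dividing by the W's and
   summing over the 2n + 1 intervals into which these points cut [-L, 0] makes the right-hand side
   telescope to 1 / zeta. The even and the odd formula are the same sum of 2n + 1 terms. *)

theory Submission
  imports Defs "HOL-Probability.Probability"
begin

section \<open>Uniqueness of Fourier coefficients\<close>

text \<open>The dual window is characterised by an equivalence, so the solution of
  \<open>S \<gamma> = g\<close> must also be unique up to null sets; equal images under
  \<open>S\<close> force equal coefficients, which is why completeness of the system is enough.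
  Completeness uses \<alpha>\<beta> \<le> 1 to fit an interval of length \<beta> into a period
  1/\<alpha>. The obstacle there is that partial fractions separate only distinct poles, so the
  zeroth Fourier coefficient, a double pole, stays unknown. It is replaced by continuity and the
  value at an endpoint, and the same device sums the series over \<open>m\<close>. The factor 1 -
  exp(i L z) in phi subtracts a copy shifted by one period L. By periodicity this cancels the
  contributions of all large \<open>k\<close>, which would otherwise be infinitely many. The points
  2 pi beta (k - n) and 2 pi beta k - L interlace because n \<beta> \<le> 1/\<alpha> \<le> (n+1)
  \<beta>. Between consecutive points n+1 or n consecutive \<open>k\<close> contribute, alternately,
  so each W is a geometric sum; this is the origin of the quotients with n+1 and n in the
  formula.\<close>

lemma integral_cos_polynomial_eq_0:
  fixes h :: "real \<Rightarrow> real"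
  assumes L: "L > 0" and cont: "continuous_on {0..L} h"
    and mom: "\<And>j::nat. integral {0..L} (\<lambda>x. h x * cos (2 * pi * x / L) ^ j) = 0"
    and p: "real_polynomial_function p"
  shows "integral {0..L} (\<lambda>x. h x * p (cos (2 * pi * x / L))) = 0"
proof -
  obtain a :: "nat \<Rightarrow> real" and n where pn: "p = (\<lambda>x. \<Sum>i\<le>n. a i * x ^ i)"
    using p real_polynomial_function_iff_sum by metis
  have int: "(\<lambda>x. h x * cos (2 * pi * x / L) ^ j) integrable_on {0..L}" for j :: nat
    using L by (intro integrable_continuous_real continuous_intros cont) auto
  have "integral {0..L} (\<lambda>x. h x * p (cos (2 * pi * x / L)))
      = integral {0..L} (\<lambda>x. \<Sum>i\<le>n. a i * (h x * cos (2 * pi * x / L) ^ i))"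
    by (simp add: pn sum_distrib_left mult.left_commute)
  also have "\<dots> = (\<Sum>i\<le>n. a i * integral {0..L} (\<lambda>x. h x * cos (2 * pi * x / L) ^ i))"
    by (subst integral_sum) (auto intro!: integrable_on_mult_right int)
  finally show ?thesis by (simp add: mom)
qed

text \<open>A function symmetric about the midpoint of a period is a continuous function \<phi> of
  \<open>cos (2 * pi * x / L)\<close>. Weierstrass approximation of \<phi> by a polynomial
  \<open>p\<close> and the vanishing moments bound the integral of h^2 = h (h - p(cos)) + h p(cos)
  by a small multiple of the integral of |h|.\<close>

lemma even_continuous_eq_0_if_cos_moments_eq_0:
  fixes h :: "real \<Rightarrow> real"
  assumes L: "L > 0" and cont: "continuous_on {0..L} h"
    and sym: "\<And>x. x \<in> {0..L} \<Longrightarrow> h (L - x) = h x"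
    and mom: "\<And>j::nat. integral {0..L} (\<lambda>x. h x * cos (2 * pi * x / L) ^ j) = 0"
    and x: "x \<in> {0..L}"
  shows "h x = 0"
proof -
  define \<phi> where "\<phi> y = h (L * arccos y / (2 * pi))" for y
  have "(\<lambda>y. L * arccos y / (2 * pi)) ` {-1..1} \<subseteq> {0..L}"
  proof safe
    fix y :: real assume "y \<in> {-1..1}"
    then have "0 \<le> arccos y" "arccos y \<le> pi" using arccos_lbound arccos_ubound by auto
    then have "L * arccos y \<le> L * (2 * pi)" using L pi_gt_zero by (intro mult_left_mono) linarith+
    then show "L * arccos y / (2 * pi) \<in> {0..L}" using L \<open>0 \<le> arccos y\<close>
      by (simp add: divide_simps)
  qed
  then have "continuous_on {-1..1} \<phi>"
    unfolding \<phi>_def using continuous_on_subset[OF cont]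
    by (intro continuous_on_compose2[OF cont]) (auto intro!: continuous_intros)
  \<comment> \<open>\<open>arccos\<close> inverts \<open>cos\<close> only on the first half of the
    period; the symmetry of \<open>h\<close> covers the second half.\<close>
  have \<phi>_cos: "\<phi> (cos (2 * pi * u / L)) = h u" if u: "u \<in> {0..L}" for u
  proof (cases "u \<le> L / 2")
    case True
    then have "arccos (cos (2 * pi * u / L)) = 2 * pi * u / L"
      using u L by (intro arccos_cos) (auto simp: field_simps)
    then show ?thesis using L by (simp add: \<phi>_def)
  next
    case False
    have "cos (2 * pi * u / L) = cos (2 * pi * (L - u) / L)"
      using L by (simp add: diff_divide_distrib right_diff_distrib cos_diff)
    moreover have "arccos (cos (2 * pi * (L - u) / L)) = 2 * pi * (L - u) / L"
      using u L False by (intro arccos_cos) (auto simp: field_simps)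
    ultimately show ?thesis using L sym[OF u] by (simp add: \<phi>_def)
  qed
  let ?I = "integral {0..L} (\<lambda>x. \<bar>h x\<bar>)"
  have I0: "?I \<ge> 0" by (rule integral_nonneg) (auto intro!: integrable_continuous_real continuous_intros cont)
  have small: "integral {0..L} (\<lambda>x. (h x)\<^sup>2) \<le> e * ?I" if "e > 0" for e
  proof -
    obtain p where p: "real_polynomial_function p" and pe: "\<And>y. y \<in> {-1..1} \<Longrightarrow> \<bar>\<phi> y - p y\<bar> < e"
      using Stone_Weierstrass_real_polynomial_function[of "{-1..1::real}" \<phi> e]
        \<open>continuous_on {-1..1} \<phi>\<close> \<open>e > 0\<close> by auto
    have "continuous_on UNIV p"
      using p by (intro continuous_on_polymonial_function) (simp add: real_polynomial_function_eq)
    then have pc: "continuous_on {0..L} (\<lambda>x. p (cos (2 * pi * x / L)))"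
      proof (rule continuous_on_compose2)
      show "continuous_on {0..L} (\<lambda>x. cos (2 * pi * x / L))"
        using L by (intro continuous_intros) auto
    qed auto
    have "integral {0..L} (\<lambda>x. (h x)\<^sup>2)
      = integral {0..L} (\<lambda>x. h x * (h x - p (cos (2 * pi * x / L))) + h x * p (cos (2 * pi * x / L)))"
      by (simp add: power2_eq_square algebra_simps)
    also have "\<dots> = integral {0..L} (\<lambda>x. h x * (h x - p (cos (2 * pi * x / L))))"
      using integral_cos_polynomial_eq_0[OF L cont mom p]
      by (subst integral_add) (auto intro!: integrable_continuous_real continuous_intros cont pc)
    also have "\<dots> \<le> integral {0..L} (\<lambda>x. e * \<bar>h x\<bar>)"
    proof (rule integral_le)
      fix x assume "x \<in> {0..L}"
      then have "\<bar>h x - p (cos (2 * pi * x / L))\<bar> \<le> e"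
        using pe[of "cos (2 * pi * x / L)"] \<phi>_cos[of x] by auto
      then have "\<bar>h x\<bar> * \<bar>h x - p (cos (2 * pi * x / L))\<bar> \<le> \<bar>h x\<bar> * e"
        by (intro mult_left_mono) auto
      then show "h x * (h x - p (cos (2 * pi * x / L))) \<le> e * \<bar>h x\<bar>"
        by (metis abs_ge_self abs_mult mult.commute order_trans)
    qed (auto intro!: integrable_continuous_real continuous_intros cont pc)
    finally show ?thesis by simp
  qed
  have "integral {0..L} (\<lambda>x. (h x)\<^sup>2) \<le> 0"
  proof (rule field_le_epsilon)
    fix e :: real assume "e > 0"
    \<comment> \<open>The summand 1 keeps the divisor positive when the integral of |h| is
      0.\<close>
    have "integral {0..L} (\<lambda>x. (h x)\<^sup>2) \<le> e / (?I + 1) * ?I"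
      using small[of "e / (?I + 1)"] \<open>e > 0\<close> I0 by simp
    also have "\<dots> \<le> e" using \<open>e > 0\<close> I0 by (simp add: field_simps)
    finally show "integral {0..L} (\<lambda>x. (h x)\<^sup>2) \<le> 0 + e" by simp
  qed
  moreover have "integral {0..L} (\<lambda>x. (h x)\<^sup>2) \<ge> 0"
    by (rule integral_nonneg) (auto intro!: integrable_continuous_real continuous_intros cont)
  ultimately have "integral {0..L} (\<lambda>x. (h x)\<^sup>2) = 0" by simp
  moreover have "(\<lambda>x. (h x)\<^sup>2) integrable_on cbox 0 L"
    by (auto intro!: integrable_continuous_real continuous_intros cont)
  ultimately have "((\<lambda>x. (h x)\<^sup>2) has_integral 0) (cbox 0 L)"
    by (metis cbox_interval has_integral_iff)
  then have "(h x)\<^sup>2 = 0"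
    using x L by (intro has_integral_0_cbox_imp_0[of 0 L "\<lambda>x. (h x)\<^sup>2"]) (auto intro!: continuous_intros cont)
  then show ?thesis by simp
qed

lemma has_vector_derivative_exp_of_real:
  fixes c :: complex
  shows   "((\<lambda>x. exp (c * of_real x)) has_vector_derivative c * exp (c * of_real x)) (at x within S)"
  by (rule has_vector_derivative_real_field[where f="\<lambda>z. exp (c * z)"]) (auto intro!: derivative_eq_intros)

lemma has_integral_exp_of_real:
  fixes c :: complex
  assumes "c \<noteq> 0" "a \<le> b"
  shows "((\<lambda>x. exp (c * of_real x)) has_integral (exp (c * of_real b) - exp (c * of_real a)) / c) {a..b}"
proof -
  have "((\<lambda>x. exp (c * of_real x)) has_integral
      exp (c * of_real b) * (1 / c) - exp (c * of_real a) * (1 / c)) {a..b}"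
  proof (rule fundamental_theorem_of_calculus)
    fix x
    show "((\<lambda>x. exp (c * of_real x) * (1 / c)) has_vector_derivative exp (c * of_real x)) (at x within {a..b})"
      using has_vector_derivative_mult_left[OF has_vector_derivative_exp_of_real, of c "1 / c" x "{a..b}"] assms
      by simp
  qed fact
  then show ?thesis by (simp add: diff_divide_distrib)
qed

lemma has_integral_reflect_Icc0:
  fixes f :: "real \<Rightarrow> 'a::banach"
  assumes "(f has_integral I) {0..L}" 
  shows "((\<lambda>x. f (L - x)) has_integral I) {0..L}"
  using has_integral_affinity[of f I 0 L "-1" L] assms
  by (cases "L \<ge> 0") (auto simp: image_diff_atLeastAtMost)

lemma even_continuous_complex_eq_0_if_cos_moments_eq_0:
  fixes h :: "real \<Rightarrow> complex"
  assumes L: "L > 0" and cont: "continuous_on {0..L} h"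
    and sym: "\<And>x. x \<in> {0..L} \<Longrightarrow> h (L - x) = h x"
    and mom: "\<And>j::nat. integral {0..L} (\<lambda>x. h x * of_real (cos (2 * pi * x / L)) ^ j) = 0"
    and x: "x \<in> {0..L}"
  shows "h x = 0"
proof -
  have "((\<lambda>x. h x * of_real (cos (2 * pi * x / L)) ^ j) has_integral 0) {0..L}" for j :: nat
    using mom[of j] L by (auto simp: has_integral_iff intro!: integrable_continuous_real continuous_intros cont)
  then have mom': "((\<lambda>x. Re (h x) * cos (2 * pi * x / L) ^ j) has_integral 0) {0..L}"
       "((\<lambda>x. Im (h x) * cos (2 * pi * x / L) ^ j) has_integral 0) {0..L}" for j :: nat
    using has_integral_linear[OF _ bounded_linear_Re, of "\<lambda>x. h x * of_real (cos (2 * pi * x / L)) ^ j" 0]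
       has_integral_linear[OF _ bounded_linear_Im, of "\<lambda>x. h x * of_real (cos (2 * pi * x / L)) ^ j" 0]
    by (auto simp: o_def simp flip: of_real_power)
  have "Re (h x) = 0"
    by (rule even_continuous_eq_0_if_cos_moments_eq_0[OF L, where h="\<lambda>x. Re (h x)"])
       (auto intro!: continuous_intros cont integral_unique mom' simp: sym x[simplified])
  moreover have "Im (h x) = 0"
    by (rule even_continuous_eq_0_if_cos_moments_eq_0[OF L, where h="\<lambda>x. Im (h x)"])
       (auto intro!: continuous_intros cont integral_unique mom' simp: sym x[simplified])
  ultimately show ?thesis by (simp add: complex_eq_iff)
qed

text \<open>\<open>K\<close> is split by the reflection x -> L - x. The even part falls under the
  cosine-moment lemma directly; the odd part is first multiplied by the sine, which makes it even.
  Both sets of moments are combinations of Fourier coefficients.\<close>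

lemma continuous_eq_0_if_fourier_coeffs_eq_0:
  fixes K :: "real \<Rightarrow> complex"
  assumes L: "L > 0" and cont: "continuous_on {0..L} K"
    and coeff: "\<And>m::int. integral {0..L} (\<lambda>x. K x * cis (2 * pi * of_int m * x / L)) = 0"
    and x: "x \<in> {0..L}"
  shows "K x = 0"
proof -
  have Lnz: "L \<noteq> 0" using L by simp
  note intros = integrable_continuous_real continuous_intros cont
  define c where "c x = complex_of_real (cos (2 * pi * x / L))" for x
  define s where "s x = complex_of_real (sin (2 * pi * x / L))" for x
  have c_cont: "continuous_on A c" and s_cont: "continuous_on A s" for A
    unfolding c_def s_def by (intro continuous_intros ballI Lnz)+
  have c_cis: "c x = (cis (2 * pi * x / L) + cis (- (2 * pi * x / L))) / 2"
    and s_cis: "s x = - (\<i> / 2) * (cis (2 * pi * x / L) - cis (- (2 * pi * x / L)))" for x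
    by (simp_all add: c_def s_def complex_eq_iff)
  have cis_add1: "cis (2 * pi * of_int m * x / L) * cis (2 * pi * x / L) = cis (2 * pi * of_int (m + 1) * x / L)"
    and cis_diff1: "cis (2 * pi * of_int m * x / L) * cis (- (2 * pi * x / L)) = cis (2 * pi * of_int (m - 1) * x / L)"
    for m :: int and x
    by (simp_all add: cis_mult cis_divide algebra_simps add_divide_distrib diff_divide_distrib)
  \<comment> \<open>Multiplying by the cosine moves the frequency to m+1 and m-1, so the induction
    needs all \<open>m\<close> at once.\<close>
  have mom: "((\<lambda>x. K x * cis (2 * pi * of_int m * x / L) * c x ^ j) has_integral 0) {0..L}" for m :: int and j :: nat
  proof (induction j arbitrary: m)
    case 0
    then show ?case using coeff[of m]
      by (auto simp: has_integral_iff intro!: intros Lnz)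
  next
    case (Suc j)
    have eq: "K x * cis (2 * pi * of_int m * x / L) * c x ^ Suc j
      = (K x * cis (2 * pi * of_int (m+1) * x / L) * c x ^ j + K x * cis (2 * pi * of_int (m-1) * x / L) * c x ^ j) * (1/2)" for x
      unfolding cis_add1[symmetric] cis_diff1[symmetric] power_Suc by (subst (1) c_cis) (simp add: algebra_simps)
    show ?case unfolding eq
      using has_integral_mult_left[OF has_integral_add[OF Suc[of "m+1"] Suc[of "m-1"]], of "1/2"] by simp
  qed
  have mom_s: "((\<lambda>x. K x * s x * c x ^ j) has_integral 0) {0..L}" for j :: nat
  proof -
    have eq: "K x * s x * c x ^ j
      = (K x * cis (2 * pi * of_int 1 * x / L) * c x ^ j - K x * cis (2 * pi * of_int (-1) * x / L) * c x ^ j) * (-\<i>/2)" for x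
      by (subst s_cis) (simp add: algebra_simps)
    show ?thesis unfolding eq
      using has_integral_mult_left[OF has_integral_diff[OF mom[of 1 j] mom[of "-1" j]], of "-\<i>/2"] by simp
  qed
  have c_refl: "c (L - x) = c x" and s_refl: "s (L - x) = - s x" for x
    using L by (simp_all add: c_def s_def diff_divide_distrib right_diff_distrib cos_diff sin_diff)
  have K_refl: "continuous_on {0..L} (\<lambda>x. K (L - x))"
    by (rule continuous_on_compose2[OF cont]) (auto intro!: continuous_intros)
  have even0: "K x + K (L - x) = 0" if "x \<in> {0..L}" for x
  proof (rule even_continuous_complex_eq_0_if_cos_moments_eq_0[OF L _ _ _ that])
    fix j :: nat
    have "((\<lambda>x. K x * c x ^ j) has_integral 0) {0..L}"
      using mom[of 0 j] by simp
    from has_integral_add[OF this has_integral_reflect_Icc0[OF this]]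
    show "integral {0..L} (\<lambda>x. (K x + K (L - x)) * of_real (cos (2 * pi * x / L)) ^ j) = 0"
      unfolding c_refl c_def[symmetric] by (intro integral_unique) (simp add: algebra_simps)
  qed (auto intro!: continuous_intros cont K_refl)
  have odd0: "K x * s x + K (L - x) * s (L - x) = 0" if "x \<in> {0..L}" for x
  proof (rule even_continuous_complex_eq_0_if_cos_moments_eq_0[OF L _ _ _ that])
    fix j :: nat
    from has_integral_add[OF mom_s[of j] has_integral_reflect_Icc0[OF mom_s[of j]]]
    show "integral {0..L} (\<lambda>x. (K x * s x + K (L - x) * s (L - x)) * of_real (cos (2 * pi * x / L)) ^ j) = 0"
      unfolding c_refl c_def[symmetric] by (intro integral_unique) (simp add: algebra_simps)
    show "continuous_on {0..L} (\<lambda>x. K x * s x + K (L - x) * s (L - x))"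
      unfolding s_refl by (intro continuous_intros cont K_refl s_cont)
  qed auto
  have Ks: "K y * s y = 0" if "y \<in> {0..L}" for y
  proof -
    have "K (L - y) = - K y" using even0[OF that] by (simp add: eq_neg_iff_add_eq_0 add.commute)
    then show ?thesis using odd0[OF that] by (simp add: s_refl)
  qed
  \<comment> \<open>Inside the period the sine vanishes only at L/2; that point and the endpoints
    are recovered from continuity via a zero integral.\<close>
  have "K y = 0" if "y \<in> {0<..<L} - {L/2}" for y
  proof -
    have "sin (2 * pi * y / L) \<noteq> 0"
    proof (cases "y < L / 2")
      case True
      then have "0 < 2 * pi * y / L" "2 * pi * y / L < pi" using that L by (auto simp: field_simps)
      then show ?thesis using sin_gt_zero by force
    next
      case False
      then have "pi < 2 * pi * y / L" "2 * pi * y / L < 2 * pi" using that L by (auto simp: field_simps)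
      then show ?thesis using sin_lt_zero by force
    qed
    then show ?thesis using Ks[of y] that by (auto simp: s_def)
  qed
  have "negligible {0, L, L/2}" by simp
  have "((\<lambda>x. norm (K x)) has_integral 0) {0..L}"
    by (rule has_integral_spike[OF \<open>negligible {0, L, L/2}\<close>, where f="\<lambda>_. 0"]) (auto simp: \<open>\<And>y. y \<in> {0<..<L} - {L/2} \<Longrightarrow> K y = 0\<close>)
  then have "norm (K x) = 0"
    using x L by (intro has_integral_0_cbox_imp_0[of 0 L "\<lambda>x. norm (K x)"]) (auto intro!: continuous_intros cont)
  then show ?thesis by simp
qed

text \<open>Subtracting the mean value removes the zeroth coefficient and leaves the others
  unchanged, since nontrivial characters have integral 0. In both later applications the zeroth
  coefficient is not at hand, and the constant is identified at the endpoint 0.\<close>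

lemma continuous_const_if_fourier_coeffs_eq_0:
  fixes K :: "real \<Rightarrow> complex"
  assumes L: "L > 0" and cont: "continuous_on {0..L} K"
    and coeff: "\<And>m::int. m \<noteq> 0 \<Longrightarrow> integral {0..L} (\<lambda>x. K x * cis (2 * pi * of_int m * x / L)) = 0"
    and x: "x \<in> {0..L}"
  shows "K x = K 0"
proof -
  define M where "M = integral {0..L} K / of_real L"
  have "K y - M = 0" if "y \<in> {0..L}" for y
  proof (rule continuous_eq_0_if_fourier_coeffs_eq_0[OF L _ _ that])
    show "continuous_on {0..L} (\<lambda>x. K x - M)" by (intro continuous_intros cont)
    fix m :: int
    have "integral {0..L} (\<lambda>x. (K x - M) * cis (2 * pi * of_int m * x / L))
      = integral {0..L} (\<lambda>x. K x * cis (2 * pi * of_int m * x / L)) - M * integral {0..L} (\<lambda>x. cis (2 * pi * of_int m * x / L))"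
      unfolding left_diff_distrib using L
      by (subst integral_diff) (auto intro!: integrable_continuous_real continuous_intros cont)
    also have "\<dots> = 0"
    proof (cases "m = 0")
      case True
      then show ?thesis using L by (simp add: M_def scaleR_conv_of_real)
    next
      case False
      have cis_eq: "cis (2 * pi * of_int m * x / L) = exp (\<i> * of_real (2 * pi * of_int m / L) * of_real x)" for x
        by (simp add: cis_conv_exp mult.assoc)
      have "\<i> * of_real (2 * pi * of_int m / L) \<noteq> 0" using False L by simp
      then have "((\<lambda>x. cis (2 * pi * of_int m * x / L)) has_integral
        (cis (2 * pi * of_int m * L / L) - cis (2 * pi * of_int m * 0 / L)) / (\<i> * of_real (2 * pi * of_int m / L))) {0..L}"
        unfolding cis_eq by (rule has_integral_exp_of_real) (use L in simp)
      moreover have "cis (2 * pi * of_int m * L / L) = 1"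
        using L by (simp add: cis_multiple_2pi)
      ultimately have "integral {0..L} (\<lambda>x. cis (2 * pi * of_int m * x / L)) = 0"
        by (intro integral_unique) simp
      with coeff[OF False] show ?thesis by simp
    qed
    finally show "integral {0..L} (\<lambda>x. (K x - M) * cis (2 * pi * of_int m * x / L)) = 0" .
  qed
  from this[OF x] this[of 0] L have "K x = M" "K 0 = M" by auto
  then show ?thesis by simp
qed

section \<open>Uniqueness of the Fourier transform on the real line\<close>

lemma borel_measurable_cnj_comp [measurable]:
  "f \<in> borel_measurable M \<Longrightarrow> (\<lambda>x. cnj (f x)) \<in> borel_measurable M"
  by (rule measurable_compose[where g=cnj, OF _ borel_measurable_continuous_onI]) (auto intro!: continuous_intros)

lemma borel_measurable_cis [measurable]: "cis \<in> borel_measurable borel"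
  by (rule borel_measurable_continuous_onI) (auto intro!: continuous_intros)

text \<open>The positive and negative parts of \<open>g\<close> have the same transform; at
  frequency 0 this says that they have the same mass \<open>c\<close>. Divided by \<open>c\<close>
  they become densities of probability measures with equal characteristic functions, and Levy's
  uniqueness theorem identifies them. Mass 0 is treated apart because it cannot be
  normalised.\<close>

lemma real_AE_eq_0_if_fourier_eq_0:
  fixes g :: "real \<Rightarrow> real"
  assumes g: "integrable lborel g"
    and ft: "\<And>\<xi>. (LINT t|lborel. of_real (g t) * cis (\<xi> * t)) = 0"
  shows "AE t in lborel. g t = 0"
proof -
  define p where "p t = max 0 (g t)" for t
  define q where "q t = max 0 (- g t)" for t
  have [measurable]: "g \<in> borel_measurable borel" using g by auto
  have [measurable]: "p \<in> borel_measurable borel" "q \<in> borel_measurable borel"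
    by (simp_all add: p_def[abs_def] q_def[abs_def])
  have nn: "p t \<ge> 0" "q t \<ge> 0" for t by (simp_all add: p_def q_def)
  have gpq: "g t = p t - q t" for t by (simp add: p_def q_def)
  have ip: "integrable lborel p" and iq: "integrable lborel q"
    by (rule Bochner_Integration.integrable_bound[OF g]; simp add: p_def q_def)+
  have ipc: "integrable lborel (\<lambda>t. of_real (p t) * cis (\<xi> * t))"
   and iqc: "integrable lborel (\<lambda>t. of_real (q t) * cis (\<xi> * t))" for \<xi>
    by (rule Bochner_Integration.integrable_bound[OF g]; simp add: p_def q_def norm_mult)+
  have eq: "(LINT t|lborel. of_real (p t) * cis (\<xi> * t)) = (LINT t|lborel. of_real (q t) * cis (\<xi> * t))" for \<xi>
    using ft[of \<xi>] Bochner_Integration.integral_diff[OF ipc iqc, of \<xi> \<xi>]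
    by (simp add: gpq algebra_simps)
  define c where "c = (LINT t|lborel. p t)"
  have cq: "c = (LINT t|lborel. q t)"
    using eq[of 0] by (simp add: c_def integral_complex_of_real)
  have c0: "c \<ge> 0" by (simp add: c_def nn)
  show ?thesis
  proof (cases "c = 0")
    case True
    then have "AE t in lborel. p t = 0" "AE t in lborel. q t = 0"
      using integral_nonneg_eq_0_iff_AE[OF ip] integral_nonneg_eq_0_iff_AE[OF iq] nn cq c_def by auto
    then show ?thesis by eventually_elim (simp add: gpq)
  next
    case False
    with c0 have c: "c > 0" by simp
    have dist: "real_distribution (density lborel (\<lambda>t. ennreal (r t / c)))"
      if [measurable]: "r \<in> borel_measurable borel" and "\<And>t. r t \<ge> 0" and r: "integrable lborel r" "(LINT t|lborel. r t) = c" for r :: "real \<Rightarrow> real"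
    proof -
      have "emeasure (density lborel (\<lambda>t. ennreal (r t / c))) UNIV = ennreal (LINT t|lborel. r t / c)"
        using that c by (subst emeasure_density) (auto simp: nn_integral_eq_integral)
      also have "\<dots> = 1" using r c by simp
      finally show ?thesis by (intro real_distribution.intro prob_spaceI real_distribution_axioms.intro) auto
    qed
    have "char (density lborel (\<lambda>t. ennreal (p t / c))) = char (density lborel (\<lambda>t. ennreal (q t / c)))"
    proof
      fix \<xi>
      have "char (density lborel (\<lambda>t. ennreal (r t / c))) \<xi> = (LINT t|lborel. of_real (r t) * cis (\<xi> * t)) / of_real c"
        if [measurable]: "r \<in> borel_measurable borel" and "\<And>t. r t \<ge> 0" for r :: "real \<Rightarrow> real"
      proof -
        have "char (density lborel (\<lambda>t. ennreal (r t / c))) \<xi> = (LINT t|lborel. (r t / c) *\<^sub>R iexp (\<xi> * t))"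
          unfolding char_def using that c by (subst integral_density) auto
        also have "\<dots> = (LINT t|lborel. of_real (r t) * cis (\<xi> * t) / of_real c)"
          by (simp add: cis_conv_exp scaleR_conv_of_real)
        finally show ?thesis by simp
      qed
      then show "char (density lborel (\<lambda>t. ennreal (p t / c))) \<xi> = char (density lborel (\<lambda>t. ennreal (q t / c))) \<xi>"
        using nn eq by simp
    qed
    then have "density lborel (\<lambda>t. ennreal (p t / c)) = density lborel (\<lambda>t. ennreal (q t / c))"
      using nn ip iq cq c_def by (intro Levy_uniqueness dist) auto
    then have "AE t in lborel. ennreal (p t / c) = ennreal (q t / c)"
      by (subst (asm) sigma_finite_measure.density_unique_iff[OF sigma_finite_lborel]) auto
    then show ?thesis
      by eventually_elim (use c nn in \<open>simp add: gpq\<close>)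
  qed
qed

text \<open>Conjugating the hypothesis at -\<xi> yields it for the conjugate of \<open>f\<close>,
  hence for the real and imaginary parts.\<close>

lemma AE_eq_0_if_fourier_eq_0:
  fixes f :: "real \<Rightarrow> complex"
  assumes f: "integrable lborel f"
    and ft: "\<And>\<xi>. (LINT t|lborel. f t * cis (\<xi> * t)) = 0"
  shows "AE t in lborel. f t = 0"
proof -
  have [measurable]: "f \<in> borel_measurable borel" using f by auto
  have i: "integrable lborel (\<lambda>t. f t * cis (\<xi> * t))" for \<xi>
    by (rule Bochner_Integration.integrable_bound[OF f]) (simp_all add: norm_mult)
  have ic: "integrable lborel (\<lambda>t. cnj (f t) * cis (\<xi> * t))" for \<xi>
    by (rule Bochner_Integration.integrable_bound[OF f]) (simp_all add: norm_mult)
  have ftc: "(LINT t|lborel. cnj (f t) * cis (\<xi> * t)) = 0" for \<xi>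
  proof -
    have "(LINT t|lborel. cnj (f t) * cis (\<xi> * t)) = cnj (LINT t|lborel. f t * cis (- \<xi> * t))"
      using Bochner_Integration.integral_cnj[of lborel "\<lambda>t. f t * cis (- \<xi> * t)"] by (simp add: cis_cnj)
    then show ?thesis by (simp only: ft complex_cnj_zero)
  qed
  have "AE t in lborel. Re (f t) = 0"
  proof (rule real_AE_eq_0_if_fourier_eq_0)
    fix \<xi>
    have "(LINT t|lborel. of_real (Re (f t)) * cis (\<xi> * t))
        = (LINT t|lborel. (f t * cis (\<xi> * t) + cnj (f t) * cis (\<xi> * t)) / 2)"
      by (rule Bochner_Integration.integral_cong) (auto simp: complex_eq_iff algebra_simps)
    also have "\<dots> = 0" using Bochner_Integration.integral_add[OF i ic, of \<xi> \<xi>] ft ftc by simp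
    finally show "(LINT t|lborel. of_real (Re (f t)) * cis (\<xi> * t)) = 0" .
  qed (use f in simp)
  moreover have "AE t in lborel. Im (f t) = 0"
  proof (rule real_AE_eq_0_if_fourier_eq_0)
    fix \<xi>
    have "(LINT t|lborel. of_real (Im (f t)) * cis (\<xi> * t))
        = (LINT t|lborel. (f t * cis (\<xi> * t) - cnj (f t) * cis (\<xi> * t)) / (2 * \<i>))"
      by (rule Bochner_Integration.integral_cong) (auto simp: complex_diff_cnj complex_eq_iff simp flip: left_diff_distrib)
    also have "\<dots> = 0" using Bochner_Integration.integral_diff[OF i ic, of \<xi> \<xi>] ft ftc by simp
    finally show "(LINT t|lborel. of_real (Im (f t)) * cis (\<xi> * t)) = 0" .
  qed (use f in simp)
  ultimately show ?thesis by eventually_elim (simp add: complex_eq_iff)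
qed

section \<open>Square-integrable functions\<close>

lemma L2_measurable: "f \<in> L2 \<Longrightarrow> f \<in> borel_measurable borel"
  by (simp add: L2_def)

lemma L2_integrable_square: "f \<in> L2 \<Longrightarrow> integrable lborel (\<lambda>t. (cmod (f t))\<^sup>2)"
  by (simp add: L2_def)

lemma L2_bound:
  assumes "f \<in> L2" "g \<in> borel_measurable borel" "\<And>t. cmod (g t) \<le> C * cmod (f t)"
  shows "g \<in> L2"
proof -
  have [measurable]: "g \<in> borel_measurable borel" by fact
  have "integrable lborel (\<lambda>t. C\<^sup>2 * (cmod (f t))\<^sup>2)"
    using L2_integrable_square[OF assms(1)] by simp
  then have "integrable lborel (\<lambda>t. (cmod (g t))\<^sup>2)"
  proof (rule Bochner_Integration.integrable_bound)
    show "AE t in lborel. norm ((cmod (g t))\<^sup>2) \<le> norm (C\<^sup>2 * (cmod (f t))\<^sup>2)"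
      using power_mono[OF assms(3) norm_ge_zero, of _ 2] by (auto simp: power_mult_distrib)
  qed simp
  then show ?thesis by (simp add: L2_def assms(2))
qed

lemma L2_mult_integrable:
  assumes f: "f \<in> L2" and g: "g \<in> L2"
  shows "integrable lborel (\<lambda>t. f t * g t)"
proof -
  have [measurable]: "f \<in> borel_measurable borel" "g \<in> borel_measurable borel"
    using f g by (auto dest: L2_measurable)
  have "integrable lborel (\<lambda>t. (cmod (f t))\<^sup>2 + (cmod (g t))\<^sup>2)"
    using f g by (auto dest: L2_integrable_square)
  then show ?thesis
  proof (rule Bochner_Integration.integrable_bound)
    have "cmod (f t * g t) \<le> (cmod (f t))\<^sup>2 + (cmod (g t))\<^sup>2" for t
      using sum_squares_bound[of "cmod (f t)" "cmod (g t)"] mult_nonneg_nonneg[OF norm_ge_zero norm_ge_zero, of "f t" "g t"]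
      unfolding norm_mult by linarith
    then show "AE t in lborel. norm (f t * g t) \<le> norm ((cmod (f t))\<^sup>2 + (cmod (g t))\<^sup>2)" by auto
  qed simp
qed

lemma L2_cnj: "f \<in> L2 \<Longrightarrow> (\<lambda>t. cnj (f t)) \<in> L2"
  by (rule L2_bound[where C = 1]) (auto dest: L2_measurable)

lemma L2_cmult: "f \<in> L2 \<Longrightarrow> (\<lambda>t. c * f t) \<in> L2"
  by (rule L2_bound[where C = "cmod c"]) (auto dest: L2_measurable simp: norm_mult)

lemma cmod_add_square_le: "(cmod (a + b))\<^sup>2 \<le> 2 * (cmod a)\<^sup>2 + 2 * (cmod b)\<^sup>2"
proof -
  have "(cmod (a + b))\<^sup>2 \<le> (cmod a + cmod b)\<^sup>2"
    by (intro power_mono norm_triangle_ineq) simp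
  also have "\<dots> \<le> 2 * (cmod a)\<^sup>2 + 2 * (cmod b)\<^sup>2"
    using sum_squares_bound[of "cmod a" "cmod b"] by (simp add: power2_sum)
  finally show ?thesis .
qed

lemma L2_add:
  assumes f: "f \<in> L2" and g: "g \<in> L2"
  shows "(\<lambda>t. f t + g t) \<in> L2"
proof -
  have [measurable]: "f \<in> borel_measurable borel" "g \<in> borel_measurable borel"
    using f g by (auto dest: L2_measurable)
  have "integrable lborel (\<lambda>t. 2 * (cmod (f t))\<^sup>2 + 2 * (cmod (g t))\<^sup>2)"
    using f g by (intro Bochner_Integration.integrable_add integrable_mult_right L2_integrable_square)
  then have "integrable lborel (\<lambda>t. (cmod (f t + g t))\<^sup>2)"
    by (rule Bochner_Integration.integrable_bound) (use cmod_add_square_le in auto)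
  then show ?thesis by (simp add: L2_def)
qed

lemma L2_diff: "f \<in> L2 \<Longrightarrow> g \<in> L2 \<Longrightarrow> (\<lambda>t. f t - g t) \<in> L2"
  using L2_add[of f "\<lambda>t. (-1) * g t"] L2_cmult[of g "-1"] by simp

lemma L2_sum: "(\<And>i. i \<in> I \<Longrightarrow> f i \<in> L2) \<Longrightarrow> (\<lambda>t. \<Sum>i\<in>I. f i t) \<in> L2"
proof (induction I rule: infinite_finite_induct)
  case (insert i I)
  then show ?case using L2_add[of "f i" "\<lambda>t. \<Sum>i\<in>I. f i t"] by simp
qed (auto simp: L2_def)

text \<open>Stands in for the triangle inequality and is integrated from a pointwise bound. The
  factor 2 is harmless, as it is applied to norms that tend to 0.\<close>

lemma L2_norm_add_square_le:
  assumes f: "f \<in> L2" and g: "g \<in> L2"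
  shows "(L2_norm (\<lambda>t. f t + g t))\<^sup>2 \<le> 2 * (L2_norm f)\<^sup>2 + 2 * (L2_norm g)\<^sup>2"
proof -
  have "(LINT t|lborel. (cmod (f t + g t))\<^sup>2) \<le> (LINT t|lborel. 2 * (cmod (f t))\<^sup>2 + 2 * (cmod (g t))\<^sup>2)"
    using f g L2_add[OF f g] by (intro integral_mono cmod_add_square_le Bochner_Integration.integrable_add integrable_mult_right L2_integrable_square)
  also have "\<dots> = 2 * (LINT t|lborel. (cmod (f t))\<^sup>2) + 2 * (LINT t|lborel. (cmod (g t))\<^sup>2)"
    using f g by (subst Bochner_Integration.integral_add) (auto dest: L2_integrable_square)
  finally show ?thesis by (simp add: L2_norm_def)
qed

lemma L2_inner_bound:
  assumes f: "f \<in> L2" and g: "g \<in> L2"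
  shows "cmod (L2_inner f g) \<le> L2_norm f * L2_norm g"
proof -
  have [measurable]: "f \<in> borel_measurable borel" "g \<in> borel_measurable borel"
    using f g by (auto dest: L2_measurable)
  have fg: "integrable lborel (\<lambda>t. f t * cnj (g t))"
    by (rule L2_mult_integrable[OF f L2_cnj[OF g]])
  have nn: "(\<integral>\<^sup>+ t. ennreal (cmod (h t)) ^ 2 \<partial>lborel) = ennreal ((L2_norm h)\<^sup>2)" if "h \<in> L2" for h
    using L2_integrable_square[OF that] by (simp add: ennreal_power nn_integral_eq_integral L2_norm_def)
  have "(\<integral>\<^sup>+ t. ennreal (cmod (f t)) * ennreal (cmod (g t)) \<partial>lborel)
      = ennreal (LINT t|lborel. cmod (f t * cnj (g t)))"
    using integrable_norm[OF fg] by (subst nn_integral_eq_integral[symmetric]) (auto simp: norm_mult ennreal_mult')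
  then have "ennreal (LINT t|lborel. cmod (f t * cnj (g t))) ^ 2 \<le> ennreal ((L2_norm f)\<^sup>2) * ennreal ((L2_norm g)\<^sup>2)"
    using Cauchy_Schwarz_nn_integral[of "\<lambda>t. ennreal (cmod (f t))" lborel "\<lambda>t. ennreal (cmod (g t))"]
    by (simp add: nn f g)
  then have "(LINT t|lborel. cmod (f t * cnj (g t)))\<^sup>2 \<le> (L2_norm f * L2_norm g)\<^sup>2"
    by (simp add: ennreal_power power_mult_distrib flip: ennreal_mult)
  then have "(LINT t|lborel. cmod (f t * cnj (g t))) \<le> L2_norm f * L2_norm g"
    by (rule power2_le_imp_le) (simp add: L2_norm_def)
  then show ?thesis unfolding L2_inner_def
    using integral_norm_bound[of lborel "\<lambda>t. f t * cnj (g t)"] by linarith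
qed

lemma L2_inner_cnj_commute: "L2_inner f g = cnj (L2_inner g f)"
  unfolding L2_inner_def Bochner_Integration.integral_cnj[symmetric]
  by (simp only: complex_cnj_mult complex_cnj_cnj mult.commute)

lemma L2_inner_diff_left:
  assumes "f \<in> L2" "g \<in> L2" "h \<in> L2"
  shows "L2_inner (\<lambda>t. f t - g t) h = L2_inner f h - L2_inner g h"
  unfolding L2_inner_def left_diff_distrib
  by (intro Bochner_Integration.integral_diff L2_mult_integrable L2_cnj assms)

lemma L2_inner_sum_cmult_left:
  assumes "\<And>i. i \<in> I \<Longrightarrow> f i \<in> L2" "h \<in> L2"
  shows "L2_inner (\<lambda>t. \<Sum>i\<in>I. c i * f i t) h = (\<Sum>i\<in>I. c i * L2_inner (f i) h)"
proof -
  have "L2_inner (\<lambda>t. \<Sum>i\<in>I. c i * f i t) h = (LINT t|lborel. (\<Sum>i\<in>I. c i * (f i t * cnj (h t))))"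
    by (simp add: L2_inner_def sum_distrib_right mult.assoc)
  also have "\<dots> = (\<Sum>i\<in>I. c i * L2_inner (f i) h)"
    unfolding L2_inner_def using L2_mult_integrable[OF assms(1) L2_cnj[OF assms(2)]]
    by (subst Bochner_Integration.integral_sum) auto
  finally show ?thesis .
qed

text \<open>Pairing the partial sums of \<open>S d = 0\<close> with \<open>d\<close> gives \<open>\<Sum>j. \<bar>\<langle>d, G j\<rangle>\<bar>\<^sup>2 = 0\<close>.\<close>

lemma frame_operator_maps_same_imp_inner_eq:
  assumes G: "\<And>j. G j \<in> L2"
    and fh: "frame_operator_maps G f h" and fh': "frame_operator_maps G f' h"
  shows "L2_inner f (G j) = L2_inner f' (G j)"
proof -
  have f: "f \<in> L2" and f': "f' \<in> L2" and h: "h \<in> L2" using fh fh' by (auto simp: frame_operator_maps_def)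
  define d where "d t = f t - f' t" for t
  have d: "d \<in> L2" unfolding d_def by (rule L2_diff[OF f f'])
  define P where "P J u t = (\<Sum>j\<in>J. L2_inner u (G j) * G j t)" for J u t
  have P: "P J u \<in> L2" for J u unfolding P_def by (intro L2_sum L2_cmult G)
  have Pd: "P J d t = P J f t - P J f' t" for J t
    unfolding P_def d_def
    by (simp add: L2_inner_diff_left f f' G left_diff_distrib sum_subtractf)
  let ?F = "finite_subsets_at_top UNIV"
  have lim: "((\<lambda>J. 2 * (L2_norm (\<lambda>t. P J f t - h t))\<^sup>2 + 2 * (L2_norm (\<lambda>t. P J f' t - h t))\<^sup>2) \<longlongrightarrow> 2 * 0\<^sup>2 + 2 * 0\<^sup>2) ?F"
    using fh fh' unfolding frame_operator_maps_def P_def by (intro tendsto_intros) auto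
  have le: "(L2_norm (P J d))\<^sup>2 \<le> 2 * (L2_norm (\<lambda>t. P J f t - h t))\<^sup>2 + 2 * (L2_norm (\<lambda>t. P J f' t - h t))\<^sup>2" for J
  proof -
    have "P J d = (\<lambda>t. (P J f t - h t) + (-1) * (P J f' t - h t))" by (auto simp: Pd)
    then have "(L2_norm (P J d))\<^sup>2 \<le> 2 * (L2_norm (\<lambda>t. P J f t - h t))\<^sup>2 + 2 * (L2_norm (\<lambda>t. (-1) * (P J f' t - h t)))\<^sup>2"
      using L2_norm_add_square_le[OF L2_diff[OF P h] L2_cmult[OF L2_diff[OF P h]], of J f "-1" J f'] by simp
    also have "L2_norm (\<lambda>t. (-1) * (P J f' t - h t)) = L2_norm (\<lambda>t. P J f' t - h t)"
      by (simp add: L2_norm_def norm_minus_commute)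
    finally show ?thesis .
  qed
  have "((\<lambda>J. (L2_norm (P J d))\<^sup>2) \<longlongrightarrow> 0) ?F"
    by (rule tendsto_sandwich[OF _ _ tendsto_const lim[simplified]]) (use le in auto)
  then have "((\<lambda>J. sqrt ((L2_norm (P J d))\<^sup>2)) \<longlongrightarrow> sqrt 0) ?F"
    by (rule tendsto_real_sqrt)
  then have Pd0: "((\<lambda>J. L2_norm (P J d) * L2_norm d) \<longlongrightarrow> 0 * L2_norm d) ?F"
    by (intro tendsto_mult) (simp_all add: L2_norm_def)
  \<comment> \<open>Once \<open>J\<close> contains \<open>j\<close>, the nonnegative sum dominates
    its single term at \<open>j\<close>, so the bound survives the limit over
    \<open>J\<close>.\<close>
  have "(cmod (L2_inner d (G j)))\<^sup>2 \<le> 0 * L2_norm d"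
  proof (rule tendsto_lowerbound[OF Pd0])
    show "\<forall>\<^sub>F J in ?F. (cmod (L2_inner d (G j)))\<^sup>2 \<le> L2_norm (P J d) * L2_norm d"
      unfolding eventually_finite_subsets_at_top
    proof (intro exI[of _ "{j}"] conjI allI impI)
      fix J :: "'a set" assume J: "finite J \<and> {j} \<subseteq> J \<and> J \<subseteq> UNIV"
      have "L2_inner (P J d) d = (\<Sum>j\<in>J. L2_inner d (G j) * L2_inner (G j) d)"
        unfolding P_def by (rule L2_inner_sum_cmult_left) (auto simp: G d)
      also have "\<dots> = of_real (\<Sum>j\<in>J. (cmod (L2_inner d (G j)))\<^sup>2)"
        by (simp add: complex_norm_square L2_inner_cnj_commute[of "G _" d] del: of_real_power)
      finally have "cmod (L2_inner (P J d) d) = (\<Sum>j\<in>J. (cmod (L2_inner d (G j)))\<^sup>2)"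
        by (simp only: norm_of_real) (simp add: sum_nonneg)
      moreover have "(cmod (L2_inner d (G j)))\<^sup>2 \<le> (\<Sum>j\<in>J. (cmod (L2_inner d (G j)))\<^sup>2)"
        using J by (intro member_le_sum) auto
      ultimately show "(cmod (L2_inner d (G j)))\<^sup>2 \<le> L2_norm (P J d) * L2_norm d"
        using L2_inner_bound[OF P d, of J d] by simp
    qed auto
  qed auto
  then have "L2_inner d (G j) = 0" by simp
  then show ?thesis unfolding d_def by (simp add: L2_inner_diff_left f f' G)
qed

section \<open>Completeness of the Gabor system\<close>

lemma integrable_inverse_square_shift:
  assumes w: "w > 0"
  shows "integrable lborel (\<lambda>t::real. 1 / ((t - y)\<^sup>2 + w\<^sup>2))"
proof -
  have "integrable lborel (\<lambda>x::real. inverse (1 + x\<^sup>2))"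
    using integrable_inverse_1_plus_square by (simp add: set_integrable_def)
  from lborel_integrable_real_affine[OF this, of "1/w" "-y/w"] w
  have "integrable lborel (\<lambda>t. inverse (1 + (- y / w + 1 / w * t)\<^sup>2))" by simp
  then have "integrable lborel (\<lambda>t. inverse (1 + (- y / w + 1 / w * t)\<^sup>2) * (1 / w\<^sup>2))" by simp
  also have "(\<lambda>t. inverse (1 + (- y / w + 1 / w * t)\<^sup>2) * (1 / w\<^sup>2)) = (\<lambda>t. 1 / ((t - y)\<^sup>2 + w\<^sup>2))"
  proof
    fix t
    have "inverse (1 + (- y / w + 1 / w * t)\<^sup>2) * (1 / w\<^sup>2) = 1 / ((1 + ((t - y) / w)\<^sup>2) * w\<^sup>2)"
      by (simp add: field_simps)
    also have "(1 + ((t - y) / w)\<^sup>2) * w\<^sup>2 = (t - y)\<^sup>2 + w\<^sup>2"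
      using w by (simp add: power_divide algebra_simps)
    finally show "inverse (1 + (- y / w + 1 / w * t)\<^sup>2) * (1 / w\<^sup>2) = 1 / ((t - y)\<^sup>2 + w\<^sup>2)" .
  qed
  finally show ?thesis .
qed

lemma cauchy_kernel_nonzero_denom [simp]:
  "w \<noteq> 0 \<Longrightarrow> of_real x + \<i> * of_real w \<noteq> 0" "w \<noteq> 0 \<Longrightarrow> of_real x - \<i> * of_real w \<noteq> 0"
  by (simp_all add: complex_eq_iff)

lemma cmod_shift_square: "(cmod (of_real x + \<i> * of_real w))\<^sup>2 = x\<^sup>2 + w\<^sup>2"
  "(cmod (of_real x - \<i> * of_real w))\<^sup>2 = x\<^sup>2 + w\<^sup>2"
  by (simp_all add: cmod_def)

lemma cauchy_kernel_L2:
  assumes "w > 0"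
  shows "(\<lambda>t. 1 / (of_real (t - y) + \<i> * of_real w)) \<in> L2"
proof -
  have "(cmod (1 / (of_real (t - y) + \<i> * of_real w)))\<^sup>2 = 1 / ((t - y)\<^sup>2 + w\<^sup>2)" for t
    unfolding norm_divide power_divide cmod_shift_square by simp
  then show ?thesis unfolding L2_def
    using integrable_inverse_square_shift[OF assms, of y] by simp
qed

lemma cis_mult_L2: "f \<in> L2 \<Longrightarrow> (\<lambda>t. f t * cis (c * t)) \<in> L2"
  by (rule L2_bound[where C = 1]) (auto dest: L2_measurable simp: norm_mult)

lemma cauchy_pairing_integrable:
  assumes "w > 0" "f \<in> L2"
  shows "integrable lborel (\<lambda>t. f t * cis (c * t) / (of_real (t - y) + \<i> * of_real w))"
  using L2_mult_integrable[OF cis_mult_L2[OF assms(2)] cauchy_kernel_L2[OF assms(1)], of c y] by simp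

lemma continuous_on_fourier_integral:
  assumes G: "integrable lborel (G :: real \<Rightarrow> complex)"
  shows "continuous_on A (\<lambda>\<xi>. LINT t|lborel. G t * cis (\<xi> * t))"
proof (rule continuous_at_imp_continuous_on, intro ballI continuous_at_sequentiallyI)
  fix \<xi> and u :: "nat \<Rightarrow> real" assume u: "u \<longlonglongrightarrow> \<xi>"
  have [measurable]: "G \<in> borel_measurable borel" using G by auto
  show "(\<lambda>n. LINT t|lborel. G t * cis (u n * t)) \<longlonglongrightarrow> (LINT t|lborel. G t * cis (\<xi> * t))"
  proof (rule integral_dominated_convergence[where w = "\<lambda>t. cmod (G t)"])
    show "AE t in lborel. (\<lambda>n. G t * cis (u n * t)) \<longlonglongrightarrow> G t * cis (\<xi> * t)"
      using u by (intro AE_I2 tendsto_intros)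
  qed (use G in \<open>auto simp: norm_mult\<close>)
qed

text \<open>Fubini applies because the weight exp(\<xi> r) is bounded on the compact interval and
  \<open>G\<close> is integrable. Weight and character merge into a single exponential, which can
  then be integrated over \<xi> in closed form.\<close>

lemma integral_fourier_swap:
  assumes G: "integrable lborel (G :: real \<Rightarrow> complex)"
  shows "integral {a..b} (\<lambda>\<xi>. exp (of_real (\<xi> * r)) * (LINT t|lborel. G t * cis (\<xi> * (s - q * t))))
    = (LINT t|lborel. G t * integral {a..b} (\<lambda>\<xi>. exp (of_real \<xi> * (of_real r + \<i> * of_real (s - q * t)))))"
proof -
  have [measurable]: "G \<in> borel_measurable borel" using G by auto
  define F where "F \<xi> t = indicator {a..b} \<xi> *\<^sub>R (exp (of_real (\<xi> * r)) * (G t * cis (\<xi> * (s - q * t))))" for \<xi> t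
  have [measurable]: "(\<lambda>(\<xi>, t). F \<xi> t) \<in> borel_measurable (lborel \<Otimes>\<^sub>M lborel)"
    unfolding F_def by measurable
  have norm_F: "norm (F \<xi> t) = indicator {a..b} \<xi> * exp (\<xi> * r) * cmod (G t)" for \<xi> t
    by (simp add: F_def norm_mult)
  have iF: "integrable (lborel \<Otimes>\<^sub>M lborel) (\<lambda>(\<xi>, t). F \<xi> t)"
  proof (rule lborel_pair.Fubini_integrable)
    have "integrable lborel (\<lambda>\<xi>. indicator {a..b} \<xi> *\<^sub>R exp (\<xi> * r))"
      by (rule borel_integrable_compact) (auto intro!: continuous_intros)
    then have "integrable lborel (\<lambda>\<xi>. indicator {a..b} \<xi> * exp (\<xi> * r) * (LINT t|lborel. cmod (G t)))"
      by simp
    then show "integrable lborel (\<lambda>\<xi>. LINT t|lborel. norm (case (\<xi>, t) of (\<xi>, t) \<Rightarrow> F \<xi> t))"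
      by (simp add: norm_F)
    show "AE \<xi> in lborel. integrable lborel (\<lambda>t. case (\<xi>, t) of (\<xi>, t) \<Rightarrow> F \<xi> t)"
    proof (rule AE_I2)
      fix \<xi>
      have "integrable lborel (\<lambda>t. indicator {a..b} \<xi> * exp (\<xi> * r) * cmod (G t))"
        using G by simp
      then show "integrable lborel (\<lambda>t. case (\<xi>, t) of (\<xi>, t) \<Rightarrow> F \<xi> t)"
        unfolding prod.case by (rule Bochner_Integration.integrable_bound) (auto simp: norm_F)
    qed
  qed fact
  have "(LINT \<xi>|lborel. LINT t|lborel. F \<xi> t) = (LINT t|lborel. LINT \<xi>|lborel. F \<xi> t)"
    using lborel_pair.Fubini_integral[OF iF] by simp
  moreover have "(LINT \<xi>|lborel. LINT t|lborel. F \<xi> t)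
      = integral {a..b} (\<lambda>\<xi>. exp (of_real (\<xi> * r)) * (LINT t|lborel. G t * cis (\<xi> * (s - q * t))))"
  proof -
    let ?h = "\<lambda>\<xi>. exp (of_real (\<xi> * r)) * (LINT t|lborel. G t * cis (\<xi> * (s - q * t)))"
    have "(LINT t|lborel. F \<xi> t) = indicator {a..b} \<xi> *\<^sub>R ?h \<xi>" for \<xi>
      unfolding F_def by simp
    moreover have "set_integrable lborel {a..b} ?h"
      unfolding set_integrable_def using lborel_pair.integrable_fst'[OF iF] calculation by simp
    ultimately show ?thesis
      using set_borel_integral_eq_integral(2)[of "{a..b}" ?h] by (simp add: set_lebesgue_integral_def)
  qed
  moreover have "(LINT \<xi>|lborel. F \<xi> t)
      = G t * integral {a..b} (\<lambda>\<xi>. exp (of_real \<xi> * (of_real r + \<i> * of_real (s - q * t))))" for t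
  proof -
    let ?h = "\<lambda>\<xi>. exp (of_real \<xi> * (of_real r + \<i> * of_real (s - q * t)))"
    have "F \<xi> t = G t * (indicator {a..b} \<xi> *\<^sub>R ?h \<xi>)" for \<xi>
      by (simp add: F_def cis_conv_exp algebra_simps flip: exp_add)
    then have "(LINT \<xi>|lborel. F \<xi> t) = G t * (LINT \<xi>|lborel. indicator {a..b} \<xi> *\<^sub>R ?h \<xi>)"
      by (simp only: Bochner_Integration.integral_mult_right_zero)
    moreover have "set_integrable lborel {a..b} ?h"
      unfolding set_integrable_def by (rule borel_integrable_compact) (auto intro!: continuous_intros)
    ultimately show ?thesis
      using set_borel_integral_eq_integral(2)[of "{a..b}" ?h] by (simp only: set_lebesgue_integral_def)
  qed
  ultimately show ?thesis by simp
qed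

text \<open>Here \<open>L\<close> is 1/\<alpha>, and the two hypotheses are orthogonality to the
  translates of two neighbouring modulations. At m = 0 they say that \<open>K\<close> vanishes at
  both ends of the interval: the right end makes the extension by zero continuous, the left end
  fixes the constant that the nonzero Fourier coefficients leave open.\<close>

lemma cauchy_orthogonal_imp_fourier_eq_0:
  assumes w: "w > 0" and \<beta>: "0 < \<beta>" "\<beta> \<le> L" and f: "f \<in> L2"
    and h0: "\<And>m::int. (LINT t|lborel. f t / (of_real (t - of_int m / L) + \<i> * of_real w)) = 0"
    and h1: "\<And>m::int. (LINT t|lborel. f t * cis (- (2 * pi * \<beta>) * t) / (of_real (t - of_int m / L) + \<i> * of_real w)) = 0"
    and \<xi>: "\<xi> \<in> {0..\<beta>}"
  shows "(LINT t|lborel. f t / (of_real t + \<i> * of_real w) * cis (\<xi> * (- (2 * pi) * t))) = 0"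
proof -
  define G where "G t = f t / (of_real t + \<i> * of_real w)" for t
  have G: "integrable lborel G"
    using cauchy_pairing_integrable[OF w f, of 0 0] by (simp add: G_def[abs_def])
  \<comment> \<open>The weight turns the exponent into -2 pi i \<xi> (t + i w). Together with the
    character of index \<open>m\<close>, the integral over \<xi> then produces the pole factor of
    the translate by \<open>m\<close>.\<close>
  define K where "K \<xi> = exp (of_real (\<xi> * (2 * pi * w))) * (LINT t|lborel. G t * cis (\<xi> * (- (2 * pi) * t)))" for \<xi>
  have "continuous_on A (\<lambda>\<xi>. LINT t|lborel. G t * cis ((- (2 * pi) * \<xi>) * t))" for A
  proof -
    have "continuous_on A (\<lambda>\<xi>. - (2 * pi) * \<xi>)" by (intro continuous_intros)
    from continuous_on_compose2[OF continuous_on_fourier_integral[OF G, of UNIV] this] show ?thesis by simp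
  qed
  then have K_cont: "continuous_on A K" for A
    unfolding K_def by (intro continuous_intros) (simp add: mult_ac)
  have K0: "K 0 = 0" using h0[of 0] by (simp add: K_def G_def)
  have K\<beta>: "K \<beta> = 0"
    using h1[of 0] by (simp add: K_def G_def mult_ac)
  define K' where "K' \<xi> = (if \<xi> \<in> {0..\<beta>} then K \<xi> else 0)" for \<xi>
  have "continuous_on ({0..\<beta>} \<union> {\<beta>..L}) K'"
    unfolding K'_def
    by (rule continuous_on_If) (auto intro!: K_cont simp: K\<beta> K0 order_antisym)
  then have K'_cont: "continuous_on {0..L} K'"
    using \<beta> by (simp add: ivl_disj_un_two_touch)
  have "K' \<xi> = K' 0"
  proof (rule continuous_const_if_fourier_coeffs_eq_0[OF _ K'_cont])
    fix m :: int assume m: "m \<noteq> 0"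
    define y where "y = of_int m / L"
    have y: "y \<noteq> 0" using m \<beta> by (simp add: y_def)
    have "integral {0..L} (\<lambda>x. K' x * cis (2 * pi * of_int m * x / L))
        = integral {0..L} (\<lambda>x. if x \<in> {0..\<beta>} then K x * cis (2 * pi * of_int m * x / L) else 0)"
      by (rule integral_cong) (simp add: K'_def)
    also have "\<dots> = integral {0..\<beta>} (\<lambda>x. K x * cis (2 * pi * of_int m * x / L))"
      using \<beta> by (subst Henstock_Kurzweil_Integration.integral_restrict_Int) simp
    also have "\<dots> = integral {0..\<beta>} (\<lambda>x. exp (of_real (x * (2 * pi * w))) *
        (LINT t|lborel. G t * cis (x * (2 * pi * y - 2 * pi * t))))"
    proof (rule integral_cong)
      fix x
      have "(LINT t|lborel. G t * cis (x * (2 * pi * y - 2 * pi * t)))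
          = (LINT t|lborel. G t * cis (x * (- (2 * pi) * t)) * cis (2 * pi * of_int m * x / L))"
        by (simp add: y_def mult.assoc cis_mult algebra_simps)
      then show "K x * cis (2 * pi * of_int m * x / L) = exp (of_real (x * (2 * pi * w))) *
        (LINT t|lborel. G t * cis (x * (2 * pi * y - 2 * pi * t)))"
        by (simp add: K_def)
    qed
    also have "\<dots> = (LINT t|lborel. G t * integral {0..\<beta>} (\<lambda>x. exp (of_real x * (of_real (2 * pi * w) + \<i> * of_real (2 * pi * y - 2 * pi * t)))))"
      by (rule integral_fourier_swap[OF G])
    also have "\<dots> = (LINT t|lborel.
        (exp (of_real (2 * pi * \<beta> * w)) * cis (2 * pi * \<beta> * y) / (-2 * pi * \<i> * y)) *
          (f t * cis (- (2 * pi * \<beta>) * t) / (of_real (t - of_int m / L) + \<i> * of_real w)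
           - f t * cis (- (2 * pi * \<beta>) * t) / (of_real (t - of_int 0 / L) + \<i> * of_real w)) -
        (1 / (-2 * pi * \<i> * y)) *
          (f t / (of_real (t - of_int m / L) + \<i> * of_real w) - f t / (of_real (t - of_int 0 / L) + \<i> * of_real w)))"
    proof (rule Bochner_Integration.integral_cong[OF refl])
      fix t
      define A where "A = of_real t + \<i> * of_real w"
      define B where "B = of_real (t - y) + \<i> * of_real w"
      have A: "A \<noteq> 0" and B: "B \<noteq> 0" 
        using cauchy_kernel_nonzero_denom(1)[of w t] cauchy_kernel_nonzero_denom(1)[of w "t - y"] w
        by (auto simp: A_def B_def)
      have AB: "A - B = of_real y" by (simp add: A_def B_def)
      define E where "E = exp (of_real (2 * pi * \<beta> * w)) * cis (2 * pi * \<beta> * y) * cis (- (2 * pi * \<beta>) * t)"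
      have c: "of_real (2 * pi * w) + \<i> * of_real (2 * pi * y - 2 * pi * t) = - 2 * pi * \<i> * B"
        by (simp add: B_def complex_eq_iff algebra_simps)
      have "integral {0..\<beta>} (\<lambda>x. exp (of_real x * (- 2 * pi * \<i> * B))) = (exp ((- 2 * pi * \<i> * B) * of_real \<beta>) - 1) / (- 2 * pi * \<i> * B)"
        using has_integral_exp_of_real[of "- 2 * pi * \<i> * B" 0 \<beta>] B \<beta>
        by (intro integral_unique) (simp add: mult.commute)
      also have "exp ((- 2 * pi * \<i> * B) * of_real \<beta>) = E"
        unfolding c[symmetric] by (simp add: E_def cis_conv_exp algebra_simps flip: exp_add)
      finally have I: "integral {0..\<beta>} (\<lambda>x. exp (of_real x * (of_real (2 * pi * w) + \<i> * of_real (2 * pi * y - 2 * pi * t)))) = (E - 1) / (- 2 * pi * \<i> * B)"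
        unfolding c .
      \<comment> \<open>The two poles differ by \<open>y\<close>, which is nonzero as
        \<open>m\<close> is. Both resulting pieces pair \<open>f\<close> with kernels of the system,
        those at the translates \<open>m\<close> and 0.\<close>
      have pf: "1 / (A * B) = (1 / B - 1 / A) / of_real y"
      proof -
        have "1 / B - 1 / A = (A - B) / (A * B)" using A B by (simp add: divide_simps)
        then show ?thesis using y by (simp add: AB)
      qed
      have "G t * ((E - 1) / (- 2 * pi * \<i> * B)) = f t * (E - 1) / (- 2 * pi * \<i>) * (1 / (A * B))"
        by (simp add: G_def A_def)
      also have "\<dots> = f t * (E - 1) / (- 2 * pi * \<i>) * ((1 / B - 1 / A) / of_real y)"
        unfolding pf ..
      also have "\<dots> = (E / (-2 * pi * \<i> * y)) * (f t / B - f t / A) - (1 / (-2 * pi * \<i> * y)) * (f t / B - f t / A)"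
      proof -
        have "f t / B - f t / A = f t * (1 / B - 1 / A)" by (simp add: right_diff_distrib)
        moreover have "f t * (E - 1) / (- 2 * pi * \<i>) * (d / of_real y)
          = (E / (-2 * pi * \<i> * y)) * (f t * d) - (1 / (-2 * pi * \<i> * y)) * (f t * d)" for d
          using y by (simp add: field_simps)
        ultimately show ?thesis by (simp only:)
      qed
      finally have fin: "G t * ((E - 1) / (- 2 * pi * \<i> * B))
        = (E / (-2 * pi * \<i> * y)) * (f t / B - f t / A) - (1 / (-2 * pi * \<i> * y)) * (f t / B - f t / A)" .
      have BA: "of_real (t - of_int m / L) + \<i> * of_real w = B" "of_real (t - of_int 0 / L) + \<i> * of_real w = A"
        by (simp_all add: A_def B_def y_def)
      have fc: "f t * c / B - f t * c / A = c * (f t / B - f t / A)" for c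
        by (simp add: right_diff_distrib mult.commute)
      show "G t * integral {0..\<beta>} (\<lambda>x. exp (of_real x * (of_real (2 * pi * w) + \<i> * of_real (2 * pi * y - 2 * pi * t)))) = 
        (exp (of_real (2 * pi * \<beta> * w)) * cis (2 * pi * \<beta> * y) / (-2 * pi * \<i> * y)) *
          (f t * cis (- (2 * pi * \<beta>) * t) / (of_real (t - of_int m / L) + \<i> * of_real w)
           - f t * cis (- (2 * pi * \<beta>) * t) / (of_real (t - of_int 0 / L) + \<i> * of_real w)) -
        (1 / (-2 * pi * \<i> * y)) *
          (f t / (of_real (t - of_int m / L) + \<i> * of_real w) - f t / (of_real (t - of_int 0 / L) + \<i> * of_real w))"
        unfolding I fin BA fc by (simp add: E_def mult_ac)
    qed
    also have "\<dots> = 0"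
    proof -
      have i1: "integrable lborel (\<lambda>t. f t * cis (- (2 * pi * \<beta>) * t) / (of_real (t - of_int k / L) + \<i> * of_real w))" for k :: int
        by (rule cauchy_pairing_integrable[OF w f])
      have i0: "integrable lborel (\<lambda>t. f t / (of_real (t - of_int k / L) + \<i> * of_real w))" for k :: int
        using cauchy_pairing_integrable[OF w f, of 0 "of_int k / L"] by simp
      have D: "(LINT t|lborel. c * (p t - q t) - c' * (p' t - q' t))
          = c * ((LINT t|lborel. p t) - (LINT t|lborel. q t)) - c' * ((LINT t|lborel. p' t) - (LINT t|lborel. q' t))"
        if "integrable lborel p" "integrable lborel q" "integrable lborel p'" "integrable lborel q'"
        for c c' :: complex and p q p' q' :: "real \<Rightarrow> complex"
        using that by simp
      show ?thesis
        unfolding D[OF i1 i1 i0 i0] h0 h1 by simp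
    qed
    finally show "integral {0..L} (\<lambda>x. K' x * cis (2 * pi * of_int m * x / L)) = 0" .
  qed (use \<beta> \<xi> in auto)
  then have "K \<xi> = 0" using \<beta> \<xi> K0 by (auto simp: K'_def)
  then show ?thesis by (simp add: K_def G_def)
qed

section \<open>From one frequency cell to the whole Gabor system\<close>

lemma cnj_gabor_cauchy_kernel:
  "cnj (gabor_system \<alpha> \<beta> (cauchy_kernel w) (m, k) t)
    = cis (- (2 * pi * \<beta> * of_int k) * t) / (of_real (t - of_int m * \<alpha>) + \<i> * of_real w)"
proof -
  have "exp (2 * of_real pi * \<i> * of_real \<beta> * of_int k * of_real t) = cis (2 * pi * \<beta> * of_int k * t)"
    by (simp add: cis_conv_exp mult_ac)
  then show ?thesis by (simp add: gabor_system_def cauchy_kernel_def cis_cnj mult.commute)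
qed

lemma L2_inner_gabor_cauchy_kernel:
  "L2_inner f (gabor_system \<alpha> \<beta> (cauchy_kernel w) (m, k))
    = (LINT t|lborel. f t * cis (- (2 * pi * \<beta> * of_int k) * t) / (of_real (t - of_int m * \<alpha>) + \<i> * of_real w))"
  by (simp add: L2_inner_def cnj_gabor_cauchy_kernel)

lemma gabor_cauchy_kernel_L2:
  assumes "w > 0"
  shows "gabor_system \<alpha> \<beta> (cauchy_kernel w) j \<in> L2"
proof (cases j)
  case (Pair m k)
  have "(\<lambda>t. cnj (gabor_system \<alpha> \<beta> (cauchy_kernel w) (m, k) t)) \<in> L2"
    unfolding cnj_gabor_cauchy_kernel
    using cis_mult_L2[OF cauchy_kernel_L2[OF assms, of "of_int m * \<alpha>"], of "- (2 * pi * \<beta> * of_int k)"]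
    by simp
  from L2_cnj[OF this] show ?thesis by (simp add: Pair)
qed

text \<open>A frequency \<xi> is brought into [0, \<beta>] by modulating \<open>f\<close> with the
  floor of \<xi>/\<beta>; orthogonality to all modulations is invariant under this. The transform is
  taken of f(t)/(t + i w), which is integrable although \<open>f\<close> itself need not be, so
  uniqueness for integrable functions suffices.\<close>

lemma gabor_cauchy_kernel_complete:
  assumes w: "w > 0" and \<alpha>: "\<alpha> > 0" and \<beta>: "\<beta> > 0" "\<alpha> * \<beta> \<le> 1" and f: "f \<in> L2"
    and orth: "\<And>m k. L2_inner f (gabor_system \<alpha> \<beta> (cauchy_kernel w) (m, k)) = 0"
  shows "AE t in lborel. f t = 0"
proof -
  have z: "(LINT t|lborel. f t / (of_real t + \<i> * of_real w) * cis (\<xi> * (- (2 * pi) * t))) = 0" for \<xi>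
  proof -
    define k where "k = \<lfloor>\<xi> / \<beta>\<rfloor>"
    define r where "r = \<xi> - of_int k * \<beta>"
    have "of_int k \<le> \<xi> / \<beta>" "\<xi> / \<beta> \<le> of_int k + 1" unfolding k_def by linarith+
    then have r: "r \<in> {0..\<beta>}" using \<beta>(1) by (simp add: r_def field_simps)
    define F where "F t = f t * cis (- (2 * pi * \<beta> * of_int k) * t)" for t
    have F: "F \<in> L2" unfolding F_def by (rule cis_mult_L2[OF f])
    have "(LINT t|lborel. F t / (of_real t + \<i> * of_real w) * cis (r * (- (2 * pi) * t))) = 0"
    proof (rule cauchy_orthogonal_imp_fourier_eq_0[OF w \<beta>(1) _ F _ _ r])
      show "\<beta> \<le> 1 / \<alpha>" using \<alpha> \<beta> by (simp add: field_simps)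
      fix m :: int
      show "(LINT t|lborel. F t / (of_real (t - of_int m / (1 / \<alpha>)) + \<i> * of_real w)) = 0"
        using orth[of m k] by (simp add: L2_inner_gabor_cauchy_kernel F_def)
      have "F t * cis (- (2 * pi * \<beta>) * t) = f t * cis (- (2 * pi * \<beta> * of_int (k + 1)) * t)" for t
        by (simp add: F_def mult.assoc cis_mult algebra_simps)
      then show "(LINT t|lborel. F t * cis (- (2 * pi * \<beta>) * t) / (of_real (t - of_int m / (1 / \<alpha>)) + \<i> * of_real w)) = 0"
        using orth[of m "k + 1"] by (simp add: L2_inner_gabor_cauchy_kernel)
    qed
    moreover have "F t / (of_real t + \<i> * of_real w) * cis (r * (- (2 * pi) * t))
        = f t / (of_real t + \<i> * of_real w) * cis (\<xi> * (- (2 * pi) * t))" for t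
      by (simp add: F_def r_def mult.assoc cis_mult algebra_simps)
    ultimately show ?thesis by (simp only:)
  qed
  have "AE t in lborel. f t / (of_real t + \<i> * of_real w) = 0"
  proof (rule AE_eq_0_if_fourier_eq_0)
    show "integrable lborel (\<lambda>t. f t / (of_real t + \<i> * of_real w))"
      using cauchy_pairing_integrable[OF w f, of 0 0] by simp
    fix \<xi>
    show "(LINT t|lborel. f t / (of_real t + \<i> * of_real w) * cis (\<xi> * t)) = 0"
      using z[of "- \<xi> / (2 * pi)"] by simp
  qed
  then show ?thesis using w by simp
qed

section \<open>Fourier inversion\<close>

lemma LINT_std_normal_cis:
  "(LINT x|lborel. of_real (std_normal_density x) * cis (s * x)) = of_real (exp (- s\<^sup>2 / 2))"
proof -
  have "char std_normal_distribution s = (LINT x|lborel. std_normal_density x *\<^sub>R iexp (s * x))"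
    unfolding char_def by (subst integral_density) auto
  then show ?thesis
    by (simp add: char_std_normal_distribution scaleR_conv_of_real cis_conv_exp)
qed

lemma std_normal_density_le: "std_normal_density x \<le> std_normal_density 0"
  by (simp add: std_normal_density_def divide_right_mono)

lemma integrable_std_normal_density: "integrable lborel std_normal_density"
  using integrable_std_normal_moment[of 0] by simp

lemma LINT_std_normal_density: "(LINT x|lborel. std_normal_density x) = 1"
  using integral_std_normal_moment_even[of 0] by simp

lemma LINT_scaled_std_normal_cis:
  assumes "\<epsilon> > 0"
  shows "(LINT t|lborel. of_real (std_normal_density (\<epsilon> * t)) * cis (s * t))
    = of_real (sqrt (2 * pi) / \<epsilon> * std_normal_density (s / \<epsilon>))"
proof -
  have "(LINT t|lborel. of_real (std_normal_density (\<epsilon> * t)) * cis (s * t))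
      = (1 / \<epsilon>) *\<^sub>R (LINT x|lborel. of_real (std_normal_density x) * cis (s / \<epsilon> * x))"
    using assms by (subst lborel_integral_real_affine[where c = "1 / \<epsilon>" and t = 0]) (auto simp: field_simps)
  also have "\<dots> = of_real (sqrt (2 * pi) / \<epsilon> * std_normal_density (s / \<epsilon>))"
    unfolding LINT_std_normal_cis by (simp add: std_normal_density_def scaleR_conv_of_real)
  finally show ?thesis .
qed

text \<open>Inserting a Gaussian of width tending to infinity reduces the claim to an approximate identity.\<close>

theorem fourier_inversion_continuous:
  fixes h :: "real \<Rightarrow> complex"
  assumes h: "integrable lborel h" and bound: "\<And>v. cmod (h v) \<le> C" and cont: "isCont h u"
  defines "H \<equiv> (\<lambda>t. LINT v|lborel. h v * cis (- (t * v)))"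
  assumes H: "integrable lborel H"
  shows "(LINT t|lborel. H t * cis (t * u)) = 2 * pi * h u"
proof -
  have [measurable]: "h \<in> borel_measurable borel" "H \<in> borel_measurable borel" using h H by auto
  define \<epsilon> :: "nat \<Rightarrow> real" where "\<epsilon> n = 1 / (real n + 1)" for n
  have \<epsilon>: "\<epsilon> n > 0" for n by (simp add: \<epsilon>_def)
  have \<epsilon>0: "\<epsilon> \<longlonglongrightarrow> 0"
    unfolding \<epsilon>_def using LIMSEQ_inverse_real_of_nat by (simp add: inverse_eq_divide add.commute)
  let ?\<phi> = std_normal_density
  have \<phi>_cont: "isCont ?\<phi> x" for x
    unfolding std_normal_density_def[abs_def] by (intro continuous_intros) simp_all
  define J where "J n = (LINT t|lborel. H t * cis (t * u) * of_real (?\<phi> (\<epsilon> n * t)))" for n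
  \<comment> \<open>The Gaussian flattens to the constant \<open>?\<phi> 0\<close>, and
    \<open>H\<close> is integrable, so dominated convergence applies.\<close>
  have "J \<longlonglongrightarrow> (LINT t|lborel. H t * cis (t * u) * of_real (?\<phi> (0 * t)))"
    unfolding J_def
  proof (rule integral_dominated_convergence[where w = "\<lambda>t. cmod (H t) * ?\<phi> 0"])
    show "AE t in lborel. (\<lambda>n. H t * cis (t * u) * of_real (?\<phi> (\<epsilon> n * t))) \<longlonglongrightarrow> H t * cis (t * u) * of_real (?\<phi> (0 * t))"
      by (intro AE_I2 tendsto_intros isCont_tendsto_compose[OF \<phi>_cont] \<epsilon>0)
    show "AE t in lborel. norm (H t * cis (t * u) * of_real (?\<phi> (\<epsilon> n * t))) \<le> cmod (H t) * ?\<phi> 0" for n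
      by (auto simp: norm_mult intro!: mult_left_mono std_normal_density_le)
  qed (use H in auto)
  then have lim1: "J \<longlonglongrightarrow> (LINT t|lborel. H t * cis (t * u)) * of_real (?\<phi> 0)" by simp
  \<comment> \<open>The Gaussian makes the double integral absolutely convergent. Its transform is
    again a Gaussian, now of width \<open>\<epsilon> n\<close> around \<open>u\<close>, and a
    substitution makes the weight independent of \<open>n\<close>.\<close>
  have J_eq: "J n = of_real (sqrt (2 * pi)) * (LINT x|lborel. h (u + \<epsilon> n * x) * of_real (?\<phi> x))" for n
  proof -
    define F where "F t v = h v * cis (- (t * v)) * cis (t * u) * of_real (?\<phi> (\<epsilon> n * t))" for t v
    have [measurable]: "(\<lambda>(t, v). F t v) \<in> borel_measurable (lborel \<Otimes>\<^sub>M lborel)"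
      unfolding F_def by measurable
    have norm_F: "norm (F t v) = ?\<phi> (\<epsilon> n * t) * cmod (h v)" for t v
      by (simp add: F_def norm_mult)
    have i\<phi>: "integrable lborel (\<lambda>t. ?\<phi> (\<epsilon> n * t))"
      using lborel_integrable_real_affine[OF integrable_std_normal_density, of "\<epsilon> n" 0] \<epsilon>[of n] by simp
    have iF: "integrable (lborel \<Otimes>\<^sub>M lborel) (\<lambda>(t, v). F t v)"
    proof (rule lborel_pair.Fubini_integrable)
      show "integrable lborel (\<lambda>t. LINT v|lborel. norm (case (t, v) of (t, v) \<Rightarrow> F t v))"
        using i\<phi> by (simp add: norm_F)
      show "AE t in lborel. integrable lborel (\<lambda>v. case (t, v) of (t, v) \<Rightarrow> F t v)"
      proof (rule AE_I2)
        fix t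
        have "integrable lborel (\<lambda>v. ?\<phi> (\<epsilon> n * t) * cmod (h v))" using h by simp
        then show "integrable lborel (\<lambda>v. case (t, v) of (t, v) \<Rightarrow> F t v)"
          unfolding prod.case by (rule Bochner_Integration.integrable_bound) (auto simp: norm_F)
      qed
    qed fact
    have "J n = (LINT t|lborel. LINT v|lborel. F t v)"
      unfolding J_def F_def H_def by (simp only: Bochner_Integration.integral_mult_left_zero)
    also have "\<dots> = (LINT v|lborel. LINT t|lborel. F t v)"
      using lborel_pair.Fubini_integral[OF iF] by simp
    also have "\<dots> = (LINT v|lborel. h v * of_real (sqrt (2 * pi) / \<epsilon> n * ?\<phi> ((u - v) / \<epsilon> n)))"
    proof (rule Bochner_Integration.integral_cong[OF refl])
      fix v
      have "F t v = h v * (of_real (?\<phi> (\<epsilon> n * t)) * cis ((u - v) * t))" for t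
        by (simp add: F_def mult_ac cis_mult) (simp add: algebra_simps)
      then show "(LINT t|lborel. F t v) = h v * of_real (sqrt (2 * pi) / \<epsilon> n * ?\<phi> ((u - v) / \<epsilon> n))"
        by (simp only: Bochner_Integration.integral_mult_right_zero LINT_scaled_std_normal_cis[OF \<epsilon>])
    qed
    also have "\<dots> = \<epsilon> n *\<^sub>R (LINT x|lborel. h (u + \<epsilon> n * x) * of_real (sqrt (2 * pi) / \<epsilon> n * ?\<phi> (- x)))"
      using \<epsilon>[of n] by (subst lborel_integral_real_affine[where c = "\<epsilon> n" and t = u]) auto
    also have "\<dots> = (LINT x|lborel. of_real (sqrt (2 * pi)) * (h (u + \<epsilon> n * x) * of_real (?\<phi> x)))"
    proof -
      have "\<epsilon> n *\<^sub>R (h (u + \<epsilon> n * x) * of_real (sqrt (2 * pi) / \<epsilon> n * ?\<phi> (- x)))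
         = of_real (sqrt (2 * pi)) * (h (u + \<epsilon> n * x) * of_real (?\<phi> x))" for x
        using \<epsilon>[of n] by (simp add: std_normal_density_def scaleR_conv_of_real)
      then show ?thesis
        by (simp only: integral_scaleR_right[symmetric])
    qed
    also have "\<dots> = of_real (sqrt (2 * pi)) * (LINT x|lborel. h (u + \<epsilon> n * x) * of_real (?\<phi> x))"
      by (rule Bochner_Integration.integral_mult_right_zero)
    finally show ?thesis .
  qed
  have "(\<lambda>n. LINT x|lborel. h (u + \<epsilon> n * x) * of_real (?\<phi> x)) \<longlonglongrightarrow> (LINT x|lborel. h (u + 0 * x) * of_real (?\<phi> x))"
  proof (rule integral_dominated_convergence[where w = "\<lambda>x. C * ?\<phi> x"])
    have "(\<lambda>n. h (u + \<epsilon> n * x)) \<longlonglongrightarrow> h (u + 0 * x)" for x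
      by (rule isCont_tendsto_compose[OF _ tendsto_add[OF tendsto_const tendsto_mult[OF \<epsilon>0 tendsto_const]]])
         (simp add: cont)
    then show "AE x in lborel. (\<lambda>n. h (u + \<epsilon> n * x) * of_real (?\<phi> x)) \<longlonglongrightarrow> h (u + 0 * x) * of_real (?\<phi> x)"
      by (intro AE_I2 tendsto_mult) auto
    show "AE x in lborel. norm (h (u + \<epsilon> n * x) * of_real (?\<phi> x)) \<le> C * ?\<phi> x" for n
      by (auto simp: norm_mult intro!: mult_right_mono bound)
  qed (use integrable_std_normal_density in auto)
  also have "(LINT x|lborel. h (u + 0 * x) * of_real (?\<phi> x)) = h u"
    by (simp add: integral_complex_of_real LINT_std_normal_density)
  finally have "J \<longlonglongrightarrow> of_real (sqrt (2 * pi)) * h u"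
    unfolding J_eq by (intro tendsto_intros)
  \<comment> \<open>As \<open>?\<phi> 0\<close> is 1/sqrt(2 pi), comparing the two limits yields the
    factor 2 pi.\<close>
  with lim1 have "(LINT t|lborel. H t * cis (t * u)) * of_real (?\<phi> 0) = of_real (sqrt (2 * pi)) * h u"
    using LIMSEQ_unique by blast
  then have "(LINT t|lborel. H t * cis (t * u)) * of_real (1 / sqrt (2 * pi)) = of_real (sqrt (2 * pi)) * h u"
    by (simp add: std_normal_density_def)
  then have "(LINT t|lborel. H t * cis (t * u)) = h u * (of_real (sqrt (2 * pi)) * of_real (sqrt (2 * pi)))"
    by (simp add: field_simps)
  also have "complex_of_real (sqrt (2 * pi)) * of_real (sqrt (2 * pi)) = of_real (2 * pi)"
    unfolding of_real_mult[symmetric] by (subst real_sqrt_mult_self) simp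
  finally show ?thesis by (simp add: mult.commute)
qed

section \<open>Line integrals of exponentials with two poles\<close>

text \<open>Up to a constant this is an Erlang density, whose integral is finite.\<close>

lemma integrable_power_exp:
  fixes l :: real assumes l: "l > 0"
  shows "integrable lborel (\<lambda>u::real. indicator {0<..} u * (u ^ k * exp (- (l * u))))"
proof -
  have "(\<integral>\<^sup>+ x. ennreal (erlang_density k l x) \<partial>lborel) < \<infinity>"
    using nn_integral_erlang_ith_moment[OF l, of k 0] by (simp add: ennreal_numeral)
  then have "integrable lborel (erlang_density k l)"
    using l by (intro integrableI_nonneg) auto
  then have "integrable lborel (\<lambda>u. (fact k / l ^ Suc k) * erlang_density k l u)" by simp
  then show ?thesis
    by (rule Bochner_Integration.integrable_bound)
       (use l in \<open>auto simp: erlang_density_def abs_mult split: split_indicator\<close>)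
qed

lemma set_integrable_power_cexp:
  fixes c :: complex assumes c: "Re c > 0"
  shows "set_integrable lborel {0<..} (\<lambda>u::real. of_real u ^ k * exp (- c * of_real u))"
  unfolding set_integrable_def
  by (rule Bochner_Integration.integrable_bound[OF integrable_power_exp[OF c, of k]])
     (auto simp: norm_mult norm_power abs_mult split: split_indicator)

lemma tendsto_power_cexp_at_top:
  fixes c :: complex assumes c: "Re c > 0"
  shows "((\<lambda>u::real. of_real u ^ k * exp (- c * of_real u)) \<longlongrightarrow> 0) at_top"
proof (rule tendsto_norm_zero_cancel)
  have "((\<lambda>u::real. u ^ k / exp (Re c * u)) \<longlongrightarrow> 0) at_top"
  proof -
    have "filterlim (\<lambda>u. Re c * u) at_top at_top"
      using c by (intro filterlim_tendsto_pos_mult_at_top[OF tendsto_const]) (auto intro: filterlim_ident)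
    from filterlim_compose[OF tendsto_power_div_exp_0 this, of k]
    have "((\<lambda>u. (1 / Re c ^ k) * ((Re c * u) ^ k / exp (Re c * u))) \<longlongrightarrow> (1 / Re c ^ k) * 0) at_top"
      by (intro tendsto_intros)
    then show ?thesis using c by (simp add: power_mult_distrib)
  qed
  then have "((\<lambda>u::real. \<bar>u ^ k / exp (Re c * u)\<bar>) \<longlongrightarrow> 0) at_top"
    by (rule tendsto_rabs_zero)
  then show "((\<lambda>u. norm (complex_of_real u ^ k * exp (- c * of_real u))) \<longlongrightarrow> 0) at_top"
    by (simp add: norm_mult norm_power norm_inverse exp_minus divide_inverse abs_mult power_abs)
qed

lemma LINT_cexp:
  assumes c: "Re c > 0"
  shows "(LINT u:{0<..}|lborel. exp (- c * of_real u)) = 1 / c"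
proof -
  have c0: "c \<noteq> 0" using c by auto
  have "(LBINT u=ereal 0..\<infinity>. exp (- c * of_real u)) = 0 - (- 1 / c)"
  proof (rule interval_integral_FTC_integrable[where F = "\<lambda>u. exp (- c * of_real u) * (- 1 / c)"])
    fix x :: real
    show "((\<lambda>u. exp (- c * of_real u) * (- 1 / c)) has_vector_derivative exp (- c * of_real x)) (at x)"
      using has_vector_derivative_mult_left[OF has_vector_derivative_exp_of_real, of "- c" "- 1 / c" x UNIV] c0
      by simp
    show "isCont (\<lambda>u. exp (- c * of_real u)) x" by (intro continuous_intros)
  next
    show "set_integrable lborel (einterval (ereal 0) \<infinity>) (\<lambda>u. exp (- c * complex_of_real u))"
      using set_integrable_power_cexp[OF c, of 0] by (simp add: einterval_def greaterThan_def)
    have "((\<lambda>u. exp (- c * complex_of_real u) * (- 1 / c)) \<longlongrightarrow> exp (- c * complex_of_real 0) * (- 1 / c)) (at_right 0)"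
      by (intro tendsto_intros)
    then show "(((\<lambda>u. exp (- c * complex_of_real u) * (- 1 / c)) \<circ> real_of_ereal) \<longlongrightarrow> - 1 / c) (at_right (ereal 0))"
      unfolding ereal_tendsto_simps by simp
    have "((\<lambda>u::real. exp (- c * complex_of_real u) * (- 1 / c)) \<longlongrightarrow> 0 * (- 1 / c)) at_top"
      using tendsto_power_cexp_at_top[OF c, of 0] by (intro tendsto_intros) simp
    then show "(((\<lambda>u. exp (- c * complex_of_real u) * (- 1 / c)) \<circ> real_of_ereal) \<longlongrightarrow> 0) (at_left \<infinity>)"
      unfolding ereal_tendsto_simps by simp
  qed simp
  then show ?thesis by (simp add: interval_integral_to_infinity_eq)
qed

lemma LINT_times_cexp:
  assumes c: "Re c > 0"
  shows "(LINT u:{0<..}|lborel. of_real u * exp (- c * of_real u)) = 1 / c\<^sup>2"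
proof -
  have c0: "c \<noteq> 0" using c by auto
  \<comment> \<open>Obtained by integrating u exp(-c u) by parts.\<close>
  let ?F = "\<lambda>u::real. exp (- c * of_real u) * (- 1 / c\<^sup>2) + of_real u * (exp (- c * of_real u) * (- 1 / c))"
  have "(LBINT u=ereal 0..\<infinity>. of_real u * exp (- c * of_real u)) = 0 - (- 1 / c\<^sup>2)"
  proof (rule interval_integral_FTC_integrable[where F = ?F])
    fix x :: real
    have d: "((\<lambda>u. exp (- c * of_real u)) has_vector_derivative - c * exp (- c * of_real x)) (at x)"
      by (rule has_vector_derivative_exp_of_real)
    have "(?F has_vector_derivative (- c * exp (- c * of_real x)) * (- 1 / c\<^sup>2) +
       (of_real x * ((- c * exp (- c * of_real x)) * (- 1 / c)) + 1 * (exp (- c * of_real x) * (- 1 / c)))) (at x)"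
      by (intro has_vector_derivative_add has_vector_derivative_mult has_vector_derivative_mult_left d
           has_vector_derivative_of_real) (auto intro!: derivative_eq_intros)
    then show "(?F has_vector_derivative of_real x * exp (- c * of_real x)) (at x)"
      using c0 by (simp add: power2_eq_square)
    show "isCont (\<lambda>u. complex_of_real u * exp (- c * of_real u)) x" by (intro continuous_intros)
  next
    show "set_integrable lborel (einterval (ereal 0) \<infinity>) (\<lambda>u. complex_of_real u * exp (- c * complex_of_real u))"
      using set_integrable_power_cexp[OF c, of 1] by (simp add: einterval_def greaterThan_def)
    have "(?F \<longlongrightarrow> exp (- c * complex_of_real 0) * (- 1 / c\<^sup>2) + of_real 0 * (exp (- c * of_real 0) * (- 1 / c))) (at_right 0)"
      by (intro tendsto_intros)
    then show "((?F \<circ> real_of_ereal) \<longlongrightarrow> - 1 / c\<^sup>2) (at_right (ereal 0))"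
      unfolding ereal_tendsto_simps by simp
    have "((\<lambda>u::real. of_real u ^ 0 * exp (- c * complex_of_real u) * (- 1 / c\<^sup>2) + of_real u ^ 1 * exp (- c * of_real u) * (- 1 / c)) \<longlongrightarrow> 0 * (- 1 / c\<^sup>2) + 0 * (- 1 / c)) at_top"
      by (intro tendsto_add tendsto_mult tendsto_const tendsto_power_cexp_at_top[OF c])
    then show "((?F \<circ> real_of_ereal) \<longlongrightarrow> 0) (at_left \<infinity>)"
      unfolding ereal_tendsto_simps by simp
  qed simp
  then show ?thesis by (simp add: interval_integral_to_infinity_eq)
qed

section \<open>Primitives of characters and integrals with two poles\<close>

text \<open>The primitive of \<open>cis (y * u)\<close> that vanishes at 0. The case y = 0 is
  separate because the quotient would collapse to 0 by the convention for division by 0; it occurs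
  when two poles coincide.\<close>

definition cis_primitive :: "real \<Rightarrow> real \<Rightarrow> complex" where
  "cis_primitive y u = (if y = 0 then of_real u else (cis (y * u) - 1) / (\<i> * of_real y))"

lemma has_vector_derivative_cis_primitive:
  "(cis_primitive y has_vector_derivative cis (y * u)) (at u within A)"
proof (cases "y = 0")
  case True
  then show ?thesis by (auto simp: cis_primitive_def[abs_def] intro!: derivative_eq_intros)
next
  case False
  have "((\<lambda>u. exp (\<i> * of_real y * of_real u) * (1 / (\<i> * of_real y)) - 1 / (\<i> * of_real y)) has_vector_derivative
     (\<i> * of_real y * exp (\<i> * of_real y * of_real u)) * (1 / (\<i> * of_real y)) - 0) (at u within A)"
    by (intro has_vector_derivative_diff has_vector_derivative_const has_vector_derivative_mult_left has_vector_derivative_exp_of_real)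
  with False show ?thesis
    by (simp add: cis_primitive_def[abs_def] cis_conv_exp diff_divide_distrib mult.assoc)
qed

lemma cis_primitive_0 [simp]: "cis_primitive y 0 = 0"
  by (simp add: cis_primitive_def)

lemma isCont_cis_primitive: "isCont (cis_primitive y) u"
  by (rule has_vector_derivative_continuous[OF has_vector_derivative_cis_primitive])

lemma continuous_on_cis_primitive [continuous_intros]: "continuous_on A (cis_primitive y)"
  by (simp add: continuous_at_imp_continuous_on isCont_cis_primitive)

lemma has_integral_cis_primitive:
  "a \<le> b \<Longrightarrow> ((\<lambda>u. cis (y * u)) has_integral cis_primitive y b - cis_primitive y a) {a..b}"
  by (rule fundamental_theorem_of_calculus) (auto intro: has_vector_derivative_cis_primitive)

lemma cmod_cis_primitive_diff_le: "a \<le> b \<Longrightarrow> cmod (cis_primitive y b - cis_primitive y a) \<le> b - a"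
  using has_integral_bound[of 1 "\<lambda>u. cis (y * u)" "cis_primitive y b - cis_primitive y a" a b]
    has_integral_cis_primitive[of a b y] by simp

lemma borel_measurable_cis_primitive [measurable]: "cis_primitive y \<in> borel_measurable borel"
  by (rule borel_measurable_continuous_onI) (rule continuous_on_cis_primitive)

lemma cnj_cis_primitive: "cnj (cis_primitive y u) = cis_primitive (- y) u"
  by (simp add: cis_primitive_def cis_cnj)

text \<open>A Laplace transform: for nonzero \<open>y\<close> a difference of two exponentials
  yields the factors c and c - i y, and y = 0 gives the double pole. That both cases take one form
  is the point of \<open>cis_primitive\<close>.\<close>

lemma LINT_cis_primitive_cexp:
  assumes c: "Re c > 0"
  shows "(LINT u:{0<..}|lborel. cis_primitive y u * exp (- c * of_real u)) = 1 / (c * (c - \<i> * of_real y))"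
proof (cases "y = 0")
  case True
  then show ?thesis using LINT_times_cexp[OF c] by (simp add: cis_primitive_def power2_eq_square)
next
  case False
  have c': "Re (c - \<i> * of_real y) > 0" using c by simp
  have c0: "c \<noteq> 0" "c - \<i> * of_real y \<noteq> 0" using c c' by (metis zero_complex.sel(1) less_irrefl)+
  have "cis_primitive y u * exp (- c * of_real u)
      = (1 / (\<i> * of_real y)) * (exp (- (c - \<i> * of_real y) * of_real u) - exp (- c * of_real u))" for u
    using False by (simp add: cis_primitive_def cis_conv_exp field_simps flip: exp_add)
  moreover have "(LINT u:{0<..}|lborel. exp (- (c - \<i> * of_real y) * of_real u) - exp (- c * of_real u))
      = 1 / (c - \<i> * of_real y) - 1 / c"
    using set_integrable_power_cexp[OF c, of 0] set_integrable_power_cexp[OF c', of 0]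
    by (subst set_integral_diff) (simp_all only: LINT_cexp[OF c] LINT_cexp[OF c'] power_0 mult_1)
  ultimately have "(LINT u:{0<..}|lborel. cis_primitive y u * exp (- c * of_real u))
      = (1 / (\<i> * of_real y)) * (1 / (c - \<i> * of_real y) - 1 / c)"
    by (simp only: set_integral_mult_right)
  also have "1 / (c - \<i> * of_real y) - 1 / c = (\<i> * of_real y) / (c * (c - \<i> * of_real y))"
    using c0 by (simp add: field_simps)
  finally show ?thesis using False by simp
qed

text \<open>Fourier inversion takes the place of a residue computation. The function
  \<open>h\<close> is a damped primitive supported on the positive half-line, and its transform is
  the two-pole kernel up to sign and conjugation. \<open>h\<close> is continuous at 0 since the
  primitive vanishes there, and two poles make the kernel integrable, as inversion requires.\<close>

lemma LINT_cis_cauchy_pair: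
  assumes w: "w > 0"
  shows "(LINT t|lborel. cis (- (u * t)) / ((of_real t + \<i> * of_real w) * (of_real (t - y) + \<i> * of_real w)))
    = - 2 * pi * exp (- (w * u)) * cis_primitive (- y) (max 0 u)"
proof -
  define h where "h u = of_real (exp (- (w * u))) * cis_primitive y (max 0 u)" for u
  have [measurable]: "h \<in> borel_measurable borel" unfolding h_def by measurable
  have h_eq: "h u * cis (- (t * u)) = indicator {0<..} u *\<^sub>R (cis_primitive y u * exp (- (of_real w + \<i> * of_real t) * of_real u))" for t u
    by (cases "u > 0") (simp_all add: h_def cis_conv_exp exp_of_real[symmetric] algebra_simps flip: exp_add)
  have h_le: "cmod (h u) \<le> indicator {0<..} u * (u ^ 1 * exp (- (w * u)))" for u
    using cmod_cis_primitive_diff_le[of 0 u y] by (cases "u > 0") (simp_all add: h_def norm_mult)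
  have "integrable lborel h"
    by (rule Bochner_Integration.integrable_bound[OF integrable_power_exp[OF w, of 1]])
       (use h_le in \<open>auto intro: order_trans[OF _ abs_ge_self]\<close>)
  moreover have "cmod (h u) \<le> 1 / w" for u
  proof -
    have "w * u \<le> exp (w * u)" using exp_ge_add_one_self[of "w * u"] by linarith
    then have "u * exp (- (w * u)) \<le> 1 / w" using w by (simp add: exp_minus field_simps)
    then show ?thesis using h_le[of u] w by (cases "u > 0") auto
  qed
  moreover have "isCont h u" for u
  proof -
    have "isCont (\<lambda>x::real. max 0 x) u" unfolding isCont_def by (intro tendsto_intros)
    then have "isCont (\<lambda>x. cis_primitive y (max 0 x)) u" by (rule isCont_o2[OF _ isCont_cis_primitive])
    then show ?thesis unfolding h_def by (intro continuous_intros)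
  qed
  moreover define H where "H t = (LINT v|lborel. h v * cis (- (t * v)))" for t
  \<comment> \<open>Since w + i t = i (t - i w), the two factors i produce the minus sign; the
    conjugate accounts for the poles lying on the other side of the real line.\<close>
  have H_eq: "H t = - cnj (1 / ((of_real t + \<i> * of_real w) * (of_real (t - y) + \<i> * of_real w)))" for t
  proof -
    have "H t = 1 / ((of_real w + \<i> * of_real t) * (of_real w + \<i> * of_real t - \<i> * of_real y))"
      unfolding H_def h_eq using LINT_cis_primitive_cexp[of "of_real w + \<i> * of_real t" y] w
      by (simp add: set_lebesgue_integral_def)
    also have "(of_real w + \<i> * of_real t) * (of_real w + \<i> * of_real t - \<i> * of_real y)
        = - cnj ((of_real t + \<i> * of_real w) * (of_real (t - y) + \<i> * of_real w))"
      by (simp add: complex_eq_iff)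
    finally show ?thesis by simp
  qed
  have "integrable lborel (\<lambda>t. 1 / ((of_real t + \<i> * of_real w) * (of_real (t - y) + \<i> * of_real w)))"
    using L2_mult_integrable[OF cauchy_kernel_L2[OF w, of 0] cauchy_kernel_L2[OF w, of y]] by simp
  then have "integrable lborel H"
    unfolding H_eq[abs_def] by (intro Bochner_Integration.integrable_minus integrable_bounded_linear[OF bounded_linear_cnj])
  ultimately have "(LINT t|lborel. H t * cis (t * u)) = 2 * pi * h u"
    using fourier_inversion_continuous[of h "1 / w" u] unfolding H_def by blast
  then have "cnj (LINT t|lborel. H t * cis (t * u)) = cnj (2 * pi * h u)" by simp
  moreover have "cnj (LINT t|lborel. H t * cis (t * u))
     = - (LINT t|lborel. cis (- (u * t)) / ((of_real t + \<i> * of_real w) * (of_real (t - y) + \<i> * of_real w)))"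
    unfolding H_eq Bochner_Integration.integral_cnj[symmetric] integral_minus[symmetric]
    by (rule Bochner_Integration.integral_cong[OF refl]) (simp add: cis_cnj mult.commute)
  ultimately show ?thesis
    by (simp add: h_def cnj_cis_primitive equation_minus_iff)
qed

text \<open>Expressed in z = t + i w, the damping factors cancel. For \<sigma> \<ge> 0 the value is
  0: the exponential is bounded in the upper half-plane, and both poles lie below the real
  line.\<close>

lemma LINT_exp_cauchy_pair:
  assumes w: "w > 0"
  shows "(LINT t|lborel. exp (\<i> * of_real \<sigma> * (of_real t + \<i> * of_real w)) /
      ((of_real t + \<i> * of_real w) * (of_real (t - y) + \<i> * of_real w)))
    = - 2 * pi * cis_primitive (- y) (max 0 (- \<sigma>))"
proof -
  have "exp (\<i> * of_real \<sigma> * (of_real t + \<i> * of_real w)) = of_real (exp (- (w * \<sigma>))) * cis (- ((- \<sigma>) * t))" for t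
    by (simp add: cis_conv_exp exp_of_real[symmetric] algebra_simps flip: exp_add)
  then have "(LINT t|lborel. exp (\<i> * of_real \<sigma> * (of_real t + \<i> * of_real w)) /
      ((of_real t + \<i> * of_real w) * (of_real (t - y) + \<i> * of_real w)))
    = (LINT t|lborel. of_real (exp (- (w * \<sigma>))) * (cis (- ((- \<sigma>) * t)) / ((of_real t + \<i> * of_real w) * (of_real (t - y) + \<i> * of_real w))))"
    by (simp only: times_divide_eq_right)
  also have "\<dots> = of_real (exp (- (w * \<sigma>))) * (- 2 * pi * exp (- (w * (- \<sigma>))) * cis_primitive (- y) (max 0 (- \<sigma>)))"
    by (simp only: Bochner_Integration.integral_mult_right_zero LINT_cis_cauchy_pair[OF w])
  also have "\<dots> = - 2 * pi * of_real (exp (- (w * \<sigma>)) * exp (w * \<sigma>)) * cis_primitive (- y) (max 0 (- \<sigma>))"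
    by simp
  finally show ?thesis by (simp flip: exp_add)
qed

lemma integrable_exp_cauchy_pair:
  assumes w: "w > 0"
  shows "integrable lborel (\<lambda>t. exp (\<i> * of_real \<sigma> * (of_real t + \<i> * of_real w)) /
      ((of_real t + \<i> * of_real w) * (of_real (t - y) + \<i> * of_real w)))"
proof -
  have i: "integrable lborel (\<lambda>t. 1 / ((of_real t + \<i> * of_real w) * (of_real (t - y) + \<i> * of_real w)))"
    using L2_mult_integrable[OF cauchy_kernel_L2[OF w, of 0] cauchy_kernel_L2[OF w, of y]] by simp
  have "integrable lborel (\<lambda>t. of_real (exp (- (w * \<sigma>))) * (1 / ((of_real t + \<i> * of_real w) * (of_real (t - y) + \<i> * of_real w))))"
    using i by (rule integrable_mult_right)
  then show ?thesis
    by (rule Bochner_Integration.integrable_bound) (auto simp: norm_mult norm_divide mult.commute)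
qed

section \<open>Sums over the poles\<close>

lemma summable_on_int_powr:
  fixes p :: real
  assumes p: "p > 1"
  shows "(\<lambda>m::int. (1 + \<bar>of_int m\<bar>) powr - p) summable_on UNIV"
proof -
  have "summable (\<lambda>n. real (n + 1) powr - p)"
    using summable_real_powr_iff[of "- p"] p by (subst summable_iff_shift) auto
  then have nat: "(\<lambda>n::nat. (1 + real n) powr - p) summable_on UNIV"
    by (intro norm_summable_imp_summable_on) (simp add: add.commute)
  have "(\<lambda>m::int. (1 + \<bar>of_int m\<bar>) powr - p) summable_on range int"
    using nat by (subst summable_on_reindex) (auto simp: o_def)
  moreover have "(\<lambda>m::int. (1 + \<bar>of_int m\<bar>) powr - p) summable_on range (\<lambda>n. - int n)"
    using nat by (subst summable_on_reindex) (auto simp: o_def inj_on_def)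
  ultimately have "(\<lambda>m::int. (1 + \<bar>of_int m\<bar>) powr - p) summable_on (range int \<union> (range (\<lambda>n. - int n) - range int))"
    by (intro summable_on_Un_disjoint) (auto intro: summable_on_subset_banach)
  moreover have "range int \<union> (range (\<lambda>n. - int n) - range int) = UNIV"
    by (auto simp: image_iff) (metis int_cases2)
  ultimately show ?thesis by simp
qed

text \<open>The modulus of the denominator of the system at \<open>t\<close>, the same for all
  modulations. At t = 0 it also serves as the measure of decay in \<open>m\<close> of the
  coefficients.\<close>

definition pole_dist :: "real \<Rightarrow> real \<Rightarrow> real \<Rightarrow> int \<Rightarrow> real" where
  "pole_dist \<alpha> w t m = cmod (of_real (t - of_int m * \<alpha>) - \<i> * of_real w)"

lemma pole_dist_ge: "w > 0 \<Longrightarrow> pole_dist \<alpha> w t m \<ge> w"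
  using abs_Im_le_cmod[of "of_real (t - of_int m * \<alpha>) - \<i> * of_real w"] by (simp add: pole_dist_def)

text \<open>Compares with the index distance d to the floor of t/\<alpha>. For d \<le> 1 the
  imaginary part w suffices, whence w/2 against 1 + d \<le> 2. For d \<ge> 2 the real part is at
  least \<alpha> (d - 1), and d - 1 \<ge> (d + 1)/3, whence \<alpha>/3.\<close>

lemma pole_dist_lower:
  assumes w: "w > 0" and \<alpha>: "\<alpha> > 0"
  shows "min (\<alpha> / 3) (w / 2) * (1 + \<bar>of_int (m - \<lfloor>t / \<alpha>\<rfloor>)\<bar>) \<le> pole_dist \<alpha> w t m"
proof (cases "\<bar>m - \<lfloor>t / \<alpha>\<rfloor>\<bar> \<le> 1")
  case True
  then have "1 + \<bar>of_int (m - \<lfloor>t / \<alpha>\<rfloor>)\<bar> \<le> (2::real)" by linarith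
  then have "min (\<alpha> / 3) (w / 2) * (1 + \<bar>of_int (m - \<lfloor>t / \<alpha>\<rfloor>)\<bar>) \<le> (w / 2) * 2"
    using w \<alpha> by (intro mult_mono) auto
  then show ?thesis using pole_dist_ge[OF w, of \<alpha> t m] by linarith
next
  case False
  define d where "d = \<bar>of_int (m - \<lfloor>t / \<alpha>\<rfloor>) :: real\<bar>"
  have d: "d \<ge> 2" using False unfolding d_def by linarith
  have "d - 1 \<le> \<bar>t / \<alpha> - of_int m\<bar>" unfolding d_def by linarith
  then have "\<alpha> * (d - 1) \<le> \<alpha> * \<bar>t / \<alpha> - of_int m\<bar>" using \<alpha> by (intro mult_left_mono) auto
  also have "\<dots> = \<bar>\<alpha> * (t / \<alpha> - of_int m)\<bar>" using \<alpha> by (simp add: abs_mult)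
  also have "\<dots> = \<bar>t - of_int m * \<alpha>\<bar>" using \<alpha> by (simp add: algebra_simps)
  also have "\<dots> \<le> pole_dist \<alpha> w t m"
    using abs_Re_le_cmod[of "of_real (t - of_int m * \<alpha>) - \<i> * of_real w"] by (simp add: pole_dist_def)
  finally have 1: "\<alpha> * (d - 1) \<le> pole_dist \<alpha> w t m" .
  have "min (\<alpha> / 3) (w / 2) * (1 + d) \<le> (\<alpha> / 3) * (1 + d)"
    using d by (intro mult_right_mono) auto
  also have "\<dots> \<le> (\<alpha> / 3) * (3 * (d - 1))" using d \<alpha> by (intro mult_left_mono) auto
  also have "\<dots> = \<alpha> * (d - 1)" by simp
  finally have "min (\<alpha> / 3) (w / 2) * (1 + d) \<le> pole_dist \<alpha> w t m" using 1 by linarith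
  then show ?thesis by (simp only: d_def)
qed

text \<open>The bound is uniform in \<open>t\<close>: reindexing by the floor of t/\<alpha> turns
  the majorant into one fixed series.\<close>

lemma summable_on_pole_dist_powr:
  assumes w: "w > 0" and \<alpha>: "\<alpha> > 0" and p: "p > 1"
  shows "(\<lambda>m. pole_dist \<alpha> w t m powr - p) summable_on UNIV"
    and "(\<Sum>\<^sub>\<infinity>m. pole_dist \<alpha> w t m powr - p)
      \<le> min (\<alpha> / 3) (w / 2) powr - p * (\<Sum>\<^sub>\<infinity>m::int. (1 + \<bar>of_int m\<bar>) powr - p)"
proof -
  define c where "c = min (\<alpha> / 3) (w / 2)"
  have c: "c > 0" using w \<alpha> by (simp add: c_def)
  define k where "k = \<lfloor>t / \<alpha>\<rfloor>"
  let ?f = "\<lambda>m::int. (1 + \<bar>of_int m\<bar> :: real) powr - p"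
  have bij: "bij (\<lambda>m::int. m - k)" by (rule bij_betw_byWitness[where f' = "\<lambda>m. m + k"]) auto
  have s: "(\<lambda>m. ?f (m - k)) summable_on UNIV"
    using summable_on_reindex_bij_betw[OF bij, of ?f] summable_on_int_powr[OF p] by simp
  have i: "(\<Sum>\<^sub>\<infinity>m. ?f (m - k)) = (\<Sum>\<^sub>\<infinity>m. ?f m)"
    using infsum_reindex_bij_betw[OF bij, of ?f] by simp
  have le: "pole_dist \<alpha> w t m powr - p \<le> c powr - p * ?f (m - k)" for m
  proof -
    have "pole_dist \<alpha> w t m powr - p \<le> (c * (1 + \<bar>of_int (m - k)\<bar>)) powr - p"
      using pole_dist_lower[OF w \<alpha>, of m t] c p unfolding c_def[symmetric] k_def[symmetric]
      by (intro powr_mono2') (auto intro!: mult_pos_pos)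
    then show ?thesis using c by (simp add: powr_mult)
  qed
  have s': "(\<lambda>m. c powr - p * ?f (m - k)) summable_on UNIV"
    by (rule summable_on_cmult_right[OF s])
  show 1: "(\<lambda>m. pole_dist \<alpha> w t m powr - p) summable_on UNIV"
    by (rule summable_on_comparison_test[OF s']) (use le in auto)
  have "(\<Sum>\<^sub>\<infinity>m. pole_dist \<alpha> w t m powr - p) \<le> (\<Sum>\<^sub>\<infinity>m. c powr - p * ?f (m - k))"
    by (rule infsum_mono[OF 1 s']) (use le in auto)
  also have "\<dots> = c powr - p * (\<Sum>\<^sub>\<infinity>m. ?f m)"
    by (simp only: infsum_cmult_right[OF s] i)
  finally show "(\<Sum>\<^sub>\<infinity>m. pole_dist \<alpha> w t m powr - p)
      \<le> min (\<alpha> / 3) (w / 2) powr - p * (\<Sum>\<^sub>\<infinity>m::int. (1 + \<bar>of_int m\<bar>) powr - p)"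
    by (simp add: c_def)
qed

text \<open>Splitting off three quarters of a power of the larger factor keeps the sum over \<open>m\<close> convergent
  and leaves a factor in \<open>L\<^sup>2\<close>.\<close>

lemma inverse_product_le:
  fixes X Y T :: real
  assumes X: "X > 0" and Y: "Y > 0" and T: "T > 0" and TXY: "T \<le> X + Y"
  shows "1 / (X * Y) \<le> 2 * T powr - (3/4) * (X powr - (5/4) + Y powr - (5/4))"
proof -
  \<comment> \<open>Since 2 B \<ge> T, three quarters of 1/B are bounded through \<open>T\<close>;
    the remaining quarter is bounded through A \<le> B and raises the exponent of \<open>A\<close>
    from 1 to 5/4.\<close>
  have key: "1 / (A * B) \<le> 2 * T powr - (3/4) * A powr - (5/4)"
    if A: "A > 0" and AB: "A \<le> B" and TB: "T \<le> 2 * B" for A B :: real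
  proof -
    have B: "B > 0" using A AB by linarith
    have "1 / (A * B) = A powr - 1 * B powr - 1"
      using A B by (simp add: powr_minus_divide)
    also have "B powr - 1 = B powr - (3/4) * B powr - (1/4)" by (simp flip: powr_add)
    also have "A powr - 1 * (B powr - (3/4) * B powr - (1/4)) \<le> A powr - 1 * ((T / 2) powr - (3/4) * A powr - (1/4))"
      using A B T AB TB by (intro mult_left_mono mult_mono powr_mono2') auto
    also have "\<dots> = (T / 2) powr - (3/4) * A powr - (5/4)"
    proof -
      have e: "A powr - (5/4) = A powr - 1 * A powr - (1/4)" by (simp only: powr_add[symmetric]) simp
      show ?thesis unfolding e by (simp only: mult_ac)
    qed
    also have "(T / 2) powr - (3/4) = 2 powr (3/4) * T powr - (3/4)"
      using T by (simp add: powr_divide powr_minus_divide)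
    also have "\<dots> * A powr - (5/4) \<le> (2 powr 1 * T powr - (3/4)) * A powr - (5/4)"
      by (intro mult_right_mono powr_mono) auto
    finally show ?thesis by simp
  qed
  show ?thesis
  proof (cases "X \<le> Y")
    case True
    then have "1 / (X * Y) \<le> 2 * T powr - (3/4) * X powr - (5/4)" using TXY by (intro key X) auto
    also have "\<dots> \<le> 2 * T powr - (3/4) * (X powr - (5/4) + Y powr - (5/4))" by (intro mult_left_mono) auto
    finally show ?thesis .
  next
    case False
    then have "1 / (Y * X) \<le> 2 * T powr - (3/4) * Y powr - (5/4)" using TXY by (intro key Y) auto
    also have "\<dots> \<le> 2 * T powr - (3/4) * (X powr - (5/4) + Y powr - (5/4))" by (intro mult_left_mono) auto
    finally show ?thesis by (simp add: mult.commute)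
  qed
qed

text \<open>The majorant behind both interchanges of limits below: one factor is the decay of the
  coefficients in \<open>m\<close>, the other the size of the translate at \<open>t\<close>. The
  exponent 3/8 is chosen so that the square of the bound is integrable over the line.\<close>

lemma pole_dist_product:
  assumes w: "w > 0" and \<alpha>: "\<alpha> > 0"
  obtains C where "C \<ge> 0" "\<And>t. (\<lambda>m. 1 / (pole_dist \<alpha> w 0 m * pole_dist \<alpha> w t m)) summable_on UNIV"
    "\<And>t. (\<Sum>\<^sub>\<infinity>m. 1 / (pole_dist \<alpha> w 0 m * pole_dist \<alpha> w t m)) \<le> C * (t\<^sup>2 + w\<^sup>2) powr - (3/8)"
proof -
  define D where "D = min (\<alpha> / 3) (w / 2) powr - (5/4) * (\<Sum>\<^sub>\<infinity>m::int. (1 + \<bar>of_int m\<bar>) powr - (5/4))"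
  have D: "D \<ge> 0" unfolding D_def by (intro mult_nonneg_nonneg infsum_nonneg) auto
  note s = summable_on_pole_dist_powr(1)[OF w \<alpha>, of "5/4"]
  note b = summable_on_pole_dist_powr(2)[OF w \<alpha>, of "5/4", folded D_def]
  let ?X = "pole_dist \<alpha> w 0" and ?Y = "pole_dist \<alpha> w"
  let ?T = "\<lambda>t. 2 * (t\<^sup>2 + w\<^sup>2) powr - (3/8)"
  let ?g = "\<lambda>t m. ?T t * (?X m powr - (5/4) + ?Y t m powr - (5/4))"
  have pos: "?Y t m > 0" for t m using pole_dist_ge[OF w, of \<alpha> t m] w by linarith
  have le: "1 / (?X m * ?Y t m) \<le> ?g t m" for t m
  proof -
    define T where "T = sqrt (t\<^sup>2 + w\<^sup>2)"
    have tw: "t\<^sup>2 + w\<^sup>2 > 0" using w by (simp add: sum_power2_gt_zero_iff)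
    then have T: "T > 0" by (simp add: T_def)
    have "T \<le> sqrt (t\<^sup>2 + (2 * w)\<^sup>2)"
      unfolding T_def using w by (intro real_sqrt_le_mono add_left_mono power_mono) auto
    \<comment> \<open>Conjugating one factor adds the imaginary parts instead of cancelling them, so
      the sum of the two distances stays away from 0 even for t = 0.\<close>
    also have "\<dots> = cmod (of_real (0 - of_int m * \<alpha>) - \<i> * of_real w - cnj (of_real (t - of_int m * \<alpha>) - \<i> * of_real w))"
      by (simp add: cmod_def)
    also have "\<dots> \<le> ?X m + ?Y t m"
      unfolding pole_dist_def using norm_triangle_ineq4 by (metis complex_mod_cnj)
    finally have "1 / (?X m * ?Y t m) \<le> 2 * T powr - (3/4) * (?X m powr - (5/4) + ?Y t m powr - (5/4))"
      by (intro inverse_product_le pos T)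
    also have "T powr - (3/4) = (t\<^sup>2 + w\<^sup>2) powr - (3/8)"
      using tw by (simp add: T_def powr_powr flip: powr_half_sqrt)
    finally show ?thesis .
  qed
  have sg: "?g t summable_on UNIV" for t
    by (intro summable_on_cmult_right summable_on_add s) auto
  have sX: "(\<lambda>m. 1 / (?X m * ?Y t m)) summable_on UNIV" for t
    by (rule summable_on_comparison_test[OF sg[of t]]) (use le pos in \<open>auto intro: less_imp_le\<close>)
  show ?thesis
  proof (rule that[of "4 * D"])
    fix t
    have "(\<Sum>\<^sub>\<infinity>m. 1 / (?X m * ?Y t m)) \<le> (\<Sum>\<^sub>\<infinity>m. ?g t m)"
      by (rule infsum_mono[OF sX sg]) (use le in auto)
    also have "\<dots> = ?T t * ((\<Sum>\<^sub>\<infinity>m. ?X m powr - (5/4)) + (\<Sum>\<^sub>\<infinity>m. ?Y t m powr - (5/4)))"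
      by (subst infsum_cmult_right) (auto intro!: summable_on_add s simp: infsum_add[OF s s])
    also have "\<dots> \<le> ?T t * (D + D)"
      by (intro mult_left_mono add_mono b) auto
    finally show "(\<Sum>\<^sub>\<infinity>m. 1 / (?X m * ?Y t m)) \<le> 4 * D * (t\<^sup>2 + w\<^sup>2) powr - (3/8)"
      by (simp add: mult_ac)
  qed (use D sX in auto)
qed

section \<open>The interpolation series over the poles\<close>

text \<open>For nonzero \<open>m\<close> the primitive is at most 2/(|m| \<alpha>), while the
  distance at t = 0 is at most |m| (\<alpha> + w); for m = 0 the primitive is bounded by the period
  and the distance is w. The constant is the sum of the two that arise.\<close>

lemma cmod_cis_primitive_le_pole_dist:
  assumes w: "w > 0" and \<alpha>: "\<alpha> > 0" and x: "0 \<le> x" "x \<le> 2 * pi / \<alpha>"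
  shows "cmod (cis_primitive (- (of_int m * \<alpha>)) x)
    \<le> (2 * (\<alpha> + w) / \<alpha> + 2 * pi / \<alpha> * w) / pole_dist \<alpha> w 0 m"
proof (cases "m = 0")
  case True
  have "cmod (cis_primitive (- (of_int m * \<alpha>)) x) = x" using True x by (simp add: cis_primitive_def)
  also have "\<dots> \<le> (2 * pi / \<alpha> * w) / w" using x w by simp
  also have "\<dots> \<le> (2 * (\<alpha> + w) / \<alpha> + 2 * pi / \<alpha> * w) / w"
    using w \<alpha> by (intro divide_right_mono) auto
  finally show ?thesis using True w by (simp add: pole_dist_def norm_mult)
next
  case False
  define M where "M = \<bar>of_int m :: real\<bar>"
  have M: "M \<ge> 1" using False unfolding M_def by linarith
  have X: "pole_dist \<alpha> w 0 m > 0" using pole_dist_ge[OF w, of \<alpha> 0 m] w by linarith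
  have "pole_dist \<alpha> w 0 m \<le> M * \<alpha> + w"
    unfolding pole_dist_def using \<alpha> w
    by (intro order_trans[OF norm_triangle_ineq4]) (simp add: norm_mult M_def)
  also have "\<dots> \<le> M * (\<alpha> + w)" using M w by (simp add: algebra_simps)
  finally have X_le: "pole_dist \<alpha> w 0 m \<le> M * (\<alpha> + w)" .
  have "cmod (cis_primitive (- (of_int m * \<alpha>)) x) = cmod (cis (- (of_int m * \<alpha>) * x) - 1) / (M * \<alpha>)"
    using False \<alpha> by (simp add: cis_primitive_def norm_divide norm_mult M_def)
  also have "\<dots> \<le> 2 / (M * \<alpha>)"
    using M \<alpha> norm_triangle_ineq4[of "cis (- (of_int m * \<alpha>) * x)" 1] by (intro divide_right_mono) auto
  also have "\<dots> \<le> (2 * (\<alpha> + w) / \<alpha>) / pole_dist \<alpha> w 0 m"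
    using X_le X M \<alpha> by (simp add: field_simps)
  also have "\<dots> \<le> (2 * (\<alpha> + w) / \<alpha> + 2 * pi / \<alpha> * w) / pole_dist \<alpha> w 0 m"
    using X w \<alpha> by (intro divide_right_mono) auto
  finally show ?thesis .
qed

text \<open>Integration by parts; over a full period of the character only the primitive at
  \<Lambda> is left of the boundary terms.\<close>

lemma has_integral_cis_primitive_mult_cis:
  assumes q: "q \<noteq> 0" and \<Lambda>: "\<Lambda> \<ge> 0" "cis (q * \<Lambda>) = 1"
  shows "((\<lambda>x. cis_primitive p x * cis (q * x)) has_integral
    (cis_primitive p \<Lambda> - cis_primitive (p + q) \<Lambda>) / (\<i> * of_real q)) {0..\<Lambda>}"
proof -
  let ?F = "\<lambda>x. (cis_primitive p x * cis (q * x)) * (1 / (\<i> * of_real q)) - cis_primitive (p + q) x * (1 / (\<i> * of_real q))"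
  have "((\<lambda>x. cis_primitive p x * cis (q * x)) has_integral ?F \<Lambda> - ?F 0) {0..\<Lambda>}"
  proof (rule fundamental_theorem_of_calculus)
    fix x
    have c: "((\<lambda>x. cis (q * x)) has_vector_derivative (\<i> * of_real q) * cis (q * x)) (at x within {0..\<Lambda>})"
      using has_vector_derivative_exp_of_real[of "\<i> * of_real q" x "{0..\<Lambda>}"] by (simp add: cis_conv_exp mult.assoc)
    have "(?F has_vector_derivative
      (cis_primitive p x * ((\<i> * of_real q) * cis (q * x)) + cis (p * x) * cis (q * x)) * (1 / (\<i> * of_real q))
       - cis ((p + q) * x) * (1 / (\<i> * of_real q))) (at x within {0..\<Lambda>})"
      by (intro has_vector_derivative_diff has_vector_derivative_mult_left has_vector_derivative_mult
          has_vector_derivative_cis_primitive c)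
    then show "(?F has_vector_derivative cis_primitive p x * cis (q * x)) (at x within {0..\<Lambda>})"
      using q by (simp add: cis_mult ring_distribs field_simps)
  qed fact
  then show ?thesis using \<Lambda> by (simp add: diff_divide_distrib)
qed

lemma cis_primitive_period:
  assumes "\<alpha> > 0"
  shows "cis_primitive (- (of_int m * \<alpha>)) (2 * pi / \<alpha>) = (if m = 0 then of_real (2 * pi / \<alpha>) else 0)"
proof -
  have "cis (2 * pi * of_int (- m)) = 1" by (rule cis_multiple_2pi) auto
  moreover have "- (of_int m * \<alpha>) * (2 * pi / \<alpha>) = 2 * pi * of_int (- m)"
    using assms by simp
  ultimately show ?thesis using assms by (simp only: cis_primitive_def) auto
qed

text \<open>The exponential has modulus exp(-w \<Lambda>) < 1 for every real \<open>t\<close>, so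
  the denominator stays away from 0 uniformly.\<close>

lemma one_minus_exp_nonzero:
  assumes "w > 0" "\<Lambda> > 0"
  shows "cmod (1 - exp (- \<i> * (of_real t - \<i> * of_real w) * of_real \<Lambda>)) \<ge> 1 - exp (- (w * \<Lambda>))"
    and "1 - exp (- \<i> * (of_real t - \<i> * of_real w) * of_real \<Lambda>) \<noteq> 0"
proof -
  have "cmod (exp (- \<i> * (of_real t - \<i> * of_real w) * of_real \<Lambda>)) = exp (- (w * \<Lambda>))"
    by simp
  then show 1: "cmod (1 - exp (- \<i> * (of_real t - \<i> * of_real w) * of_real \<Lambda>)) \<ge> 1 - exp (- (w * \<Lambda>))"
    using norm_triangle_ineq2[of 1 "exp (- \<i> * (of_real t - \<i> * of_real w) * of_real \<Lambda>)"] by simp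
  have "exp (- (w * \<Lambda>)) < 1" using assms by simp
  with 1 show "1 - exp (- \<i> * (of_real t - \<i> * of_real w) * of_real \<Lambda>) \<noteq> 0" by force
qed

text \<open>The derivative of the right-hand side in x is i \<Lambda> exp(-i \<zeta> x) / (1 -
  exp(-i \<zeta> \<Lambda>)), whose Fourier coefficients at the frequencies -m \<alpha> on
  [0, \<Lambda>] are 1/(\<zeta> - m \<alpha>). The series here is that Fourier series integrated in
  x, which makes it absolutely convergent. The proof compares the nonzero Fourier coefficients of
  the two sides, both continuous in x, and settles the constant at x = 0, where both vanish.\<close>

lemma has_sum_cis_primitive_over_poles:
  fixes \<alpha> w t x :: real
  assumes w: "w > 0" and \<alpha>: "\<alpha> > 0" and x: "x \<in> {0..2 * pi / \<alpha>}"
  defines "\<Lambda> \<equiv> 2 * pi / \<alpha>" and "\<zeta> \<equiv> of_real t - \<i> * of_real w"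
  shows "((\<lambda>m. cis_primitive (- (of_int m * \<alpha>)) x / (of_real (t - of_int m * \<alpha>) - \<i> * of_real w)) has_sum
     of_real \<Lambda> * (1 - exp (- \<i> * \<zeta> * of_real x)) / (\<zeta> * (1 - exp (- \<i> * \<zeta> * of_real \<Lambda>)))) UNIV"
proof -
  have \<Lambda>: "\<Lambda> > 0" using \<alpha> by (simp add: \<Lambda>_def)
  define pole where "pole m = of_real (t - of_int m * \<alpha>) - \<i> * of_real w" for m :: int
  have pole0: "pole m \<noteq> 0" for m unfolding pole_def using w cauchy_kernel_nonzero_denom(2)[of w] by blast
  have pole_eq: "pole m = \<zeta> - of_int m * of_real \<alpha>" for m by (simp add: pole_def \<zeta>_def)
  have \<zeta>0: "\<zeta> \<noteq> 0" using pole0[of 0] by (simp add: pole_eq)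
  define E where "E = 1 - exp (- \<i> * \<zeta> * of_real \<Lambda>)"
  have E0: "E \<noteq> 0" unfolding E_def \<zeta>_def using one_minus_exp_nonzero(2)[OF w \<Lambda>] by simp
  define f where "f m x = cis_primitive (- (of_int m * \<alpha>)) x / pole m" for m x
  define C where "C = 2 * (\<alpha> + w) / \<alpha> + \<Lambda> * w"
  define M where "M m = C * (1 / (pole_dist \<alpha> w 0 m * pole_dist \<alpha> w t m))" for m
  have "(\<lambda>m. 1 / (pole_dist \<alpha> w 0 m * pole_dist \<alpha> w t m)) summable_on UNIV"
    by (rule pole_dist_product[OF w \<alpha>])
  then have M_sum: "M summable_on UNIV"
    unfolding M_def by (intro summable_on_cmult_right)
  have f_le: "cmod (f m x) \<le> M m" if "x \<in> {0..\<Lambda>}" for m x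
  proof -
    have "cmod (f m x) = cmod (cis_primitive (- (of_int m * \<alpha>)) x) / pole_dist \<alpha> w t m"
      by (simp add: f_def norm_divide pole_dist_def pole_def)
    also have "\<dots> \<le> (C / pole_dist \<alpha> w 0 m) / pole_dist \<alpha> w t m"
      using cmod_cis_primitive_le_pole_dist[OF w \<alpha>, of x m] that pole_dist_ge[OF w, of \<alpha> t m] w
      by (intro divide_right_mono) (auto simp: C_def \<Lambda>_def)
    finally show ?thesis by (simp add: M_def)
  qed
  have f_sum: "(\<lambda>m. f m x) summable_on UNIV" if "x \<in> {0..\<Lambda>}" for x
    by (rule Infinite_Sum.abs_summable_summable, rule summable_on_comparison_test[OF M_sum]) (use f_le[OF that] in auto)
  define S where "S x = (\<Sum>\<^sub>\<infinity>m. f m x)" for x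
  define T where "T x = of_real \<Lambda> / (\<zeta> * E) * (1 - exp (- \<i> * \<zeta> * of_real x))" for x :: real
  have f_cont: "continuous_on A (f m)" for A m
    unfolding f_def by (intro continuous_intros pole0 ballI)
  have "uniform_limit {0..\<Lambda>} (\<lambda>J x. \<Sum>m\<in>J. f m x) S (finite_subsets_at_top UNIV)"
    unfolding S_def by (rule Weierstrass_m_test_general[OF _ M_sum]) (use f_le in auto)
  then have S_cont: "continuous_on {0..\<Lambda>} S"
    by (rule uniform_limit_theorem[rotated]) (auto intro!: always_eventually continuous_on_sum f_cont)
  have T_cont: "continuous_on A T" for A unfolding T_def by (intro continuous_intros)
  have "S x - T x = S 0 - T 0"
  proof (rule continuous_const_if_fourier_coeffs_eq_0[OF \<Lambda>, where K = "\<lambda>x. S x - T x"])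
    show "continuous_on {0..\<Lambda>} (\<lambda>x. S x - T x)" by (intro continuous_intros S_cont T_cont)
    fix l :: int assume l: "l \<noteq> 0"
    define q where "q = of_int l * \<alpha>"
    have q0: "q \<noteq> 0" using l \<alpha> by (simp add: q_def)
    have q_eq: "2 * pi * of_int l * x / \<Lambda> = q * x" for x
      using \<alpha> by (simp add: q_def \<Lambda>_def)
    have q1: "cis (q * \<Lambda>) = 1"
      using cis_multiple_2pi[of "of_int l"] \<Lambda> unfolding q_eq[symmetric] by simp
    \<comment> \<open>At the end of the period the primitive with index \<open>m\<close> is 0 unless
      m = 0, and the one shifted by \<open>q\<close> is 0 unless m = l, so only these two terms have
      a nonzero coefficient.\<close>
    define a where "a m = of_real \<Lambda> / (\<i> * of_real q) * ((if m = 0 then 1 / pole m else 0) - (if m = l then 1 / pole m else 0))" for m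
    have fI: "((\<lambda>x. f m x * cis (q * x)) has_integral a m) {0..\<Lambda>}" for m
    proof -
      have "((\<lambda>x. cis_primitive (- (of_int m * \<alpha>)) x * cis (q * x) * (1 / pole m)) has_integral
        (cis_primitive (- (of_int m * \<alpha>)) \<Lambda> - cis_primitive (- (of_int m * \<alpha>) + q) \<Lambda>) / (\<i> * of_real q) * (1 / pole m)) {0..\<Lambda>}"
        using \<Lambda> q1 by (intro has_integral_mult_left has_integral_cis_primitive_mult_cis[OF q0]) auto
      moreover have "cis_primitive (- (of_int m * \<alpha>)) \<Lambda> = (if m = 0 then of_real \<Lambda> else 0)"
        using cis_primitive_period[OF \<alpha>, of m] by (simp add: \<Lambda>_def)
      moreover have "- (of_int m * \<alpha>) + q = - (of_int (m - l) * \<alpha>)" by (simp add: q_def algebra_simps)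
      moreover have "cis_primitive (- (of_int (m - l) * \<alpha>)) \<Lambda> = (if m = l then of_real \<Lambda> else 0)"
        using cis_primitive_period[OF \<alpha>, of "m - l"] by (simp add: \<Lambda>_def)
      ultimately have "((\<lambda>x. cis_primitive (- (of_int m * \<alpha>)) x * cis (q * x) * (1 / pole m)) has_integral
        ((if m = 0 then of_real \<Lambda> else 0) - (if m = l then of_real \<Lambda> else 0)) / (\<i> * of_real q) * (1 / pole m)) {0..\<Lambda>}"
        by (simp only:)
      moreover have "((if m = 0 then of_real \<Lambda> else 0) - (if m = l then of_real \<Lambda> else 0)) / (\<i> * of_real q) * (1 / pole m) = a m"
        using l by (simp add: a_def)
      ultimately show ?thesis by (simp add: f_def)
    qed
    have u: "uniform_limit {0..\<Lambda>} (\<lambda>J x. \<Sum>m\<in>J. f m x * cis (q * x)) (\<lambda>x. \<Sum>\<^sub>\<infinity>m. f m x * cis (q * x)) (finite_subsets_at_top UNIV)"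
      by (rule Weierstrass_m_test_general[OF _ M_sum]) (use f_le in \<open>auto simp: norm_mult\<close>)
    obtain I J where I: "\<And>X. ((\<lambda>x. \<Sum>m\<in>X. f m x * cis (q * x)) has_integral I X) {0..\<Lambda>}"
      and J: "((\<lambda>x. \<Sum>\<^sub>\<infinity>m. f m x * cis (q * x)) has_integral J) {0..\<Lambda>}"
      and IJ: "(I \<longlongrightarrow> J) (finite_subsets_at_top UNIV)"
      by (rule uniform_limit_integral[OF u]) (auto intro!: continuous_intros f_cont)
    define v where "v = of_real \<Lambda> / (\<i> * of_real q) * (1 / pole 0 - 1 / pole l)"
    \<comment> \<open>The coefficient of a partial sum no longer changes once the index set contains
      0 and \<open>l\<close>.\<close>
    have "\<forall>\<^sub>F X in finite_subsets_at_top UNIV. I X = v"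
      unfolding eventually_finite_subsets_at_top
    proof (intro exI[of _ "{0, l}"] conjI allI impI)
      fix X :: "int set" assume X: "finite X \<and> {0, l} \<subseteq> X \<and> X \<subseteq> UNIV"
      then have "((\<lambda>x. \<Sum>m\<in>X. f m x * cis (q * x)) has_integral (\<Sum>m\<in>X. a m)) {0..\<Lambda>}"
        by (intro has_integral_sum fI) auto
      then have "I X = (\<Sum>m\<in>X. a m)" using I has_integral_unique by blast
      also have "\<dots> = v"
        unfolding a_def sum_distrib_left[symmetric] sum_subtractf using X by (simp add: v_def)
      finally show "I X = v" .
    qed auto
    then have "J = v"
      using IJ tendsto_eventually tendsto_unique[OF finite_subsets_at_top_neq_bot] by blast
    have SI: "((\<lambda>x. S x * cis (q * x)) has_integral v) {0..\<Lambda>}"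
      using J \<open>J = v\<close> by (simp add: has_integral_eq[OF _ J] infsum_cmult_left' S_def)
    have TI: "((\<lambda>x. T x * cis (q * x)) has_integral v) {0..\<Lambda>}"
    proof -
      have c1: "((\<lambda>x. cis (q * x)) has_integral 0) {0..\<Lambda>}"
        using has_integral_exp_of_real[of "\<i> * of_real q" 0 \<Lambda>] q0 q1 \<Lambda>
        by (simp add: cis_conv_exp mult.assoc)
      have nz: "- \<i> * pole l \<noteq> 0" using pole0 by simp
      \<comment> \<open>The character shifts \<zeta> to the pole factor of index \<open>l\<close>;
        the boundary values are unchanged because \<open>cis (q * \<Lambda>)\<close> is 1.\<close>
      have "exp (- \<i> * pole l * of_real x) = exp (- \<i> * \<zeta> * of_real x) * cis (q * x)" for x
        by (simp add: pole_eq cis_conv_exp q_def algebra_simps flip: exp_add)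
      with has_integral_exp_of_real[OF nz, of 0 \<Lambda>] \<Lambda> q1
      have c2: "((\<lambda>x. exp (- \<i> * \<zeta> * of_real x) * cis (q * x)) has_integral (- E / (- \<i> * pole l))) {0..\<Lambda>}"
        by (simp add: E_def)
      have "((\<lambda>x. of_real \<Lambda> / (\<zeta> * E) * (cis (q * x) - exp (- \<i> * \<zeta> * of_real x) * cis (q * x))) has_integral
         of_real \<Lambda> / (\<zeta> * E) * (0 - (- E / (- \<i> * pole l)))) {0..\<Lambda>}"
        by (intro has_integral_mult_right has_integral_diff c1 c2)
      moreover have "of_real \<Lambda> / (\<zeta> * E) * (0 - (- E / (- \<i> * pole l))) = v"
      proof -
        have "1 / pole 0 - 1 / pole l = (pole l - pole 0) / (pole 0 * pole l)"
          using pole0[of 0] pole0[of l] by (simp add: field_simps)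
        also have "pole l - pole 0 = - of_real q" by (simp add: pole_eq q_def)
        finally have e: "1 / pole 0 - 1 / pole l = - of_real q / (pole 0 * pole l)" .
        have p0: "pole 0 = \<zeta>" by (simp add: pole_eq)
        show ?thesis unfolding v_def e unfolding p0 using E0 q0 \<zeta>0 pole0[of l] by (simp add: field_simps)
      qed
      ultimately show ?thesis by (simp add: T_def algebra_simps)
    qed
    show "integral {0..\<Lambda>} (\<lambda>x. (S x - T x) * cis (2 * pi * of_int l * x / \<Lambda>)) = 0"
      unfolding q_eq using has_integral_diff[OF SI TI] by (intro integral_unique) (simp add: left_diff_distrib)
  qed (use x in \<open>simp add: \<Lambda>_def\<close>)
  also have "S 0 - T 0 = 0" by (simp add: S_def f_def T_def)
  finally have "S x = T x" by simp
  then have "((\<lambda>m. f m x) has_sum T x) UNIV"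
    using has_sum_infsum[OF f_sum, of x] x by (simp add: S_def \<Lambda>_def)
  then show ?thesis
    by (simp add: f_def T_def E_def pole_def)
qed

section \<open>The frame operator on frequency bands\<close>

text \<open>The quotient (exp(i a z) - exp(i b z))/z is a constant times the integral of exp(i s z)
  over s in [a, b], so its spectrum is a band. The other factor subtracts the copy shifted by
  \<Lambda>, which makes all but finitely many modulations orthogonal to it.\<close>

definition band_function :: "real \<Rightarrow> real \<Rightarrow> real \<Rightarrow> real \<Rightarrow> real \<Rightarrow> complex" where
  "band_function \<Lambda> w a b t =
    (1 - exp (\<i> * of_real \<Lambda> * (of_real t + \<i> * of_real w))) *
    (exp (\<i> * of_real a * (of_real t + \<i> * of_real w)) - exp (\<i> * of_real b * (of_real t + \<i> * of_real w))) /
    (of_real t + \<i> * of_real w)"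

lemma band_function_L2:
  assumes w: "w > 0"
  shows "band_function \<Lambda> w a b \<in> L2"
proof -
  have E: "cmod (exp (\<i> * of_real \<sigma> * (of_real t + \<i> * of_real w))) = exp (- (\<sigma> * w))" for \<sigma> t :: real
    by simp
  have "(\<lambda>t. 1 / (of_real (t - 0) + \<i> * of_real w)) \<in> L2" by (rule cauchy_kernel_L2[OF w])
  then have "(\<lambda>t. 1 / (of_real t + \<i> * of_real w)) \<in> L2" by simp
  then show ?thesis
  proof (rule L2_bound[where C = "(1 + exp (- (\<Lambda> * w))) * (exp (- (a * w)) + exp (- (b * w)))"])
    show "band_function \<Lambda> w a b \<in> borel_measurable borel"
      unfolding band_function_def[abs_def] by measurable
    fix t
    let ?z = "complex_of_real t + \<i> * of_real w"
    have "cmod (1 - exp (\<i> * of_real \<Lambda> * ?z)) \<le> 1 + exp (- (\<Lambda> * w))"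
      using norm_triangle_ineq4[of 1 "exp (\<i> * of_real \<Lambda> * ?z)"] unfolding E by simp
    moreover have "cmod (exp (\<i> * of_real a * ?z) - exp (\<i> * of_real b * ?z)) \<le> exp (- (a * w)) + exp (- (b * w))"
      using norm_triangle_ineq4[of "exp (\<i> * of_real a * ?z)" "exp (\<i> * of_real b * ?z)"] unfolding E by simp
    ultimately have "cmod (1 - exp (\<i> * of_real \<Lambda> * ?z)) * cmod (exp (\<i> * of_real a * ?z) - exp (\<i> * of_real b * ?z))
        \<le> (1 + exp (- (\<Lambda> * w))) * (exp (- (a * w)) + exp (- (b * w)))"
      by (intro mult_mono) (auto intro: add_nonneg_nonneg)
    then show "cmod (band_function \<Lambda> w a b t) \<le> (1 + exp (- (\<Lambda> * w))) * (exp (- (a * w)) + exp (- (b * w))) * cmod (1 / ?z)"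
      unfolding band_function_def norm_divide norm_mult by (simp add: divide_right_mono)
  qed
qed

text \<open>Expanding the product gives four exponentials over the two poles. Modulation shifts all
  four exponents alike; since it acts in t and the exponents are in t + i w, it costs the factor
  exp(-2 pi \<beta> k w).\<close>

lemma L2_inner_band_function:
  fixes \<alpha> \<beta> \<Lambda> w a b :: real
  assumes w: "w > 0"
  defines "P \<equiv> \<lambda>m x. cis_primitive (- (of_int m * \<alpha>)) (max 0 x)"
  shows "L2_inner (band_function \<Lambda> w a b) (gabor_system \<alpha> \<beta> (cauchy_kernel w) (m, k))
    = - of_real (2 * pi * exp (- (2 * pi * \<beta> * of_int k * w))) *
      (P m (2 * pi * \<beta> * of_int k - a) - P m (2 * pi * \<beta> * of_int k - b)
       - P m (2 * pi * \<beta> * of_int k - a - \<Lambda>) + P m (2 * pi * \<beta> * of_int k - b - \<Lambda>))"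
proof -
  define \<kappa> where "\<kappa> = 2 * pi * \<beta> * of_int k"
  define y where "y = of_int m * \<alpha>"
  define F where "F \<sigma> t = exp (\<i> * of_real \<sigma> * (of_real t + \<i> * of_real w)) /
      ((of_real t + \<i> * of_real w) * (of_real (t - y) + \<i> * of_real w))" for \<sigma> t :: real
  have iF: "integrable lborel (F \<sigma>)" for \<sigma>
    unfolding F_def by (rule integrable_exp_cauchy_pair[OF w])
  have LF: "(LINT t|lborel. F \<sigma> t) = - 2 * pi * P m (- \<sigma>)" for \<sigma>
    unfolding F_def P_def using LINT_exp_cauchy_pair[OF w, of \<sigma> y] by (simp add: y_def)
  have eq: "band_function \<Lambda> w a b t * cis (- \<kappa> * t) / (of_real (t - y) + \<i> * of_real w)
      = of_real (exp (- (\<kappa> * w))) * (F (a - \<kappa>) t - F (b - \<kappa>) t - F (a - \<kappa> + \<Lambda>) t + F (b - \<kappa> + \<Lambda>) t)" for t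
  proof -
    define z where "z = complex_of_real t + \<i> * of_real w"
    define E where "E \<sigma> = exp (\<i> * complex_of_real \<sigma> * z)" for \<sigma>
    have cis_eq: "cis (- \<kappa> * t) = of_real (exp (- (\<kappa> * w))) * E (- \<kappa>)"
      by (simp add: E_def z_def cis_conv_exp exp_of_real[symmetric] algebra_simps flip: exp_add)
    have mult: "E \<sigma> * E \<tau> = E (\<sigma> + \<tau>)" for \<sigma> \<tau>
      by (simp add: E_def algebra_simps flip: exp_add)
    have N: "(1 - E \<Lambda>) * (E a - E b) * E (- \<kappa>) = E (a - \<kappa>) - E (b - \<kappa>) - E (a - \<kappa> + \<Lambda>) + E (b - \<kappa> + \<Lambda>)"
      by (simp add: ring_distribs mult) (simp add: mult mult.assoc add_ac add_diff_eq)
    have "(1 - E \<Lambda>) * (E a - E b) / z * (c * E (- \<kappa>)) / p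
        = c * (E (a - \<kappa>) / (z * p) - E (b - \<kappa>) / (z * p) - E (a - \<kappa> + \<Lambda>) / (z * p) + E (b - \<kappa> + \<Lambda>) / (z * p))" for c p
      unfolding diff_divide_distrib[symmetric] add_divide_distrib[symmetric] N[symmetric] by simp
    then show ?thesis
      unfolding band_function_def F_def cis_eq z_def[symmetric] E_def[symmetric] .
  qed
  have "L2_inner (band_function \<Lambda> w a b) (gabor_system \<alpha> \<beta> (cauchy_kernel w) (m, k))
    = of_real (exp (- (\<kappa> * w))) * (- 2 * pi * P m (\<kappa> - a) - (- 2 * pi * P m (\<kappa> - b))
       - (- 2 * pi * P m (\<kappa> - a - \<Lambda>)) + (- 2 * pi * P m (\<kappa> - b - \<Lambda>)))"
    unfolding L2_inner_gabor_cauchy_kernel \<kappa>_def[symmetric] y_def[symmetric] eq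
    using LF[of "a - \<kappa>"] LF[of "b - \<kappa>"] LF[of "a - \<kappa> + \<Lambda>"] LF[of "b - \<kappa> + \<Lambda>"] iF
    by (simp add: diff_diff_add)
  then show ?thesis unfolding \<kappa>_def by (simp add: algebra_simps)
qed

text \<open>The shift changes the phase by a multiple of 2 pi; for m = 0 the primitive is the
  identity and loses one period.\<close>

lemma cis_primitive_shift_period:
  assumes "\<alpha> > 0"
  shows "cis_primitive (- (of_int m * \<alpha>)) (x - 2 * pi / \<alpha>) + (if m = 0 then of_real (2 * pi / \<alpha>) else 0)
    = cis_primitive (- (of_int m * \<alpha>)) x"
proof -
  have "cis (2 * pi * of_int m) = 1" by (rule cis_multiple_2pi) auto
  moreover have "- (of_int m * \<alpha>) * (x - 2 * pi / \<alpha>) = - (of_int m * \<alpha>) * x + 2 * pi * of_int m"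
    using assms by (simp add: algebra_simps)
  ultimately have eq: "cis (- (of_int m * \<alpha>) * (x - 2 * pi / \<alpha>)) = cis (- (of_int m * \<alpha>) * x)"
    by (simp only: cis_mult[symmetric] mult_1_right)
  show ?thesis unfolding cis_primitive_def eq using assms by auto
qed

text \<open>Compares the band [a, b] with the window [\<kappa> - \<Lambda>, \<kappa>] of the
  modulation. Inside the window only the two unshifted terms survive the cutoff
  \<open>max 0\<close>. To the right of it all four are cut off; to the left none is, and they
  cancel because a shift by one period changes both primitives by the same constant.\<close>

lemma L2_inner_band_function_cases:
  fixes \<alpha> \<beta> w a b :: real and m k :: int
  assumes w: "w > 0" and \<alpha>: "\<alpha> > 0" and ab: "a \<le> b"
  defines "\<Lambda> \<equiv> 2 * pi / \<alpha>" and "\<kappa> \<equiv> 2 * pi * \<beta> * of_int k"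
  shows "\<kappa> - \<Lambda> \<le> a \<Longrightarrow> b \<le> \<kappa> \<Longrightarrow>
      L2_inner (band_function \<Lambda> w a b) (gabor_system \<alpha> \<beta> (cauchy_kernel w) (m, k))
        = of_real (2 * pi * exp (- (\<kappa> * w))) *
          (cis_primitive (- (of_int m * \<alpha>)) (\<kappa> - b) - cis_primitive (- (of_int m * \<alpha>)) (\<kappa> - a))"
    and "\<kappa> \<le> a \<or> b \<le> \<kappa> - \<Lambda> \<Longrightarrow>
      L2_inner (band_function \<Lambda> w a b) (gabor_system \<alpha> \<beta> (cauchy_kernel w) (m, k)) = 0"
proof -
  note inner = L2_inner_band_function[OF w, of \<Lambda> a b \<alpha> \<beta> m k, folded \<kappa>_def]
  show "L2_inner (band_function \<Lambda> w a b) (gabor_system \<alpha> \<beta> (cauchy_kernel w) (m, k))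
        = of_real (2 * pi * exp (- (\<kappa> * w))) *
          (cis_primitive (- (of_int m * \<alpha>)) (\<kappa> - b) - cis_primitive (- (of_int m * \<alpha>)) (\<kappa> - a))"
    if "\<kappa> - \<Lambda> \<le> a" "b \<le> \<kappa>"
  proof -
    have m: "max 0 (\<kappa> - a) = \<kappa> - a" "max 0 (\<kappa> - b) = \<kappa> - b"
        "max 0 (\<kappa> - a - \<Lambda>) = 0" "max 0 (\<kappa> - b - \<Lambda>) = 0"
      using that ab by auto
    show ?thesis unfolding inner m by (simp add: algebra_simps)
  qed
  have \<Lambda>: "\<Lambda> > 0" using \<alpha> by (simp add: \<Lambda>_def)
  show "L2_inner (band_function \<Lambda> w a b) (gabor_system \<alpha> \<beta> (cauchy_kernel w) (m, k)) = 0"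
    if "\<kappa> \<le> a \<or> b \<le> \<kappa> - \<Lambda>"
    using that
  proof
    assume "\<kappa> \<le> a"
    then have "max 0 (\<kappa> - a) = 0" "max 0 (\<kappa> - b) = 0" "max 0 (\<kappa> - a - \<Lambda>) = 0" "max 0 (\<kappa> - b - \<Lambda>) = 0"
      using ab \<Lambda> by auto
    then show ?thesis unfolding inner by simp
  next
    assume "b \<le> \<kappa> - \<Lambda>"
    then have m: "max 0 (\<kappa> - a) = \<kappa> - a" "max 0 (\<kappa> - b) = \<kappa> - b"
        "max 0 (\<kappa> - a - \<Lambda>) = \<kappa> - a - \<Lambda>" "max 0 (\<kappa> - b - \<Lambda>) = \<kappa> - b - \<Lambda>"
      using ab \<Lambda> by auto
    note s = cis_primitive_shift_period[OF \<alpha>, of m, folded \<Lambda>_def, symmetric]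
    show ?thesis unfolding inner m s[of "\<kappa> - a"] s[of "\<kappa> - b"] by simp
  qed
qed

section \<open>Summing the frame series in the L2 norm\<close>

text \<open>Dominated convergence handles sequences, whereas the frame operator is a limit over the
  net of finite index sets. An enumeration of the countable index set yields one finite set whose
  tail \<open>B\<close> is small in L2; tails only shrink when the set grows, so every larger finite
  set is covered.\<close>

lemma frame_operator_maps_dominated:
  fixes G :: "'i::countable \<Rightarrow> real \<Rightarrow> complex"
  assumes G: "\<And>j. G j \<in> L2" and f: "f \<in> L2" and h: "h \<in> L2"
    and sum: "\<And>t. ((\<lambda>j. L2_inner f (G j) * G j t) has_sum h t) UNIV"
    and abs: "\<And>t. (\<lambda>j. cmod (L2_inner f (G j) * G j t)) summable_on UNIV"
    and D: "integrable lborel D"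
    and dom: "\<And>t. (\<Sum>\<^sub>\<infinity>j. cmod (L2_inner f (G j) * G j t))\<^sup>2 \<le> D t"
  shows "frame_operator_maps G f h"
proof -
  define u where "u j t = L2_inner f (G j) * G j t" for j t
  define A where "A t = (\<Sum>\<^sub>\<infinity>j. cmod (u j t))" for t
  \<comment> \<open>Defined by subtraction and not as a sum over the complement, so that its
    measurability follows from that of \<open>A\<close>.\<close>
  define B where "B J t = A t - (\<Sum>j\<in>J. cmod (u j t))" for J t
  define Jn where "Jn n = {j :: 'i. to_nat j < n}" for n
  have fin: "finite (Jn n)" for n
    unfolding Jn_def by (rule finite_imageD[of to_nat]) (auto intro: finite_subset[of _ "{..<n}"] simp: inj_on_def)
  have u_L2: "u j \<in> L2" for j unfolding u_def by (rule L2_cmult[OF G])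
  have [measurable]: "u j \<in> borel_measurable borel" for j using u_L2 by (rule L2_measurable)
  have [measurable]: "h \<in> borel_measurable borel" using h by (rule L2_measurable)
  note abs' = abs[folded u_def] and sum' = sum[folded u_def]
  have B_eq: "B J t = (\<Sum>\<^sub>\<infinity>j\<in>-J. cmod (u j t))" if "finite J" for J t
  proof -
    have "A t = (\<Sum>\<^sub>\<infinity>j\<in>J \<union> -J. cmod (u j t))" by (simp add: A_def)
    also have "\<dots> = (\<Sum>\<^sub>\<infinity>j\<in>J. cmod (u j t)) + (\<Sum>\<^sub>\<infinity>j\<in>-J. cmod (u j t))"
      using that by (intro infsum_Un_disjoint summable_on_subset_banach[OF abs']) auto
    finally show ?thesis using that by (simp add: B_def)
  qed
  have tail: "cmod ((\<Sum>j\<in>J. u j t) - h t) \<le> B J t" if "finite J" for J t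
  proof -
    have us: "(\<lambda>j. u j t) summable_on A" for A
      using Infinite_Sum.abs_summable_summable[OF abs', of t] by (rule summable_on_subset_banach) auto
    have "h t = (\<Sum>\<^sub>\<infinity>j\<in>J \<union> -J. u j t)" using infsumI[OF sum'] by simp
    also have "\<dots> = (\<Sum>\<^sub>\<infinity>j\<in>J. u j t) + (\<Sum>\<^sub>\<infinity>j\<in>-J. u j t)"
      by (intro infsum_Un_disjoint us) auto
    finally have "(\<Sum>j\<in>J. u j t) - h t = - (\<Sum>\<^sub>\<infinity>j\<in>-J. u j t)" using that by simp
    then have "cmod ((\<Sum>j\<in>J. u j t) - h t) = cmod (\<Sum>\<^sub>\<infinity>j\<in>-J. u j t)" by simp
    also have "\<dots> \<le> (\<Sum>\<^sub>\<infinity>j\<in>-J. cmod (u j t))"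
      by (rule norm_infsum_bound) (rule summable_on_subset_banach[OF abs'], simp)
    finally show ?thesis using that by (simp add: B_eq)
  qed
  have Jn_lim: "filterlim Jn (finite_subsets_at_top UNIV) sequentially"
    unfolding filterlim_finite_subsets_at_top
  proof (intro allI impI)
    fix X :: "'i set" assume X: "finite X \<and> X \<subseteq> UNIV"
    have "X \<subseteq> Jn n" if "n > Max (insert 0 (to_nat ` X))" for n
      using X that unfolding Jn_def by (auto simp: Max_less_iff)
    then show "\<forall>\<^sub>F n in sequentially. finite (Jn n) \<and> X \<subseteq> Jn n \<and> Jn n \<subseteq> UNIV"
      using fin by (intro eventually_sequentiallyI[of "Suc (Max (insert 0 (to_nat ` X)))"]) auto
  qed
  have Jn_sum: "(\<lambda>n. \<Sum>j\<in>Jn n. cmod (u j t)) \<longlonglongrightarrow> A t" for t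
    unfolding A_def using has_sum_infsum[OF abs', of t, unfolded has_sum_def] by (rule filterlim_compose[OF _ Jn_lim])
  have [measurable]: "A \<in> borel_measurable borel"
    by (rule borel_measurable_LIMSEQ_metric[where f = "\<lambda>n t. \<Sum>j\<in>Jn n. cmod (u j t)"]) (auto intro: Jn_sum)
  have [measurable]: "B J \<in> borel_measurable borel" for J unfolding B_def by measurable
  have B0: "B J t \<ge> 0" if "finite J" for J t unfolding B_eq[OF that] by (rule infsum_nonneg) simp
  have B_le: "(B J t)\<^sup>2 \<le> D t" if "finite J" for J t
  proof -
    have "B J t \<le> A t" by (simp add: B_def sum_nonneg)
    then have "(B J t)\<^sup>2 \<le> (A t)\<^sup>2" using B0[OF that] by (intro power_mono)
    also have "\<dots> \<le> D t" using dom[of t] by (simp add: A_def u_def)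
    finally show ?thesis .
  qed
  have B_int: "integrable lborel (\<lambda>t. (B J t)\<^sup>2)" if "finite J" for J
    by (rule Bochner_Integration.integrable_bound[OF D])
       (use B_le[OF that] in \<open>auto intro: order_trans[OF _ abs_ge_self]\<close>)
  have "(\<lambda>n. LINT t|lborel. (B (Jn n) t)\<^sup>2) \<longlonglongrightarrow> (LINT t|(lborel :: real measure). 0\<^sup>2)"
  proof (rule integral_dominated_convergence[OF _ _ D])
    have "(\<lambda>n. A t - (\<Sum>j\<in>Jn n. cmod (u j t))) \<longlonglongrightarrow> A t - A t" for t
      by (intro tendsto_intros Jn_sum)
    then have "(\<lambda>n. B (Jn n) t) \<longlonglongrightarrow> 0" for t by (simp add: B_def)
    then show "AE t in lborel. (\<lambda>n. (B (Jn n) t)\<^sup>2) \<longlonglongrightarrow> 0\<^sup>2"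
      by (intro AE_I2 tendsto_power)
    show "AE t in lborel. norm ((B (Jn n) t)\<^sup>2) \<le> D t" for n using B_le[OF fin] by auto
  qed auto
  then have B_lim: "(\<lambda>n. LINT t|lborel. (B (Jn n) t)\<^sup>2) \<longlonglongrightarrow> 0" by simp
  have "((\<lambda>J. L2_norm (\<lambda>t. (\<Sum>j\<in>J. u j t) - h t)) \<longlongrightarrow> 0) (finite_subsets_at_top UNIV)"
  proof (rule tendstoI)
    fix e :: real assume e: "e > 0"
    then have "\<forall>\<^sub>F n in sequentially. (LINT t|lborel. (B (Jn n) t)\<^sup>2) < e\<^sup>2"
      by (intro order_tendstoD(2)[OF B_lim]) simp
    then obtain n where n: "(LINT t|lborel. (B (Jn n) t)\<^sup>2) < e\<^sup>2"
      by (auto simp: eventually_sequentially)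
    show "\<forall>\<^sub>F J in finite_subsets_at_top UNIV. dist (L2_norm (\<lambda>t. (\<Sum>j\<in>J. u j t) - h t)) 0 < e"
      unfolding eventually_finite_subsets_at_top
    proof (intro exI[of _ "Jn n"] conjI allI impI fin)
      fix J assume J: "finite J \<and> Jn n \<subseteq> J \<and> J \<subseteq> UNIV"
      have "(LINT t|lborel. (cmod ((\<Sum>j\<in>J. u j t) - h t))\<^sup>2) \<le> (LINT t|lborel. (B (Jn n) t)\<^sup>2)"
      proof (rule integral_mono)
        show "integrable lborel (\<lambda>t. (cmod ((\<Sum>j\<in>J. u j t) - h t))\<^sup>2)"
          by (intro L2_integrable_square L2_diff L2_sum u_L2 h)
        show "integrable lborel (\<lambda>t. (B (Jn n) t)\<^sup>2)" by (rule B_int[OF fin])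
        fix t
        have "B J t \<le> B (Jn n) t" using J by (simp add: B_def sum_mono2)
        then show "(cmod ((\<Sum>j\<in>J. u j t) - h t))\<^sup>2 \<le> (B (Jn n) t)\<^sup>2"
          using tail[of J t] J by (intro power_mono) auto
      qed
      also note n
      finally have "L2_norm (\<lambda>t. (\<Sum>j\<in>J. u j t) - h t) < e"
        unfolding L2_norm_def using e real_less_rsqrt real_sqrt_less_mono by fastforce
      then show "dist (L2_norm (\<lambda>t. (\<Sum>j\<in>J. u j t) - h t)) 0 < e"
        by (simp add: L2_norm_def)
    qed auto
  qed
  then show ?thesis using f h by (simp add: frame_operator_maps_def u_def)
qed

lemma has_sum_diff_normed:
  fixes f g :: "'a \<Rightarrow> 'b::real_normed_vector"
  assumes "(f has_sum a) A" "(g has_sum b) A"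
  shows "((\<lambda>x. f x - g x) has_sum a - b) A"
  using has_sum_add[OF assms(1), of "\<lambda>x. - g x" "- b"] assms(2) by (simp add: has_sum_uminus)

lemma has_sum_finite_strips:
  fixes u :: "'a \<times> 'b \<Rightarrow> 'c::{real_normed_vector}"
  assumes "finite K"
    and "\<And>k. k \<in> K \<Longrightarrow> ((\<lambda>m. u (m, k)) has_sum V k) UNIV"
    and "\<And>m k. k \<notin> K \<Longrightarrow> u (m, k) = 0"
  shows "(u has_sum (\<Sum>k\<in>K. V k)) UNIV"
proof -
  have "(u has_sum (\<Sum>k\<in>K. V k)) (UNIV \<times> K)"
    using assms(1,2)
  proof (induction K)
    case (insert k K)
    have "inj_on (\<lambda>m. (m, k)) UNIV" by (simp add: inj_on_def)
    then have "(u has_sum V k) (range (\<lambda>m. (m, k)))"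
      using insert.prems[of k] by (subst has_sum_reindex) (auto simp: o_def)
    moreover have "range (\<lambda>m::'a. (m, k)) = UNIV \<times> {k}" by auto
    ultimately have "(u has_sum V k) (UNIV \<times> {k})" by (simp only:)
    moreover have "(u has_sum (\<Sum>k\<in>K. V k)) (UNIV \<times> K)" using insert by auto
    ultimately have "(u has_sum (V k + (\<Sum>k\<in>K. V k))) (UNIV \<times> {k} \<union> UNIV \<times> K)"
      using insert.hyps by (intro has_sum_Un_disjoint) auto
    moreover have "(UNIV :: 'a set) \<times> {k} \<union> UNIV \<times> K = UNIV \<times> insert k K" by auto
    ultimately show ?case using insert.hyps by simp
  qed simp
  moreover have "k \<in> K" if "u (m, k) \<noteq> 0" for m k using assms(3) that by blast
  ultimately show ?thesis
    by (subst has_sum_cong_neutral[where T = "UNIV \<times> K" and g = u]) auto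
qed

text \<open>Since (|t| + w)^2 \<le> 2 (t^2 + w^2), the integrand is at most twice (|t| + w)^(-3/2),
  which has an explicit primitive on each half-line.\<close>

lemma integrable_square_plus_square_powr:
  fixes w :: real
  assumes w: "w > 0"
  shows "integrable lborel (\<lambda>t. (t\<^sup>2 + w\<^sup>2) powr - (3/4))"
proof -
  define f where "f t = (t + w) powr - (3/2)" for t
  define F where "F t = - 2 * (t + w) powr - (1/2)" for t
  have [measurable]: "f \<in> borel_measurable borel" unfolding f_def by measurable
  have "(\<integral>\<^sup>+x. ennreal (f x) * indicator {0 ..} x \<partial>lborel) = ennreal (0 - F 0)"
  proof (rule nn_integral_FTC_atLeast)
    fix x :: real assume x: "0 \<le> x"
    have "((\<lambda>t. (t + w) powr - (1/2)) has_real_derivative (- (1/2) * (x + w) powr (- (1/2) - 1)) * 1) (at x)"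
      by (rule DERIV_chain2[OF has_real_derivative_powr]) (use x w in \<open>auto intro!: derivative_eq_intros\<close>)
    from DERIV_cmult[OF this, of "- 2"] show "DERIV F x :> f x" by (simp add: F_def[abs_def] f_def)
  next
    have "filterlim (\<lambda>t. t + w) at_top at_top"
      using filterlim_tendsto_add_at_top[OF tendsto_const filterlim_ident, of w] by (simp add: add.commute)
    then have "((\<lambda>t. (t + w) powr - (1/2)) \<longlongrightarrow> 0) at_top"
      by (intro tendsto_neg_powr) auto
    from tendsto_mult[OF tendsto_const[of "- 2"] this] show "(F \<longlongrightarrow> 0) at_top"
      by (simp add: F_def[abs_def])
  qed (auto simp: f_def)
  moreover have "(\<integral>\<^sup>+x. ennreal (indicator {0..} x * f x) \<partial>lborel)
      = (\<integral>\<^sup>+x. ennreal (f x) * indicator {0 ..} x \<partial>lborel)"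
    by (intro nn_integral_cong) (simp add: indicator_def)
  ultimately have "(\<integral>\<^sup>+x. ennreal (indicator {0..} x * f x) \<partial>lborel) < \<infinity>"
    by (simp only: ennreal_less_top infinity_ennreal_def)
  then have "integrable lborel (\<lambda>t. indicator {0..} t * f t)"
    by (intro integrableI_nonneg) (simp_all add: f_def)
  then have "integrable lborel (\<lambda>t. indicator {0..} t * f t + indicator {0..} (0 + - 1 * t) * f (0 + - 1 * t))"
    using lborel_integrable_real_affine[of "\<lambda>t. indicator {0..} t * f t" "- 1" 0]
    by (intro Bochner_Integration.integrable_add) auto
  then have i: "integrable lborel (\<lambda>t. 2 * (indicator {0..} t * f t + indicator {0..} (0 + - 1 * t) * f (0 + - 1 * t)))"
    by (rule integrable_mult_right)
  have "(t\<^sup>2 + w\<^sup>2) powr - (3/4) \<le> 2 * f \<bar>t\<bar>" for t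
  proof -
    have "(\<bar>t\<bar> + w)\<^sup>2 / 2 \<le> t\<^sup>2 + w\<^sup>2"
      using sum_squares_bound[of "\<bar>t\<bar>" w] by (simp add: power2_sum)
    moreover have p: "\<bar>t\<bar> + w > 0" using w by linarith
    ultimately have "(t\<^sup>2 + w\<^sup>2) powr - (3/4) \<le> ((\<bar>t\<bar> + w)\<^sup>2 / 2) powr - (3/4)"
      by (intro powr_mono2') auto
    also have "\<dots> = ((\<bar>t\<bar> + w) powr 2) powr - (3/4) * 2 powr (3/4)"
      using p by (simp add: powr_divide powr_minus_divide)
    also have "\<dots> = f \<bar>t\<bar> * 2 powr (3/4)" by (simp add: f_def powr_powr)
    also have "\<dots> \<le> f \<bar>t\<bar> * 2 powr 1" by (intro mult_left_mono powr_mono) (auto simp: f_def)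
    finally show ?thesis by simp
  qed
  moreover have "f \<bar>t\<bar> \<le> indicator {0..} t * f t + indicator {0..} (0 + - 1 * t) * f (0 + - 1 * t)" for t
    by (auto simp: f_def indicator_def)
  ultimately have "(t\<^sup>2 + w\<^sup>2) powr - (3/4) \<le> 2 * (indicator {0..} t * f t + indicator {0..} (0 + - 1 * t) * f (0 + - 1 * t))" for t
    by (smt (verit))
  then show ?thesis
    by (intro Bochner_Integration.integrable_bound[OF i]) (auto intro: order_trans[OF _ abs_ge_self])
qed

section \<open>The image of a frequency band\<close>

lemma gabor_system_cauchy_kernel:
  "gabor_system \<alpha> \<beta> (cauchy_kernel w) (m, k) t
    = cis (2 * pi * \<beta> * of_int k * t) / (of_real (t - of_int m * \<alpha>) - \<i> * of_real w)"
  using arg_cong[OF cnj_gabor_cauchy_kernel[of \<alpha> \<beta> w m k t], of cnj] by (simp add: cis_cnj)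

text \<open>The image of the band function under the frame operator, up to a factor independent of
  \<open>t\<close>, when no window boundary lies inside the band. For the band [-\<Lambda>, 0] it is
  -1/(t - i w), minus the Cauchy kernel.\<close>

definition band_image :: "real \<Rightarrow> real \<Rightarrow> real \<Rightarrow> real \<Rightarrow> real \<Rightarrow> complex" where
  "band_image \<Lambda> w a b t =
    (exp (\<i> * (of_real t - \<i> * of_real w) * of_real a) - exp (\<i> * (of_real t - \<i> * of_real w) * of_real b)) /
    ((of_real t - \<i> * of_real w) * (1 - exp (- \<i> * (of_real t - \<i> * of_real w) * of_real \<Lambda>)))"

lemma band_image_L2:
  assumes w: "w > 0" and \<Lambda>: "\<Lambda> > 0"
  shows "band_image \<Lambda> w a b \<in> L2"
proof -
  define \<delta> where "\<delta> = 1 - exp (- (w * \<Lambda>))"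
  have \<delta>: "\<delta> > 0" using w \<Lambda> by (simp add: \<delta>_def)
  have "(\<lambda>t. 1 / (of_real (t - 0) + \<i> * of_real w)) \<in> L2" by (rule cauchy_kernel_L2[OF w])
  then have "(\<lambda>t. 1 / (of_real t + \<i> * of_real w)) \<in> L2" by simp
  then show ?thesis
  proof (rule L2_bound[where C = "(exp (a * w) + exp (b * w)) / \<delta>"])
    show "band_image \<Lambda> w a b \<in> borel_measurable borel"
      unfolding band_image_def[abs_def] by measurable
    fix t
    let ?\<zeta> = "complex_of_real t - \<i> * of_real w"
    have E: "cmod (exp (\<i> * ?\<zeta> * of_real c)) = exp (c * w)" for c by (simp add: mult.commute)
    have n: "cmod (exp (\<i> * ?\<zeta> * of_real a) - exp (\<i> * ?\<zeta> * of_real b)) \<le> exp (a * w) + exp (b * w)"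
      using norm_triangle_ineq4[of "exp (\<i> * ?\<zeta> * of_real a)" "exp (\<i> * ?\<zeta> * of_real b)"] unfolding E .
    have d: "\<delta> \<le> cmod (1 - exp (- \<i> * ?\<zeta> * of_real \<Lambda>))"
      unfolding \<delta>_def by (rule one_minus_exp_nonzero(1)[OF w \<Lambda>])
    have "cmod (exp (\<i> * ?\<zeta> * of_real a) - exp (\<i> * ?\<zeta> * of_real b)) / cmod (1 - exp (- \<i> * ?\<zeta> * of_real \<Lambda>))
        \<le> (exp (a * w) + exp (b * w)) / \<delta>"
      using n d \<delta> by (intro frac_le) auto
    then have "cmod (exp (\<i> * ?\<zeta> * of_real a) - exp (\<i> * ?\<zeta> * of_real b)) / cmod (1 - exp (- \<i> * ?\<zeta> * of_real \<Lambda>)) / cmod ?\<zeta>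
        \<le> (exp (a * w) + exp (b * w)) / \<delta> / cmod ?\<zeta>"
      by (rule divide_right_mono) simp
    moreover have "cmod ?\<zeta> = cmod (of_real t + \<i> * of_real w)" by (simp add: cmod_def)
    ultimately show "cmod (band_image \<Lambda> w a b t) \<le> (exp (a * w) + exp (b * w)) / \<delta> * cmod (1 / (of_real t + \<i> * of_real w))"
      unfolding band_image_def norm_divide norm_mult by (simp add: mult.commute)
  qed
qed

text \<open>For each \<open>k\<close> in \<open>K\<close> the sum over \<open>m\<close> is the
  difference of the interpolation series at the distances of \<open>b\<close> and of
  \<open>a\<close> from the right end of the window. Indices outside \<open>K\<close> do not see the
  band at all, so \<open>W\<close> is the only trace that \<open>K\<close> leaves.\<close>

theorem frame_operator_maps_band_function:
  fixes \<alpha> \<beta> w a b :: real and K :: "int set"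
  assumes w: "w > 0" and \<alpha>: "\<alpha> > 0" and ab: "a \<le> b" and K: "finite K"
    and in_K: "\<And>k. k \<in> K \<Longrightarrow> 2 * pi * \<beta> * of_int k - 2 * pi / \<alpha> \<le> a \<and> b \<le> 2 * pi * \<beta> * of_int k"
    and notin_K: "\<And>k. k \<notin> K \<Longrightarrow> 2 * pi * \<beta> * of_int k \<le> a \<or> b \<le> 2 * pi * \<beta> * of_int k - 2 * pi / \<alpha>"
  defines "\<Lambda> \<equiv> 2 * pi / \<alpha>" and "W \<equiv> \<Sum>k\<in>K. exp (- (4 * pi * \<beta> * w * of_int k))"
  shows "frame_operator_maps (gabor_system \<alpha> \<beta> (cauchy_kernel w)) (band_function \<Lambda> w a b)
    (\<lambda>t. of_real (2 * pi * \<Lambda> * W) * band_image \<Lambda> w a b t)"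
proof -
  have \<Lambda>: "\<Lambda> > 0" using \<alpha> by (simp add: \<Lambda>_def)
  define \<kappa> where "\<kappa> k = 2 * pi * \<beta> * of_int k" for k :: int
  define p where "p m x = cis_primitive (- (of_int m * \<alpha>)) x" for m x
  define u where "u t j = L2_inner (band_function \<Lambda> w a b) (gabor_system \<alpha> \<beta> (cauchy_kernel w) j)
     * gabor_system \<alpha> \<beta> (cauchy_kernel w) j t" for t j
  have u_K: "u t (m, k) = of_real (2 * pi * exp (- (\<kappa> k * w))) * cis (\<kappa> k * t) *
      (p m (\<kappa> k - b) / (of_real (t - of_int m * \<alpha>) - \<i> * of_real w) - p m (\<kappa> k - a) / (of_real (t - of_int m * \<alpha>) - \<i> * of_real w))"
    if "k \<in> K" for m k t
  proof -
    have "L2_inner (band_function \<Lambda> w a b) (gabor_system \<alpha> \<beta> (cauchy_kernel w) (m, k))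
        = of_real (2 * pi * exp (- (\<kappa> k * w))) * (p m (\<kappa> k - b) - p m (\<kappa> k - a))"
      unfolding \<Lambda>_def \<kappa>_def p_def
      by (rule L2_inner_band_function_cases(1)[OF w \<alpha> ab]) (use in_K[OF that] in auto)
    then show ?thesis
      unfolding u_def gabor_system_cauchy_kernel \<kappa>_def[symmetric] diff_divide_distrib[symmetric] by simp
  qed
  have u_notK: "u t (m, k) = 0" if "k \<notin> K" for m k t
    using L2_inner_band_function_cases(2)[OF w \<alpha> ab, of \<beta> k m] notin_K[OF that]
    by (simp add: u_def \<Lambda>_def[symmetric])
  have range: "\<kappa> k - b \<in> {0..2 * pi / \<alpha>}" "\<kappa> k - a \<in> {0..2 * pi / \<alpha>}" if "k \<in> K" for k
    using in_K[OF that] ab by (auto simp: \<kappa>_def)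
  have sum: "((\<lambda>j. u t j) has_sum of_real (2 * pi * \<Lambda> * W) * band_image \<Lambda> w a b t) UNIV" for t
  proof -
    define \<zeta> where "\<zeta> = complex_of_real t - \<i> * of_real w"
    define E where "E = 1 - exp (- \<i> * \<zeta> * of_real \<Lambda>)"
    define V where "V k = of_real (2 * pi * exp (- (\<kappa> k * w))) * cis (\<kappa> k * t) *
      (of_real \<Lambda> * (1 - exp (- \<i> * \<zeta> * of_real (\<kappa> k - b))) / (\<zeta> * E) - of_real \<Lambda> * (1 - exp (- \<i> * \<zeta> * of_real (\<kappa> k - a))) / (\<zeta> * E))" for k
    have "(u t has_sum (\<Sum>k\<in>K. V k)) UNIV"
    proof (rule has_sum_finite_strips[where u = "u t", OF K _ u_notK])
      fix k assume k: "k \<in> K"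
      show "((\<lambda>m. u t (m, k)) has_sum V k) UNIV"
        unfolding u_K[OF k] V_def E_def \<zeta>_def p_def \<Lambda>_def
        by (intro has_sum_cmult_right has_sum_diff_normed has_sum_cis_primitive_over_poles[OF w \<alpha>] range k)
    qed
    moreover have "V k = of_real (2 * pi * \<Lambda>) * of_real (exp (- (4 * pi * \<beta> * w * of_int k))) * band_image \<Lambda> w a b t" for k
    proof -
      \<comment> \<open>One factor exp(-\<kappa> w) stems from the inner product; a second is left
        when the modulation in t meets the exponential in \<zeta> = t - i w. All other dependence on
        \<open>k\<close> cancels.\<close>
      have e: "of_real (exp (- (\<kappa> k * w))) * cis (\<kappa> k * t) * exp (- \<i> * \<zeta> * of_real (\<kappa> k - c))
          = of_real (exp (- (4 * pi * \<beta> * w * of_int k))) * exp (\<i> * \<zeta> * of_real c)" for c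
      proof -
        have eq: "of_real (- (\<kappa> k * w)) + (\<i> * of_real (\<kappa> k * t) + - \<i> * \<zeta> * of_real (\<kappa> k - c))
            = of_real (- (4 * pi * \<beta> * w * of_int k)) + \<i> * \<zeta> * of_real c"
          by (simp add: \<zeta>_def \<kappa>_def algebra_simps)
        from arg_cong[OF this, of exp] show ?thesis
          unfolding exp_add by (simp only: cis_conv_exp exp_of_real mult.assoc)
      qed
      have "V k = of_real (2 * pi * \<Lambda>) * (of_real (exp (- (\<kappa> k * w))) * cis (\<kappa> k * t) * exp (- \<i> * \<zeta> * of_real (\<kappa> k - a))
          - of_real (exp (- (\<kappa> k * w))) * cis (\<kappa> k * t) * exp (- \<i> * \<zeta> * of_real (\<kappa> k - b))) / (\<zeta> * E)"
        unfolding V_def diff_divide_distrib[symmetric] by (simp add: algebra_simps diff_divide_distrib)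
      also have "\<dots> = of_real (2 * pi * \<Lambda>) * of_real (exp (- (4 * pi * \<beta> * w * of_int k))) * band_image \<Lambda> w a b t"
        unfolding e band_image_def \<zeta>_def[symmetric] E_def[symmetric] right_diff_distrib[symmetric] by simp
      finally show ?thesis .
    qed
    then have "(\<Sum>k\<in>K. V k) = of_real (2 * pi * \<Lambda> * W) * band_image \<Lambda> w a b t"
      by (simp add: W_def sum_distrib_left sum_distrib_right)
    ultimately show ?thesis by simp
  qed
  define C0 where "C0 = 2 * (\<alpha> + w) / \<alpha> + 2 * pi / \<alpha> * w"
  obtain C where C: "C \<ge> 0" and C_sum: "\<And>t. (\<lambda>m. 1 / (pole_dist \<alpha> w 0 m * pole_dist \<alpha> w t m)) summable_on UNIV"
    and C_le: "\<And>t. (\<Sum>\<^sub>\<infinity>m. 1 / (pole_dist \<alpha> w 0 m * pole_dist \<alpha> w t m)) \<le> C * (t\<^sup>2 + w\<^sup>2) powr - (3/8)"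
    by (rule pole_dist_product[OF w \<alpha>]) blast
  \<comment> \<open>The factor 4 pi is the 2 pi of the inner product times the number of primitives
    in the difference, each bounded through \<open>C0\<close>.\<close>
  define C1 where "C1 k = 4 * pi * exp (- (\<kappa> k * w)) * C0" for k
  have C0: "C0 \<ge> 0" using w \<alpha> by (simp add: C0_def)
  then have C1: "C1 k \<ge> 0" for k by (simp add: C1_def)
  have u_le: "cmod (u t (m, k)) \<le> C1 k * (1 / (pole_dist \<alpha> w 0 m * pole_dist \<alpha> w t m))" if k: "k \<in> K" for t m k
  proof -
    have p_le: "cmod (p m x) \<le> C0 / pole_dist \<alpha> w 0 m" if "x \<in> {0..2 * pi / \<alpha>}" for x
      using cmod_cis_primitive_le_pole_dist[OF w \<alpha>, of x m] that by (simp add: p_def C0_def)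
    have "cmod (p m (\<kappa> k - b) - p m (\<kappa> k - a)) \<le> 2 * (C0 / pole_dist \<alpha> w 0 m)"
      using norm_triangle_ineq4[of "p m (\<kappa> k - b)" "p m (\<kappa> k - a)"] p_le[OF range(1)[OF k]] p_le[OF range(2)[OF k]] by linarith
    then have "2 * pi * exp (- (\<kappa> k * w)) * (cmod (p m (\<kappa> k - b) - p m (\<kappa> k - a)) / pole_dist \<alpha> w t m)
       \<le> 2 * pi * exp (- (\<kappa> k * w)) * (2 * (C0 / pole_dist \<alpha> w 0 m) / pole_dist \<alpha> w t m)"
      using pole_dist_ge[OF w, of \<alpha> t m] w by (intro mult_left_mono divide_right_mono) auto
    moreover have "cmod (u t (m, k)) = 2 * pi * exp (- (\<kappa> k * w)) * (cmod (p m (\<kappa> k - b) - p m (\<kappa> k - a)) / pole_dist \<alpha> w t m)"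
      unfolding u_K[OF k] diff_divide_distrib[symmetric] by (simp add: norm_mult norm_divide pole_dist_def)
    ultimately show ?thesis by (simp add: C1_def)
  qed
  have strip: "(\<lambda>m. cmod (u t (m, k))) summable_on UNIV" if "k \<in> K" for t k
    by (rule summable_on_comparison_test[OF summable_on_cmult_right[OF C_sum[of t], of "C1 k"]]) (use u_le[OF that] in auto)
  have abs: "((\<lambda>j. cmod (u t j)) has_sum (\<Sum>k\<in>K. \<Sum>\<^sub>\<infinity>m. cmod (u t (m, k)))) UNIV" for t
    by (rule has_sum_finite_strips[OF K]) (auto simp: u_notK intro: has_sum_infsum strip)
  define D where "D t = ((\<Sum>k\<in>K. C1 k) * C)\<^sup>2 * (t\<^sup>2 + w\<^sup>2) powr - (3/4)" for t
  show ?thesis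
  proof (rule frame_operator_maps_dominated)
    show "integrable lborel D"
      unfolding D_def by (intro integrable_mult_right integrable_square_plus_square_powr w)
    fix t
    have "(\<Sum>\<^sub>\<infinity>j. cmod (u t j)) = (\<Sum>k\<in>K. \<Sum>\<^sub>\<infinity>m. cmod (u t (m, k)))" by (rule infsumI[OF abs])
    also have "\<dots> \<le> (\<Sum>k\<in>K. C1 k * (C * (t\<^sup>2 + w\<^sup>2) powr - (3/8)))"
    proof (rule sum_mono)
      fix k assume k: "k \<in> K"
      have "(\<Sum>\<^sub>\<infinity>m. cmod (u t (m, k))) \<le> (\<Sum>\<^sub>\<infinity>m. C1 k * (1 / (pole_dist \<alpha> w 0 m * pole_dist \<alpha> w t m)))"
        by (intro infsum_mono strip k summable_on_cmult_right C_sum u_le)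
      also have "\<dots> = C1 k * (\<Sum>\<^sub>\<infinity>m. 1 / (pole_dist \<alpha> w 0 m * pole_dist \<alpha> w t m))"
        by (rule infsum_cmult_right[OF C_sum])
      also have "\<dots> \<le> C1 k * (C * (t\<^sup>2 + w\<^sup>2) powr - (3/8))"
        by (intro mult_left_mono C_le C1)
      finally show "(\<Sum>\<^sub>\<infinity>m. cmod (u t (m, k))) \<le> C1 k * (C * (t\<^sup>2 + w\<^sup>2) powr - (3/8))" .
    qed
    also have "\<dots> = (\<Sum>k\<in>K. C1 k) * C * (t\<^sup>2 + w\<^sup>2) powr - (3/8)"
      by (simp add: sum_distrib_right mult.assoc)
    finally have "(\<Sum>\<^sub>\<infinity>j. cmod (u t j))\<^sup>2 \<le> ((\<Sum>k\<in>K. C1 k) * C * (t\<^sup>2 + w\<^sup>2) powr - (3/8))\<^sup>2"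
      by (intro power_mono infsum_nonneg) auto
    also have "\<dots> = D t"
    proof -
      have "((t\<^sup>2 + w\<^sup>2) powr - (3/8))\<^sup>2 = (t\<^sup>2 + w\<^sup>2) powr - (3/4)"
        unfolding power2_eq_square by (simp flip: powr_add)
      then show ?thesis by (simp only: D_def power_mult_distrib)
    qed
    finally show "(\<Sum>\<^sub>\<infinity>j. cmod (L2_inner (band_function \<Lambda> w a b) (gabor_system \<alpha> \<beta> (cauchy_kernel w) j)
        * gabor_system \<alpha> \<beta> (cauchy_kernel w) j t))\<^sup>2 \<le> D t"
      by (simp only: u_def)
    show "((\<lambda>j. L2_inner (band_function \<Lambda> w a b) (gabor_system \<alpha> \<beta> (cauchy_kernel w) j)
        * gabor_system \<alpha> \<beta> (cauchy_kernel w) j t) has_sum of_real (2 * pi * \<Lambda> * W) * band_image \<Lambda> w a b t) UNIV"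
      using sum[of t] by (simp only: u_def)
    show "(\<lambda>j. cmod (L2_inner (band_function \<Lambda> w a b) (gabor_system \<alpha> \<beta> (cauchy_kernel w) j)
        * gabor_system \<alpha> \<beta> (cauchy_kernel w) j t)) summable_on UNIV"
      using has_sum_imp_summable[OF abs[of t]] by (simp only: u_def)
  qed (intro gabor_cauchy_kernel_L2 band_function_L2 L2_cmult band_image_L2 w \<Lambda>)+
qed

section \<open>Assembling the dual window\<close>

lemma L2_norm_cmult: "L2_norm (\<lambda>t. c * f t) = cmod c * L2_norm f"
  by (simp add: L2_norm_def norm_mult power_mult_distrib real_sqrt_mult)

lemma L2_inner_cmult_left: "L2_inner (\<lambda>t. c * f t) g = c * L2_inner f g"
  by (simp add: L2_inner_def mult.assoc)

lemma L2_inner_add_left: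
  assumes "f \<in> L2" "g \<in> L2" "h \<in> L2"
  shows "L2_inner (\<lambda>t. f t + g t) h = L2_inner f h + L2_inner g h"
  unfolding L2_inner_def distrib_right
  by (intro Bochner_Integration.integral_add L2_mult_integrable L2_cnj assms)

lemma frame_operator_maps_cmult:
  assumes "frame_operator_maps G f h"
  shows "frame_operator_maps G (\<lambda>t. c * f t) (\<lambda>t. c * h t)"
proof -
  have "(\<Sum>j\<in>J. L2_inner (\<lambda>t. c * f t) (G j) * G j t) - c * h t = c * ((\<Sum>j\<in>J. L2_inner f (G j) * G j t) - h t)" for J t
    by (simp add: L2_inner_cmult_left right_diff_distrib sum_distrib_left mult.assoc)
  moreover have "((\<lambda>J. cmod c * L2_norm (\<lambda>t. (\<Sum>j\<in>J. L2_inner f (G j) * G j t) - h t)) \<longlongrightarrow> cmod c * 0) (finite_subsets_at_top UNIV)"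
    using assms unfolding frame_operator_maps_def by (intro tendsto_intros) auto
  ultimately show ?thesis
    using assms unfolding frame_operator_maps_def by (simp add: L2_cmult L2_norm_cmult)
qed

lemma frame_operator_maps_add:
  assumes G: "\<And>j. G j \<in> L2" and fh: "frame_operator_maps G f h" and fh': "frame_operator_maps G f' h'"
  shows "frame_operator_maps G (\<lambda>t. f t + f' t) (\<lambda>t. h t + h' t)"
proof -
  have L2: "f \<in> L2" "f' \<in> L2" "h \<in> L2" "h' \<in> L2" using fh fh' by (auto simp: frame_operator_maps_def)
  define P where "P u J t = (\<Sum>j\<in>J. L2_inner u (G j) * G j t)" for u J t
  have P: "P u J \<in> L2" for u J unfolding P_def by (intro L2_sum L2_cmult G)
  let ?F = "finite_subsets_at_top UNIV"
  have eq: "P (\<lambda>t. f t + f' t) J t - (h t + h' t) = (P f J t - h t) + (P f' J t - h' t)" for J t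
    by (simp add: P_def L2_inner_add_left L2 G distrib_right sum.distrib)
  have "((\<lambda>J. 2 * (L2_norm (\<lambda>t. P f J t - h t))\<^sup>2 + 2 * (L2_norm (\<lambda>t. P f' J t - h' t))\<^sup>2) \<longlongrightarrow> 2 * 0\<^sup>2 + 2 * 0\<^sup>2) ?F"
    using fh fh' unfolding frame_operator_maps_def P_def by (intro tendsto_intros) auto
  then have "((\<lambda>J. 2 * (L2_norm (\<lambda>t. P f J t - h t))\<^sup>2 + 2 * (L2_norm (\<lambda>t. P f' J t - h' t))\<^sup>2) \<longlongrightarrow> 0) ?F"
    by simp
  then have "((\<lambda>J. (L2_norm (\<lambda>t. P (\<lambda>t. f t + f' t) J t - (h t + h' t)))\<^sup>2) \<longlongrightarrow> 0) ?F"
    by (rule tendsto_sandwich[OF _ _ tendsto_const, rotated 2])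
       (auto simp: eq intro!: always_eventually L2_norm_add_square_le L2_diff P L2)
  then have "((\<lambda>J. sqrt ((L2_norm (\<lambda>t. P (\<lambda>t. f t + f' t) J t - (h t + h' t)))\<^sup>2)) \<longlongrightarrow> sqrt 0) ?F"
    by (rule tendsto_real_sqrt)
  moreover have "sqrt ((L2_norm u)\<^sup>2) = L2_norm u" for u by (simp add: L2_norm_def)
  ultimately show ?thesis
    unfolding frame_operator_maps_def P_def by (simp add: L2_add L2)
qed

lemma frame_operator_maps_sum:
  fixes f h :: "'a \<Rightarrow> real \<Rightarrow> complex"
  assumes G: "\<And>j. G j \<in> L2" and "\<And>i. i \<in> I \<Longrightarrow> frame_operator_maps G (f i) (h i)" and "finite I"
  shows "frame_operator_maps G (\<lambda>t. \<Sum>i\<in>I. f i t) (\<lambda>t. \<Sum>i\<in>I. h i t)"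
  using assms(3,2)
proof (induction I)
  case empty
  show ?case by (simp add: frame_operator_maps_def L2_def L2_inner_def L2_norm_def)
next
  case (insert i I)
  then show ?case using frame_operator_maps_add[OF G insert.prems[of i] insert.IH] by simp
qed

lemma frame_operator_maps_AE_cong:
  assumes fh: "frame_operator_maps G f h" and f': "f' \<in> L2" and G: "\<And>j. G j \<in> L2"
    and AE: "AE t in lborel. f' t = f t"
  shows "frame_operator_maps G f' h"
proof -
  have [measurable]: "f \<in> borel_measurable borel" "f' \<in> borel_measurable borel" "G j \<in> borel_measurable borel" for j
    using fh f' G by (auto simp: frame_operator_maps_def dest: L2_measurable)
  have "L2_inner f' (G j) = L2_inner f (G j)" for j
    unfolding L2_inner_def
  proof (rule Bochner_Integration.integral_cong_AE)
    show "AE t in lborel. f' t * cnj (G j t) = f t * cnj (G j t)"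
      using AE by eventually_elim simp
  qed measurable
  then show ?thesis using fh f' by (simp add: frame_operator_maps_def)
qed

text \<open>One dual window determines all of them: a second one has the same coefficients, so by
  completeness the difference vanishes almost everywhere. Conversely, inner products ignore null
  sets, so every square-integrable representative qualifies.\<close>

lemma canonical_dual_window_cauchy_iff:
  assumes "w > 0" "\<alpha> > 0" "\<beta> > 0" "\<alpha> * \<beta> \<le> 1"
    and \<gamma>0: "canonical_dual_window \<alpha> \<beta> (cauchy_kernel w) \<gamma>0"
  shows "canonical_dual_window \<alpha> \<beta> (cauchy_kernel w) \<gamma> \<longleftrightarrow> \<gamma> \<in> L2 \<and> (AE t in lborel. \<gamma> t = \<gamma>0 t)"
proof
  assume \<gamma>: "canonical_dual_window \<alpha> \<beta> (cauchy_kernel w) \<gamma>"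
  then have L2: "\<gamma> \<in> L2" "\<gamma>0 \<in> L2"
    using \<gamma>0 by (auto simp: canonical_dual_window_def frame_operator_maps_def)
  have "AE t in lborel. \<gamma> t - \<gamma>0 t = 0"
  proof (rule gabor_cauchy_kernel_complete[OF assms(1-4) L2_diff[OF L2]])
    fix m k
    have "L2_inner \<gamma> (gabor_system \<alpha> \<beta> (cauchy_kernel w) (m, k)) = L2_inner \<gamma>0 (gabor_system \<alpha> \<beta> (cauchy_kernel w) (m, k))"
      using \<gamma> \<gamma>0 gabor_cauchy_kernel_L2[OF assms(1)] unfolding canonical_dual_window_def
      by (intro frame_operator_maps_same_imp_inner_eq) auto
    then show "L2_inner (\<lambda>t. \<gamma> t - \<gamma>0 t) (gabor_system \<alpha> \<beta> (cauchy_kernel w) (m, k)) = 0"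
      by (simp add: L2_inner_diff_left L2 gabor_cauchy_kernel_L2 assms(1))
  qed
  then show "\<gamma> \<in> L2 \<and> (AE t in lborel. \<gamma> t = \<gamma>0 t)" using L2 by simp
next
  assume "\<gamma> \<in> L2 \<and> (AE t in lborel. \<gamma> t = \<gamma>0 t)"
  then show "canonical_dual_window \<alpha> \<beta> (cauchy_kernel w) \<gamma>"
    using \<gamma>0 unfolding canonical_dual_window_def
    by (auto intro: frame_operator_maps_AE_cong gabor_cauchy_kernel_L2 assms(1))
qed

section \<open>Geometric sums and interlaced bands\<close>

text \<open>Inverts the geometric sum W over a block of \<open>N\<close> consecutive indices ending
  in \<open>k\<close>. This inverse is the weight that becomes the exponential quotient of the final
  formula.\<close>

lemma sum_exp_block:
  fixes c :: real
  assumes c: "c > 0" and N: "N \<ge> 1"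
  shows "(exp c ^ k * ((exp c - 1) / (exp c ^ N - 1))) * (\<Sum>j\<in>{int k - int N + 1..int k}. exp (- (c * of_int j))) = 1"
proof -
  have "(\<Sum>j\<in>{int k - int N + 1..int k}. exp (- (c * of_int j))) = (\<Sum>i<N. exp (- (c * of_int (int k - int i))))"
    by (rule sum.reindex_bij_witness[where i = "\<lambda>i. int k - int i" and j = "\<lambda>j. nat (int k - j)"]) auto
  also have "\<dots> = (\<Sum>i<N. exp (- (c * real k)) * exp c ^ i)"
    by (rule sum.cong[OF refl]) (simp add: exp_of_nat_mult[symmetric] algebra_simps flip: exp_add)
  also have "\<dots> = exp (- (c * real k)) * ((exp c ^ N - 1) / (exp c - 1))"
    using c by (simp add: geometric_sum flip: sum_distrib_left)
  finally have s: "(\<Sum>j\<in>{int k - int N + 1..int k}. exp (- (c * of_int j))) = exp (- (c * real k)) * ((exp c ^ N - 1) / (exp c - 1))" .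
  have "exp c ^ N > 1" using c N by (intro one_less_power) auto
  then have nz: "exp c - 1 \<noteq> 0" "exp c ^ N - 1 \<noteq> 0" using c by auto
  have inv: "exp c ^ k * exp (- (c * real k)) = 1"
    by (simp add: exp_of_nat_mult[symmetric] mult.commute flip: exp_add)
  have "(p * (x / y)) * (q * (y / x)) = p * q" if "x \<noteq> 0" "y \<noteq> 0" for p q x y :: real
    using that by simp
  from this[OF nz] show ?thesis unfolding s by (simp only: inv)
qed

text \<open>Pulling out the exponential at the midpoint leaves a sine of the half-length; 1 - exp(i
  \<Lambda> z) is the case a = 0, b = \<Lambda>. Two factors -2 i give -4.\<close>

lemma band_function_sin:
  fixes \<Lambda> w a b t :: real
  defines "z \<equiv> complex_of_real t + \<i> * of_real w"
  shows "band_function \<Lambda> w a b t = - 4 * (exp (\<i> * of_real ((a + b) / 2 + \<Lambda> / 2) * z) *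
    sin (of_real (\<Lambda> / 2) * z) * sin (of_real ((b - a) / 2) * z)) / z"
proof -
  have d: "exp (\<i> * of_real a * z) - exp (\<i> * of_real b * z)
     = - 2 * \<i> * exp (\<i> * of_real ((a + b) / 2) * z) * sin (of_real ((b - a) / 2) * z)" for a b :: real
  proof -
    have "exp (\<i> * of_real a * z) = exp (\<i> * of_real ((a + b) / 2) * z) * exp (- (\<i> * (of_real ((b - a) / 2) * z)))"
      unfolding exp_add[symmetric] by (rule arg_cong[of _ _ exp]) (simp add: field_simps)
    moreover have "exp (\<i> * of_real b * z) = exp (\<i> * of_real ((a + b) / 2) * z) * exp (\<i> * (of_real ((b - a) / 2) * z))"
      unfolding exp_add[symmetric] by (rule arg_cong[of _ _ exp]) (simp add: field_simps)
    moreover have "m * p - m * q = - 2 * \<i> * m * ((q - p) / (2 * \<i>))" for m p q :: complex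
      by (simp add: field_simps)
    ultimately show ?thesis unfolding sin_exp_eq by (simp only:)
  qed
  have "1 - exp (\<i> * of_real \<Lambda> * z) = - 2 * \<i> * exp (\<i> * of_real (\<Lambda> / 2) * z) * sin (of_real (\<Lambda> / 2) * z)"
    using d[of 0 \<Lambda>] by simp
  moreover have "exp (\<i> * of_real ((a + b) / 2 + \<Lambda> / 2) * z)
      = exp (\<i> * of_real ((a + b) / 2) * z) * exp (\<i> * of_real (\<Lambda> / 2) * z)"
    unfolding exp_add[symmetric] by (rule arg_cong[of _ _ exp]) (simp add: field_simps)
  ultimately show ?thesis
    unfolding band_function_def z_def[symmetric] d by (simp add: mult_ac)
qed

text \<open>Because v = 2 w + i z, weight and phase combine into the powers of X = exp(2 pi \<beta>
  v). As |X| > 1, the geometric sum has a nonzero denominator.\<close>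

lemma sum_exp_modulated_block:
  fixes \<beta> w t :: real
  assumes "\<beta> > 0" "w > 0"
  defines "z \<equiv> complex_of_real t + \<i> * of_real w" and "v \<equiv> complex_of_real w + \<i> * of_real t"
  shows "(\<Sum>k<N. of_real (exp (4 * pi * \<beta> * w) ^ k) * exp (\<i> * of_real (2 * pi * \<beta> * (real k - (real N - 1) / 2)) * z))
    = exp (- (\<i> * of_real (pi * \<beta> * (real N - 1)) * z)) *
      ((exp (of_real (2 * pi * \<beta> * real N) * v) - 1) / (exp (of_real (2 * pi * \<beta>) * v) - 1))"
proof -
  define X where "X = exp (of_real (2 * pi * \<beta>) * v)"
  have "cmod X = exp (2 * pi * \<beta> * w)" by (simp add: X_def v_def)
  also have "\<dots> \<noteq> 1" using assms by simp
  finally have X1: "X \<noteq> 1" by auto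
  have "of_real (exp (4 * pi * \<beta> * w) ^ k) * exp (\<i> * of_real (2 * pi * \<beta> * (real k - (real N - 1) / 2)) * z)
      = exp (- (\<i> * of_real (pi * \<beta> * (real N - 1)) * z)) * X ^ k" for k
  proof -
    have "of_real (real k * (4 * pi * \<beta> * w)) + \<i> * of_real (2 * pi * \<beta> * (real k - (real N - 1) / 2)) * z
        = - (\<i> * of_real (pi * \<beta> * (real N - 1)) * z) + of_nat k * (of_real (2 * pi * \<beta>) * v)"
      by (simp add: z_def v_def complex_eq_iff field_simps)
    from arg_cong[OF this, of exp] show ?thesis
      by (simp only: X_def exp_add exp_of_nat_mult[symmetric] exp_of_real)
  qed
  then have "(\<Sum>k<N. of_real (exp (4 * pi * \<beta> * w) ^ k) * exp (\<i> * of_real (2 * pi * \<beta> * (real k - (real N - 1) / 2)) * z))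
      = exp (- (\<i> * of_real (pi * \<beta> * (real N - 1)) * z)) * (\<Sum>k<N. X ^ k)"
    by (simp only: sum_distrib_left)
  also have "(\<Sum>k<N. X ^ k) = (X ^ N - 1) / (X - 1)" by (rule geometric_sum[OF X1])
  also have "X ^ N = exp (of_real (2 * pi * \<beta> * real N) * v)"
    by (simp add: X_def exp_of_nat_mult[symmetric] mult_ac)
  finally show ?thesis by (simp only: X_def)
qed

lemma sum_telescope_interlaced:
  fixes U V :: "nat \<Rightarrow> 'a::ab_group_add"
  shows "(\<Sum>k<n + 1. V k - U k) + (\<Sum>k<n. U (k + 1) - V k) = V n - U 0"
  by (induction n) (simp_all add: algebra_simps)

text \<open>The endpoints a_k = 2 pi \<beta> k - \<Lambda> and b_k = 2 pi \<beta> (k - n) run from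
  a_0 = -\<Lambda> to b_n = 0. The first sum belongs to the bands [a_k, b_k], the second to the gaps
  [b_k, a_(k+1)] between them. The minus signs compensate the sign of \<open>band_image\<close> on
  [-\<Lambda>, 0]. Parity of \<open>n\<close> does not enter.\<close>

definition cauchy_dual_window :: "real \<Rightarrow> real \<Rightarrow> real \<Rightarrow> nat \<Rightarrow> real \<Rightarrow> complex" where
  "cauchy_dual_window \<alpha> \<beta> w n t =
    (let \<Lambda> = 2 * pi / \<alpha>; Q = exp (4 * pi * \<beta> * w) in
      (\<Sum>k<n + 1. - of_real (1 / (2 * pi * \<Lambda>) * (Q ^ k * ((Q - 1) / (Q ^ (n + 1) - 1)))) *
         band_function \<Lambda> w (2 * pi * \<beta> * real k - \<Lambda>) (2 * pi * \<beta> * (real k - real n)) t) +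
      (\<Sum>k<n. - of_real (1 / (2 * pi * \<Lambda>) * (Q ^ k * ((Q - 1) / (Q ^ n - 1)))) *
         band_function \<Lambda> w (2 * pi * \<beta> * (real k - real n)) (2 * pi * \<beta> * real (k + 1) - \<Lambda>) t))"

text \<open>The contributing indices form the block from k - N + 1 to k. By monotonicity in the
  index only four extreme cases matter: assumptions 1 and 2 put the band inside all windows of the
  block, while 3 and 4 put it outside those of the neighbours k + 1 and k - N.\<close>

lemma frame_operator_maps_normalised_band:
  fixes \<alpha> \<beta> w a b :: real and k N :: nat
  assumes w: "w > 0" and \<alpha>: "\<alpha> > 0" and \<beta>: "\<beta> > 0" and ab: "a \<le> b" and N: "N \<ge> 1"
  defines "\<Lambda> \<equiv> 2 * pi / \<alpha>" and "Q \<equiv> exp (4 * pi * \<beta> * w)"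
  assumes 1: "2 * pi * \<beta> * real k - \<Lambda> \<le> a" and 2: "b \<le> 2 * pi * \<beta> * (real k - real N + 1)"
    and 3: "b \<le> 2 * pi * \<beta> * (real k + 1) - \<Lambda>" and 4: "2 * pi * \<beta> * (real k - real N) \<le> a"
  shows "frame_operator_maps (gabor_system \<alpha> \<beta> (cauchy_kernel w))
    (\<lambda>t. - of_real (1 / (2 * pi * \<Lambda>) * (Q ^ k * ((Q - 1) / (Q ^ N - 1)))) * band_function \<Lambda> w a b t)
    (\<lambda>t. - band_image \<Lambda> w a b t)"
proof -
  define K where "K = {int k - int N + 1..int k}"
  define W where "W = (\<Sum>j\<in>K. exp (- (4 * pi * \<beta> * w * of_int j)))"
  have \<Lambda>: "\<Lambda> > 0" using \<alpha> by (simp add: \<Lambda>_def)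
  have mono: "2 * pi * \<beta> * x \<le> 2 * pi * \<beta> * y" if "x \<le> y" for x y using that \<beta> by (intro mult_left_mono) auto
  have "frame_operator_maps (gabor_system \<alpha> \<beta> (cauchy_kernel w)) (band_function \<Lambda> w a b)
    (\<lambda>t. of_real (2 * pi * \<Lambda> * W) * band_image \<Lambda> w a b t)"
    unfolding W_def \<Lambda>_def
  proof (rule frame_operator_maps_band_function[OF w \<alpha> ab])
    show "finite K" by (simp add: K_def)
    fix j :: int
    show "2 * pi * \<beta> * of_int j - 2 * pi / \<alpha> \<le> a \<and> b \<le> 2 * pi * \<beta> * of_int j" if "j \<in> K"
    proof -
      have "real_of_int j \<le> real k" "real k - real N + 1 \<le> of_int j" using that unfolding K_def by auto
      from mono[OF this(1)] mono[OF this(2)] show ?thesis using 1 2 unfolding \<Lambda>_def by linarith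
    qed
    show "2 * pi * \<beta> * of_int j \<le> a \<or> b \<le> 2 * pi * \<beta> * of_int j - 2 * pi / \<alpha>" if "j \<notin> K"
    proof -
      have "real_of_int j \<le> real k - real N \<or> real k + 1 \<le> of_int j"
        using that unfolding K_def by auto
      then show ?thesis
        using mono[of "of_int j" "real k - real N"] mono[of "real k + 1" "of_int j"] 3 4 unfolding \<Lambda>_def by linarith
    qed
  qed
  from frame_operator_maps_cmult[OF this]
  have "frame_operator_maps (gabor_system \<alpha> \<beta> (cauchy_kernel w))
    (\<lambda>t. - of_real (1 / (2 * pi * \<Lambda>) * (Q ^ k * ((Q - 1) / (Q ^ N - 1)))) * band_function \<Lambda> w a b t)
    (\<lambda>t. - of_real (1 / (2 * pi * \<Lambda>) * (Q ^ k * ((Q - 1) / (Q ^ N - 1)))) * (of_real (2 * pi * \<Lambda> * W) * band_image \<Lambda> w a b t))" .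
  moreover have "- of_real (1 / (2 * pi * \<Lambda>) * (Q ^ k * ((Q - 1) / (Q ^ N - 1)))) * (of_real (2 * pi * \<Lambda> * W) * B) = - B" for B :: complex
  proof -
    have "(Q ^ k * ((Q - 1) / (Q ^ N - 1))) * W = 1"
      unfolding W_def K_def Q_def by (rule sum_exp_block) (use \<beta> w N in auto)
    then have "1 / (2 * pi * \<Lambda>) * (Q ^ k * ((Q - 1) / (Q ^ N - 1))) * (2 * pi * \<Lambda> * W) = 1"
    proof -
      have "1 / (2 * pi * \<Lambda>) * y * (2 * pi * \<Lambda> * W) = y * W" for y using \<Lambda> by simp
      with \<open>(Q ^ k * ((Q - 1) / (Q ^ N - 1))) * W = 1\<close> show ?thesis by (simp only:)
    qed
    from arg_cong[OF this, of "\<lambda>x. - (complex_of_real x * B)"] show ?thesis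
      by (simp only: of_real_mult mult.assoc mult_minus_left of_real_1 mult_1)
  qed
  ultimately show ?thesis by (simp only:)
qed

text \<open>The order of the endpoints is the hypothesis on \<beta> and 1/\<alpha>:
  \<open>lower\<close> says a_k \<le> b_k and \<open>upper\<close> says b_k \<le> a_(k+1), for every
  k. Crossing a_k opens the window of index k and crossing b_k closes that of index k - n, hence
  blocks of n + 1 and n indices in turn.\<close>

lemma cauchy_dual_window_canonical:
  assumes w: "w > 0" and \<alpha>: "\<alpha> > 0" and \<beta>: "\<beta> > 0" and n: "n \<ge> 1"
    and lower: "real n * \<beta> \<le> 1 / \<alpha>" and upper: "1 / \<alpha> \<le> (real n + 1) * \<beta>"
  shows "canonical_dual_window \<alpha> \<beta> (cauchy_kernel w) (cauchy_dual_window \<alpha> \<beta> w n)"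
proof -
  define \<Lambda> where "\<Lambda> = 2 * pi / \<alpha>"
  define Q where "Q = exp (4 * pi * \<beta> * w)"
  define B where "B = 2 * pi * \<beta>"
  have \<Lambda>: "\<Lambda> > 0" using \<alpha> by (simp add: \<Lambda>_def)
  have l: "B * real n \<le> \<Lambda>" using mult_left_mono[OF lower, of "2 * pi"] by (simp add: \<Lambda>_def B_def mult_ac)
  have u: "\<Lambda> \<le> B * (real n + 1)" using mult_left_mono[OF upper, of "2 * pi"] by (simp add: \<Lambda>_def B_def mult_ac)
  note normalised = frame_operator_maps_normalised_band[OF w \<alpha> \<beta>, folded \<Lambda>_def Q_def B_def]
  let ?G = "gabor_system \<alpha> \<beta> (cauchy_kernel w)"
  let ?a = "\<lambda>k::nat. B * real k - \<Lambda>" and ?b = "\<lambda>k::nat. B * (real k - real n)"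
  have 1: "frame_operator_maps ?G
      (\<lambda>t. - of_real (1 / (2 * pi * \<Lambda>) * (Q ^ k * ((Q - 1) / (Q ^ (n + 1) - 1)))) * band_function \<Lambda> w (?a k) (?b k) t)
      (\<lambda>t. - band_image \<Lambda> w (?a k) (?b k) t)" for k
    by (rule normalised) (use l u in \<open>simp_all add: algebra_simps\<close>)
  have 2: "frame_operator_maps ?G
      (\<lambda>t. - of_real (1 / (2 * pi * \<Lambda>) * (Q ^ k * ((Q - 1) / (Q ^ n - 1)))) * band_function \<Lambda> w (?b k) (?a (k + 1)) t)
      (\<lambda>t. - band_image \<Lambda> w (?b k) (?a (k + 1)) t)" for k
    by (rule normalised) (use l u n in \<open>simp_all add: algebra_simps\<close>)
  have "frame_operator_maps ?G (cauchy_dual_window \<alpha> \<beta> w n)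
    (\<lambda>t. (\<Sum>k<n + 1. - band_image \<Lambda> w (?a k) (?b k) t) + (\<Sum>k<n. - band_image \<Lambda> w (?b k) (?a (k + 1)) t))"
    unfolding cauchy_dual_window_def[abs_def] Let_def \<Lambda>_def[symmetric] Q_def[symmetric] B_def[symmetric]
    by (intro frame_operator_maps_add frame_operator_maps_sum 1 2 gabor_cauchy_kernel_L2 w finite_lessThan)
  moreover have "(\<Sum>k<n + 1. - band_image \<Lambda> w (?a k) (?b k) t) + (\<Sum>k<n. - band_image \<Lambda> w (?b k) (?a (k + 1)) t)
      = cauchy_kernel w t" for t
  proof -
    define \<zeta> where "\<zeta> = complex_of_real t - \<i> * of_real w"
    define E where "E = 1 - exp (- \<i> * \<zeta> * of_real \<Lambda>)"
    have nz: "\<zeta> \<noteq> 0" "E \<noteq> 0"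
      using one_minus_exp_nonzero(2)[OF w \<Lambda>, of t] w unfolding E_def \<zeta>_def by simp_all
    define e where "e c = exp (\<i> * \<zeta> * complex_of_real c)" for c
    have im: "- band_image \<Lambda> w a b t = (e b - e a) / (\<zeta> * E)" for a b
      unfolding band_image_def e_def E_def \<zeta>_def by (simp add: minus_divide_left)
    have "(\<Sum>k<n + 1. - band_image \<Lambda> w (?a k) (?b k) t) + (\<Sum>k<n. - band_image \<Lambda> w (?b k) (?a (k + 1)) t)
        = ((\<Sum>k<n + 1. e (?b k) - e (?a k)) + (\<Sum>k<n. e (?a (k + 1)) - e (?b k))) / (\<zeta> * E)"
      unfolding im add_divide_distrib sum_divide_distrib ..
    also have "(\<Sum>k<n + 1. e (?b k) - e (?a k)) + (\<Sum>k<n. e (?a (k + 1)) - e (?b k)) = e (?b n) - e (?a 0)"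
      by (rule sum_telescope_interlaced)
    \<comment> \<open>The outer endpoints are 0 and -\<Lambda>, so the difference is exactly the
      denominator shared by all band images.\<close>
    also have "\<dots> = E" by (simp add: e_def E_def)
    finally show ?thesis using nz by (simp add: cauchy_kernel_def \<zeta>_def)
  qed
  ultimately show ?thesis by (simp only: canonical_dual_window_def)
qed

section \<open>Closed form and matching of the two parities\<close>

text \<open>In each of the two families all bands have the same half-width, so the sines are common
  factors. The centres, shifted by \<Lambda>/2, are equally spaced and symmetric about 0, and the
  remaining sum over \<open>k\<close> is geometric.\<close>

lemma cauchy_dual_window_closed_form:
  fixes \<alpha> \<beta> w t :: real
  assumes w: "w > 0" and \<alpha>: "\<alpha> > 0" and \<beta>: "\<beta> > 0"
  defines "z \<equiv> complex_of_real t + \<i> * of_real w" and "v \<equiv> complex_of_real w + \<i> * of_real t"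
  shows "cauchy_dual_window \<alpha> \<beta> w n t = of_real (\<alpha> / pi) * sin (of_real (pi / \<alpha>) * z) *
    (of_real ((exp (4 * pi * \<beta> * w) - 1) / (exp (4 * pi * \<beta> * w * real n) - 1)) *
     exp (- (\<i> * of_real (pi * \<beta> * (real n - 1)) * z)) *
     ((exp (of_real (2 * pi * \<beta> * real n) * v) - 1) / (exp (of_real (2 * pi * \<beta>) * v) - 1)) *
     (sin (of_real (pi * (real n + 1) * \<beta> - pi / \<alpha>) * z) / (of_real pi * z)) +
     of_real ((exp (4 * pi * \<beta> * w) - 1) / (exp (4 * pi * \<beta> * w * (real n + 1)) - 1)) *
     exp (- (\<i> * of_real (pi * \<beta> * real n) * z)) *
     ((exp (of_real (2 * pi * \<beta> * (real n + 1)) * v) - 1) / (exp (of_real (2 * pi * \<beta>) * v) - 1)) *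
     (sin (of_real (pi / \<alpha> - pi * real n * \<beta>) * z) / (of_real pi * z)))"
proof -
  define Q where "Q = exp (4 * pi * \<beta> * w)"
  define \<Lambda> where "\<Lambda> = 2 * pi / \<alpha>"
  have \<Lambda>: "\<Lambda> > 0" using \<alpha> by (simp add: \<Lambda>_def)
  have QN: "Q ^ N = exp (4 * pi * \<beta> * w * real N)" for N
    by (simp add: Q_def exp_of_nat_mult[symmetric] mult_ac)
  have block: "(\<Sum>k<N. - of_real (1 / (2 * pi * \<Lambda>) * (Q ^ k * ((Q - 1) / (Q ^ N - 1)))) * band_function \<Lambda> w (a k) (b k) t)
      = of_real (\<alpha> / pi) * sin (of_real (pi / \<alpha>) * z) *
        (of_real ((exp (4 * pi * \<beta> * w) - 1) / (exp (4 * pi * \<beta> * w * real N) - 1)) *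
         exp (- (\<i> * of_real (pi * \<beta> * (real N - 1)) * z)) *
         ((exp (of_real (2 * pi * \<beta> * real N) * v) - 1) / (exp (of_real (2 * pi * \<beta>) * v) - 1)) *
         (sin (of_real d * z) / (of_real pi * z)))"
    if mid: "\<And>k. (a k + b k) / 2 + \<Lambda> / 2 = 2 * pi * \<beta> * (real k - (real N - 1) / 2)" and d: "\<And>k. (b k - a k) / 2 = d"
    for N a b d
  proof -
    define V where "V = (Q - 1) / (Q ^ N - 1)"
    define s where "s = sin (of_real (pi / \<alpha>) * z)"
    define e where "e k = exp (\<i> * of_real (2 * pi * \<beta> * (real k - (real N - 1) / 2)) * z)" for k :: nat
    have \<Lambda>2: "\<Lambda> / 2 = pi / \<alpha>" by (simp add: \<Lambda>_def)
    have "- of_real (1 / (2 * pi * \<Lambda>) * (Q ^ k * V)) * band_function \<Lambda> w (a k) (b k) t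
        = of_real (\<alpha> / pi) * s * (of_real V * (sin (of_real d * z) / (of_real pi * z))) * (of_real (Q ^ k) * e k)" for k
    proof -
      have "band_function \<Lambda> w (a k) (b k) t = - 4 * (e k * s * sin (of_real d * z)) / z"
        unfolding band_function_sin z_def[symmetric] mid d unfolding s_def e_def \<Lambda>2 ..
      \<comment> \<open>The normalisation of a band times the 4 from the two sines; the product is
        split between the prefactor \<alpha>/pi and the divisor pi z.\<close>
      moreover have "1 / (2 * pi * \<Lambda>) * 4 = \<alpha> / pi * (1 / pi)"
        using \<alpha> by (simp add: \<Lambda>_def)
      then have "complex_of_real (1 / (2 * pi * \<Lambda>)) * 4 = of_real (\<alpha> / pi) * (1 / of_real pi)"
        by (metis of_real_mult of_real_numeral of_real_divide of_real_1)
      moreover have "- (p * (q * V')) * (- 4 * (e' * s' * x) / y) = (p * 4) * s' * (V' * (x / y)) * (q * e')"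
        for p q V' e' s' x y :: complex by simp
      ultimately show ?thesis
        by (simp only: of_real_mult) simp
    qed
    then have "(\<Sum>k<N. - of_real (1 / (2 * pi * \<Lambda>) * (Q ^ k * V)) * band_function \<Lambda> w (a k) (b k) t)
        = of_real (\<alpha> / pi) * s * (of_real V * (sin (of_real d * z) / (of_real pi * z))) * (\<Sum>k<N. of_real (Q ^ k) * e k)"
      by (simp only: sum_distrib_left)
    also have "(\<Sum>k<N. of_real (Q ^ k) * e k) = exp (- (\<i> * of_real (pi * \<beta> * (real N - 1)) * z)) *
      ((exp (of_real (2 * pi * \<beta> * real N) * v) - 1) / (exp (of_real (2 * pi * \<beta>) * v) - 1))"
      unfolding Q_def e_def z_def v_def by (rule sum_exp_modulated_block[OF \<beta> w])
    finally show ?thesis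
      unfolding V_def[symmetric] s_def[symmetric] Q_def[symmetric] QN[symmetric] by (simp only: mult_ac)
  qed
  have b1: "((2 * pi * \<beta> * real k - \<Lambda>) + 2 * pi * \<beta> * (real k - real n)) / 2 + \<Lambda> / 2
      = 2 * pi * \<beta> * (real k - (real (n + 1) - 1) / 2)"
    "(2 * pi * \<beta> * (real k - real n) - (2 * pi * \<beta> * real k - \<Lambda>)) / 2 = pi / \<alpha> - pi * real n * \<beta>" for k
    by (simp_all add: \<Lambda>_def field_simps)
  have b2: "(2 * pi * \<beta> * (real k - real n) + (2 * pi * \<beta> * real (k + 1) - \<Lambda>)) / 2 + \<Lambda> / 2
      = 2 * pi * \<beta> * (real k - (real n - 1) / 2)"
    "((2 * pi * \<beta> * real (k + 1) - \<Lambda>) - 2 * pi * \<beta> * (real k - real n)) / 2 = pi * (real n + 1) * \<beta> - pi / \<alpha>" for k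
    by (simp_all add: \<Lambda>_def field_simps)
  have r: "real (n + 1) = real n + 1" "real n + 1 - 1 = real n" by simp_all
  show ?thesis
    unfolding cauchy_dual_window_def Let_def \<Lambda>_def[symmetric] Q_def[symmetric]
      block[of "\<lambda>k. 2 * pi * \<beta> * real k - \<Lambda>" "\<lambda>k. 2 * pi * \<beta> * (real k - real n)", OF b1]
      block[of "\<lambda>k. 2 * pi * \<beta> * (real k - real n)" "\<lambda>k. 2 * pi * \<beta> * real (k + 1) - \<Lambda>", OF b2] r
    by (simp only: distrib_left add.commute)
qed

lemma canonical_dual_window_cauchy_iff_formula:
  assumes "w > 0" "\<alpha> > 0" "\<beta> > 0" "n \<ge> 1"
    and "1 / (real n + 1) \<le> \<alpha> * \<beta>" "\<alpha> * \<beta> \<le> 1 / real n"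
    and F: "\<And>t. F t = cauchy_dual_window \<alpha> \<beta> w n t"
  shows "canonical_dual_window \<alpha> \<beta> (cauchy_kernel w) \<gamma> \<longleftrightarrow> \<gamma> \<in> L2 \<and> (AE t in lborel. \<gamma> t = F t)"
proof -
  have lower: "real n * \<beta> \<le> 1 / \<alpha>" and upper: "1 / \<alpha> \<le> (real n + 1) * \<beta>"
    using assms(2-6) by (simp_all add: field_simps)
  have "1 / real n \<le> 1" using assms(4) by simp
  then have "\<alpha> * \<beta> \<le> 1" using assms(6) by linarith
  from canonical_dual_window_cauchy_iff[OF assms(1-3) this cauchy_dual_window_canonical[OF assms(1-4) lower upper]]
  show ?thesis by (simp only: F)
qed

text \<open>The even and odd formulas write one phase exp(-i pi \<beta> c z) in three ways, all by
  -i z = w - i t. In the second and third, an extra factor makes up for c - 1 and c + 1.\<close>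

lemma exp_phase_simps:
  fixes \<beta> w t c :: real
  defines "z \<equiv> complex_of_real t + \<i> * of_real w" and "v \<equiv> complex_of_real w + \<i> * of_real t"
  shows "of_real (exp (2 * pi * c * \<beta> * w)) * exp (- of_real (pi * \<beta> * c) * v) = exp (- (\<i> * of_real (pi * \<beta> * c) * z))"
    and "of_real (exp (2 * pi * (c - 1) * \<beta> * w)) * exp (- of_real (pi * \<beta> * (c - 1)) * v) *
      exp (- (of_real pi * \<i> * of_real t - of_real (pi * w)) * of_real \<beta>) = exp (- (\<i> * of_real (pi * \<beta> * c) * z))"
    and "of_real (exp (2 * pi * (c + 1) * \<beta> * w)) * exp (- of_real (pi * \<beta> * (c + 1)) * v) *
      exp ((of_real pi * \<i> * of_real t - of_real (pi * w)) * of_real \<beta>) = exp (- (\<i> * of_real (pi * \<beta> * c) * z))"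
  unfolding exp_of_real[symmetric] exp_add[symmetric]
  by (rule arg_cong[of _ _ exp]; simp add: z_def v_def complex_eq_iff algebra_simps)+

lemma mult_rearrange:
  fixes x y u r g s :: complex
  shows "x * y = m \<Longrightarrow> x * r * y * g * s = r * m * g * s"
    and "x * y * u = m \<Longrightarrow> x * r * y * g * u * s = r * m * g * s"
  by auto

(* In the literature the first summand is printed with exp ((pi*i*t - pi*w)*beta) for even n
   and with exp (2*pi*(n-1)*beta*w) for odd n. Both are misprints: for alpha*beta = 1/n with
   n even, the cases n and n-1 both apply and the printed formulas disagree. Corrected here to
   exp (-(pi*i*t - pi*w)*beta) and exp (2*pi*(n+1)*beta*w). *)
theorem mainTheorem4:
  fixes w \<alpha> \<beta> :: real and n :: nat
  assumes "w > 0" and "\<alpha> > 0" and "\<beta> > 0" and "n \<ge> 1"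
    and "1 / (real n + 1) \<le> \<alpha> * \<beta>" and "\<alpha> * \<beta> \<le> 1 / real n"
  shows
    "(even n \<longrightarrow> (let lam = 1 / (2 * \<alpha>) - real n / 2 * \<beta> in
       \<forall>\<gamma>. canonical_dual_window \<alpha> \<beta> (cauchy_kernel w) \<gamma> \<longleftrightarrow> \<gamma> \<in> L2 \<and>
       (AE t in lborel. \<gamma> t =
         of_real (\<alpha> / pi) * sin (of_real (pi / \<alpha>) * (of_real t + \<i> * of_real w)) *
         (of_real (exp (2 * pi * (real n - 2) * \<beta> * w)) *
          of_real ((exp (4 * pi * \<beta> * w) - 1) / (exp (4 * pi * \<beta> * w * real n) - 1)) *
          exp (- of_real (pi * \<beta> * (real n - 2)) * (of_real w + \<i> * of_real t)) *
          ((exp (of_real (2 * pi * \<beta> * real n) * (of_real w + \<i> * of_real t)) - 1) /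
           (exp (of_real (2 * pi * \<beta>) * (of_real w + \<i> * of_real t)) - 1)) *
          exp (- (of_real pi * \<i> * of_real t - of_real (pi * w)) * of_real \<beta>) *
          (sin (of_real (pi * (\<beta> - 2 * lam)) * (of_real t + \<i> * of_real w)) /
           (of_real pi * (of_real t + \<i> * of_real w)))
          +
          of_real (exp (2 * pi * real n * \<beta> * w)) *
          of_real ((exp (4 * pi * \<beta> * w) - 1) / (exp (4 * pi * \<beta> * w * (real n + 1)) - 1)) *
          exp (- of_real (pi * \<beta> * real n) * (of_real w + \<i> * of_real t)) *
          ((exp (of_real (2 * pi * \<beta> * (real n + 1)) * (of_real w + \<i> * of_real t)) - 1) /
           (exp (of_real (2 * pi * \<beta>) * (of_real w + \<i> * of_real t)) - 1)) *
          (sin (of_real (2 * pi * lam) * (of_real t + \<i> * of_real w)) /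
           (of_real pi * (of_real t + \<i> * of_real w)))))))
     \<and>
     (odd n \<longrightarrow> (let \<delta> = (real n + 1) / 2 * \<beta> - 1 / (2 * \<alpha>) in
       \<forall>\<gamma>. canonical_dual_window \<alpha> \<beta> (cauchy_kernel w) \<gamma> \<longleftrightarrow> \<gamma> \<in> L2 \<and>
       (AE t in lborel. \<gamma> t =
         of_real (\<alpha> / pi) * sin (of_real (pi / \<alpha>) * (of_real t + \<i> * of_real w)) *
         (of_real (exp (2 * pi * (real n + 1) * \<beta> * w)) *
          of_real ((exp (4 * pi * \<beta> * w) - 1) / (exp (4 * pi * \<beta> * w * (real n + 1)) - 1)) *
          exp (- of_real (pi * \<beta> * (real n + 1)) * (of_real w + \<i> * of_real t)) *
          ((exp (of_real (2 * pi * \<beta> * (real n + 1)) * (of_real w + \<i> * of_real t)) - 1) /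
           (exp (of_real (2 * pi * \<beta>) * (of_real w + \<i> * of_real t)) - 1)) *
          exp ((of_real pi * \<i> * of_real t - of_real (pi * w)) * of_real \<beta>) *
          (sin (of_real (pi * (\<beta> - 2 * \<delta>)) * (of_real t + \<i> * of_real w)) /
           (of_real pi * (of_real t + \<i> * of_real w)))
          +
          of_real (exp (2 * pi * (real n - 1) * \<beta> * w)) *
          of_real ((exp (4 * pi * \<beta> * w) - 1) / (exp (4 * pi * \<beta> * w * real n) - 1)) *
          exp (- of_real (pi * \<beta> * (real n - 1)) * (of_real w + \<i> * of_real t)) *
          ((exp (of_real (2 * pi * \<beta> * real n) * (of_real w + \<i> * of_real t)) - 1) /
           (exp (of_real (2 * pi * \<beta>) * (of_real w + \<i> * of_real t)) - 1)) *
          (sin (of_real (2 * pi * \<delta>) * (of_real t + \<i> * of_real w)) /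
           (of_real pi * (of_real t + \<i> * of_real w)))))))"
proof -
  note iff = canonical_dual_window_cauchy_iff_formula[OF assms]
  note closed = cauchy_dual_window_closed_form[OF assms(1-3)]
  \<comment> \<open>Both parities contain the half-widths of the two families of bands, in opposite
    order.\<close>
  have even_args: "pi * (\<beta> - 2 * (1 / (2 * \<alpha>) - real n / 2 * \<beta>)) = pi * (real n + 1) * \<beta> - pi / \<alpha>"
      "2 * pi * (1 / (2 * \<alpha>) - real n / 2 * \<beta>) = pi / \<alpha> - pi * real n * \<beta>"
    and odd_args: "pi * (\<beta> - 2 * ((real n + 1) / 2 * \<beta> - 1 / (2 * \<alpha>))) = pi / \<alpha> - pi * real n * \<beta>"
      "2 * pi * ((real n + 1) / 2 * \<beta> - 1 / (2 * \<alpha>)) = pi * (real n + 1) * \<beta> - pi / \<alpha>"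
    by (simp_all add: field_simps)
  \<comment> \<open>Brings the phase of the first even summand into the form c - 1 with c = n -
    1.\<close>
  have shift: "real n - 2 = real n - 1 - 1" by simp
  show ?thesis
    unfolding Let_def even_args odd_args shift
  proof (intro conjI impI allI, goal_cases)
    case (1 \<gamma>)
    show ?case
      by (rule iff, unfold closed, intro arg_cong2[where f = "(*)", OF refl] arg_cong2[where f = "(+)"]
           mult_rearrange exp_phase_simps)
  next
    case (2 \<gamma>)
    \<comment> \<open>For odd n the block of n + 1 indices is listed first, whereas the closed form
      starts with the block of n.\<close>
    show ?case
      by (rule iff, unfold closed, subst add.commute, intro arg_cong2[where f = "(*)", OF refl] arg_cong2[where f = "(+)"]
           mult_rearrange exp_phase_simps)
  qed
qed

end
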